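(* Let $n\geq 2$ and $T>0$. Consider $V_1$ and $V_2$ in $L^1(\mathbb{R}^n) \cap L^\infty (\mathbb{R}^n)$ such that $\sum_{k \in \mathbb{N}_0} 2^k \| V_j \|_{L^\infty (D_k)} < \infty$ for $j \in \{1, 2 \}$. Let $\mathcal{U}_T^1 $ and $ \mathcal{U}_T^2$ denote their corresponding initial-to-final-state maps. Then, \[ \mathcal{U}_T^1 = \mathcal{U}_T^2 \Rightarrow V_1 = V_2.\]
   Context: For a potential $V\in L^1((0,T);L^\infty(\mathbb{R}^n))$ (in particular a time-independent $V\in L^\infty(\mathbb{R}^n)$) and $f\in L^2(\mathbb{R}^n)$, there is a unique $u\in C([0,T];L^2(\mathbb{R}^n))$ solving $i\partial_t u = -\Delta u + Vu$ in $(0,T)\times\mathbb{R}^n$, $u(0,\cdot)=f$. The initial-to-final-state map is $\mathcal{U}_T: f\in L^2(\mathbb{R}^n)\mapsto u(T,\cdot)\in L^2(\mathbb{R}^n)$; $\mathcal{U}_T^j$ is this map for the potential $V_j$. The annuli are $D_0=\{x\in\mathbb{R}^n:|x|\leq 1\}$ and $D_k=\{x\in\mathbb{R}^n: 2^{k-1}<|x|\leq 2^k\}$ for $k\in\mathbb{N}$. *)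

theory Defs
  imports "HOL-Analysis.Analysis"
begin

definition L2 :: "(real^'n \<Rightarrow> complex) \<Rightarrow> bool" where
  "L2 f \<longleftrightarrow> f \<in> borel_measurable lebesgue \<and>
     integrable lebesgue (\<lambda>x. (cmod (f x))^2)"

definition L2norm :: "(real^'n \<Rightarrow> complex) \<Rightarrow> real" where
  "L2norm f = sqrt (\<integral>x. (cmod (f x))^2 \<partial>lebesgue)"

definition L1 :: "(real^'n \<Rightarrow> complex) \<Rightarrow> bool" where
  "L1 f \<longleftrightarrow> f \<in> borel_measurable lebesgue \<and> integrable lebesgue f"

definition Linf :: "(real^'n \<Rightarrow> complex) \<Rightarrow> bool" where
  "Linf f \<longleftrightarrow> f \<in> borel_measurable lebesgue \<and>
     (\<exists>C. AE x in lebesgue. cmod (f x) \<le> C)"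

definition Linf_norm_on :: "(real^'n \<Rightarrow> complex) \<Rightarrow> (real^'n) set \<Rightarrow> real" where
  "Linf_norm_on f D = Inf {C. C \<ge> 0 \<and> (AE x in lebesgue. x \<in> D \<longrightarrow> cmod (f x) \<le> C)}"

definition annulus :: "nat \<Rightarrow> (real^'n) set" where
  "annulus k = (if k = 0 then {x. norm x \<le> 1}
                else {x. 2^(k-1) < norm x \<and> norm x \<le> 2^k})"

fun iter_pd :: "'a::real_normed_vector list \<Rightarrow> ('a \<Rightarrow> 'b::real_normed_vector) \<Rightarrow> 'a \<Rightarrow> 'b" where
  "iter_pd [] f = f"
| "iter_pd (d # ds) f = (\<lambda>x. frechet_derivative (iter_pd ds f) (at x) d)"

definition smooth :: "('a::real_normed_vector \<Rightarrow> 'b::real_normed_vector) \<Rightarrow> bool" where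
  "smooth f \<longleftrightarrow> (\<forall>ds x. iter_pd ds f differentiable (at x))"

definition test_fun :: "real \<Rightarrow> (real \<times> (real^'n) \<Rightarrow> complex) \<Rightarrow> bool" where
  "test_fun T \<phi> \<longleftrightarrow> smooth \<phi> \<and> compact (closure {p. \<phi> p \<noteq> 0}) \<and>
     closure {p. \<phi> p \<noteq> 0} \<subseteq> {0<..<T} \<times> UNIV"

definition dt :: "(real \<times> (real^'n) \<Rightarrow> complex) \<Rightarrow> real \<times> (real^'n) \<Rightarrow> complex" where
  "dt \<phi> p = frechet_derivative \<phi> (at p) (1, 0)"

definition laplace_x :: "(real \<times> (real^'n) \<Rightarrow> complex) \<Rightarrow> real \<times> (real^'n) \<Rightarrow> complex" where
  "laplace_x \<phi> p = (\<Sum>i\<in>UNIV. iter_pd [(0, axis i 1), (0, axis i 1)] \<phi> p)"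

section \<open>Solutions of i u_t = -\<Delta>u + V u, u(0) = f, in C([0,T];L^2)\<close>

definition schrod_sol ::
  "(real^'n \<Rightarrow> complex) \<Rightarrow> real \<Rightarrow> (real^'n \<Rightarrow> complex) \<Rightarrow> (real \<Rightarrow> real^'n \<Rightarrow> complex) \<Rightarrow> bool" where
  "schrod_sol V T f u \<longleftrightarrow>
     (\<forall>t\<in>{0..T}. L2 (u t)) \<and>
     (\<forall>t\<in>{0..T}. ((\<lambda>s. L2norm (\<lambda>x. u s x - u t x)) \<longlongrightarrow> 0) (at t within {0..T})) \<and>
     (AE x in lebesgue. u 0 x = f x) \<and>
     (\<forall>\<phi>. test_fun T \<phi> \<longrightarrow>
        (LBINT t=0..T. (\<integral>x. u t x * (\<i> * dt \<phi> (t, x) - laplace_x \<phi> (t, x) + V x * \<phi> (t, x)) \<partial>lebesgue)) = 0)"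

definition same_final_map :: "(real^'n \<Rightarrow> complex) \<Rightarrow> (real^'n \<Rightarrow> complex) \<Rightarrow> real \<Rightarrow> bool" where
  "same_final_map V1 V2 T \<longleftrightarrow>
     (\<forall>f u1 u2. L2 f \<longrightarrow> schrod_sol V1 T f u1 \<longrightarrow> schrod_sol V2 T f u2 \<longrightarrow>
        (AE x in lebesgue. u1 T x = u2 T x))"

end

(* The time-dependent method of Enss and Weder.  Launch a Gaussian wave packet with large
   momentum lam in the direction theta.  It crosses the region where the potentials live in time
   O(1 / lam), and the summability condition makes the sup norm of the potentials along its path
   integrable, so each perturbed solution stays within O(1 / lam) of the free packet.  Equality of
   the final states therefore gives, up to O(1 / lam^2), the vanishing of the time integral of
   V1 - V2 against the squared modulus of the free packet.  After rescaling time by lam, the limit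
   says that the Gaussian averages of V1 - V2 integrate to zero along every half line in the
   direction theta; differentiating in the starting point shows that all Gaussian averages vanish,
   hence V1 = V2.

   The free group is the strong limit of the groups generated by difference Laplacians, and the
   perturbed solutions are built in the interaction picture. *)
theory Submission
  imports Defs
begin

section \<open>Linear evolution equations in Hilbert space\<close>

text \<open>The centre of the packet moves with speed \<open>2 * lam\<close>, so the natural
  variable is \<sigma> = \<open>2 * lam * t\<close>. A fixed \<sigma> is reached at a time tending
  to 0, before the packet has spread: the limit sees a Gaussian of the initial width, while the
  window \<open>{0..T}\<close> exhausts \<sigma> \<ge> 0. Half lines appear, not lines, because the
  packet starts at time 0.

  The obstacle is uniformity in \<open>lam\<close>. The packet bounds behind the limit are therefore
  exponentials centred at the moving point, with constants free of \<open>lam\<close>, and the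
  potentials are replaced by a decreasing radial majorant, whose integral over the half line is
  controlled by the weighted sum over the annuli.

  L2 is treated as a real Hilbert space in which multiplication by \<i> is one more operator; both
  parts of a complex pairing are recovered by testing against the packet and against \<i> times the
  packet. Unbounded generators occur only as relations between a vector and its image. The
  interaction picture keeps them out of the equation to be solved, whose coefficient is bounded and
  strongly continuous.\<close>

definition sint :: "(real \<Rightarrow> 'a::banach) \<Rightarrow> real \<Rightarrow> 'a" where
  "sint f t = integral {0..t} f - integral {t..0} f"

lemma sint_pos: "0 \<le> t \<Longrightarrow> sint f t = integral {0..t} f"
  by (cases "t = 0") (auto simp: sint_def)

lemma sint_neg:
  assumes "t \<le> 0"
  shows "sint f t = - integral {0..-t} (\<lambda>s. f (- s))"
proof -
  have "integral {t..0} f = integral {0..-t} (\<lambda>s. f (- s))"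
    using Henstock_Kurzweil_Integration.integral_reflect_real[of 0 t f] by simp
  then show ?thesis using assms by (cases "t = 0") (auto simp: sint_def)
qed

lemma has_vector_derivative_imp_continuous_on:
  assumes "\<And>t. (f has_vector_derivative f' t) (at t)"
  shows "continuous_on UNIV f"
  using assms by (auto intro!: continuous_at_imp_continuous_on has_vector_derivative_continuous)

text \<open>Groups run in both time directions, hence the oriented integral from 0. Near
  \<open>t\<close> it differs by a constant from the integral with the fixed left end
  \<open>-R\<close>, to which the fundamental theorem applies whatever the sign of
  \<open>t\<close>.\<close>

lemma sint_has_vector_derivative:
  assumes f: "continuous_on UNIV f"
  shows "(sint f has_vector_derivative f t) (at t)"
proof -
  define R where "R = \<bar>t\<bar> + 1"
  have tR: "t \<in> {-R<..<R}" by (auto simp: R_def)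
  have int: "f integrable_on {a..b}" for a b
    by (rule integrable_continuous_real) (rule continuous_on_subset[OF f], simp)
  have eq: "integral {-R..s} f - integral {-R..0} f = sint f s" if "s \<in> {-R<..<R}" for s
  proof (cases "0 \<le> s")
    case True
    have "integral {-R..0} f + integral {0..s} f = integral {-R..s} f"
      by (rule Henstock_Kurzweil_Integration.integral_combine[OF _ True int]) (simp add: R_def)
    then show ?thesis using True by (simp add: sint_pos algebra_simps)
  next
    case False
    have "integral {-R..s} f + integral {s..0} f = integral {-R..0} f"
      by (rule Henstock_Kurzweil_Integration.integral_combine[OF _ _ int]) (use that False in auto)
    then show ?thesis using False by (simp add: sint_def algebra_simps)
  qed
  have "((\<lambda>s. integral {-R..s} f) has_vector_derivative f t) (at t within {-R..R})"
    by (rule integral_has_vector_derivative) (auto intro: continuous_on_subset[OF f] simp: R_def)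
  moreover have "at t within {-R..R} = at t"
    by (rule at_within_interior) (auto simp: R_def)
  ultimately have "((\<lambda>s. integral {-R..s} f - integral {-R..0} f) has_vector_derivative f t) (at t)"
    by (auto intro!: derivative_eq_intros)
  then show ?thesis
    by (rule has_vector_derivative_transform_within_open[where S="{-R<..<R}"]) (use tR in \<open>auto simp: eq\<close>)
qed

text \<open>One integration turns a monomial bound into the next monomial with the factor
  \<open>1 / Suc k\<close>; iterated, this produces the factorials that make the Picard series
  converge. The case \<open>k = 0\<close> is the plain length estimate.\<close>

lemma norm_sint_le_power:
  fixes f :: "real \<Rightarrow> 'a::banach"
  assumes f: "continuous_on UNIV f" and bd: "\<And>s. \<bar>s\<bar> \<le> \<bar>t\<bar> \<Longrightarrow> norm (f s) \<le> c * \<bar>s\<bar> ^ k"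
  shows "norm (sint f t) \<le> c * \<bar>t\<bar> ^ Suc k / Suc k"
proof -
  have key: "norm (integral {0..r} g) \<le> c * r ^ Suc k / Suc k"
    if "0 \<le> r" "continuous_on UNIV g" "\<And>s. 0 \<le> s \<Longrightarrow> s \<le> r \<Longrightarrow> norm (g s) \<le> c * s ^ k"
    for r and g :: "real \<Rightarrow> 'a"
  proof -
    have "((\<lambda>s. c * s ^ Suc k / Suc k) has_vector_derivative c * s ^ k) (at s within {0..r})" for s
      unfolding has_real_derivative_iff_has_vector_derivative[symmetric]
      by (auto intro!: derivative_eq_intros simp del: power_Suc of_nat_Suc)
    then have "((\<lambda>s. c * s ^ k) has_integral c * r ^ Suc k / Suc k - c * 0 ^ Suc k / Suc k) {0..r}"
      by (intro fundamental_theorem_of_calculus that)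
    then have I: "((\<lambda>s. c * s ^ k) has_integral c * r ^ Suc k / Suc k) {0..r}" by simp
    have "norm (integral {0..r} g) \<le> integral {0..r} (\<lambda>s. c * s ^ k)"
    proof (rule integral_norm_bound_integral)
      show "g integrable_on {0..r}"
        by (rule integrable_continuous_real) (rule continuous_on_subset[OF that(2)], simp)
    qed (use I that in auto)
    then show ?thesis by (simp only: integral_unique[OF I])
  qed
  show ?thesis
  proof (cases "0 \<le> t")
    case True
    have "norm (integral {0..t} f) \<le> c * t ^ Suc k / Suc k"
    proof (rule key[OF True f])
      show "norm (f s) \<le> c * s ^ k" if "0 \<le> s" "s \<le> t" for s using bd[of s] that by simp
    qed
    then show ?thesis using True by (simp only: sint_pos abs_of_nonneg)
  next
    case False
    have "continuous_on UNIV (\<lambda>s. f (- s))"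
      by (intro continuous_intros continuous_on_compose2[OF f]) auto
    then have "norm (integral {0..-t} (\<lambda>s. f (- s))) \<le> c * (-t) ^ Suc k / Suc k"
    proof (rule key[rotated])
      show "norm (f (- s)) \<le> c * s ^ k" if "0 \<le> s" "s \<le> - t" for s using bd[of "- s"] that False by simp
    qed (use False in simp)
    moreover have "\<bar>t\<bar> = - t" using False by simp
    moreover have "sint f t = - integral {0..-t} (\<lambda>s. f (- s))" using False by (intro sint_neg) simp
    ultimately show ?thesis by (simp only: norm_minus_cancel)
  qed
qed

lemma sint_add:
  assumes "continuous_on UNIV f" "continuous_on UNIV g"
  shows "sint (\<lambda>s. f s + g s) t = sint f t + sint g t"
proof -
  have int: "h integrable_on {a..b}" if "continuous_on UNIV h" for h :: "real \<Rightarrow> 'a" and a b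
    by (rule integrable_continuous_real) (rule continuous_on_subset[OF that], simp)
  show ?thesis by (simp add: sint_def integral_add int assms)
qed

lemma sint_diff:
  assumes "continuous_on UNIV f" "continuous_on UNIV g"
  shows "sint (\<lambda>s. f s - g s) t = sint f t - sint g t"
proof -
  have int: "h integrable_on {a..b}" if "continuous_on UNIV h" for h :: "real \<Rightarrow> 'a" and a b
    by (rule integrable_continuous_real) (rule continuous_on_subset[OF that], simp)
  show ?thesis by (simp add: sint_def integral_diff int assms)
qed

text \<open>The operator families are continuous only strongly, not in norm. The uniform bound makes
  up for it: in \<open>A s (g s) = A s (g s - g t) + A s (g t)\<close> the first term is small
  uniformly in the operator.\<close>

lemma continuous_on_strong_apply:
  fixes A :: "real \<Rightarrow> 'a::real_normed_vector \<Rightarrow> 'b::real_normed_vector"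
  assumes lin: "\<And>t. linear (A t)" and bd: "\<And>t x. norm (A t x) \<le> C * norm x"
    and cont: "\<And>x. continuous_on UNIV (\<lambda>t. A t x)" and g: "continuous_on UNIV g"
  shows "continuous_on UNIV (\<lambda>t. A t (g t))"
proof -
  have "((\<lambda>s. A s (g s)) \<longlongrightarrow> A t (g t)) (at t)" for t
  proof -
    have g': "((\<lambda>s. g s - g t) \<longlongrightarrow> 0) (at t)"
      using g by (simp add: LIM_zero continuous_on_def)
    have "((\<lambda>s. C * norm (g s - g t)) \<longlongrightarrow> 0) (at t)"
      using tendsto_mult_right_zero[OF tendsto_norm_zero[OF g']] .
    then have "((\<lambda>s. A s (g s - g t)) \<longlongrightarrow> 0) (at t)"
      by (rule Lim_null_comparison[rotated]) (simp add: bd)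
    moreover have "((\<lambda>s. A s (g t)) \<longlongrightarrow> A t (g t)) (at t)"
      using cont[of "g t"] by (simp add: continuous_on_def)
    ultimately have "((\<lambda>s. A s (g s - g t) + A s (g t)) \<longlongrightarrow> 0 + A t (g t)) (at t)"
      by (rule tendsto_add)
    then show ?thesis using lin by (simp add: linear_diff)
  qed
  then show ?thesis by (simp add: continuous_on_def)
qed

text \<open>Picard iteration as a series: \<open>y k\<close> is a k-fold iterated integral of size
  at most \<open>(D * |t|) ^ k / fact k\<close> times \<open>norm x\<close>, so the sum converges
  uniformly on bounded time intervals. Strong continuity of \<open>A\<close> is what the interaction
  picture can offer.\<close>

lemma linear_ode_exists:
  fixes A :: "real \<Rightarrow> 'a::banach \<Rightarrow> 'a"
  assumes lin: "\<And>t. linear (A t)" and bd: "\<And>t x. norm (A t x) \<le> C * norm x"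
    and cont: "\<And>x. continuous_on UNIV (\<lambda>t. A t x)"
  shows "\<exists>y. y 0 = x \<and> (\<forall>t. (y has_vector_derivative A t (y t)) (at t))"
proof -
  define y where "y = rec_nat (\<lambda>t. x) (\<lambda>k z t. sint (\<lambda>s. A s (z s)) t)"
  have y0: "y 0 = (\<lambda>t. x)" and ySuc: "y (Suc k) = (\<lambda>t. sint (\<lambda>s. A s (y k s)) t)" for k
    by (simp_all add: y_def)
  note comp = continuous_on_strong_apply[OF lin bd cont]
  have sint_cont: "continuous_on UNIV (sint f)" if "continuous_on UNIV f" for f :: "real \<Rightarrow> 'a"
    by (rule has_vector_derivative_imp_continuous_on[OF sint_has_vector_derivative[OF that]])
  have ycont: "continuous_on UNIV (y k)" for k
    by (induction k) (auto simp: y0 ySuc intro!: sint_cont[unfolded eta_contract_eq] comp)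
  \<comment> \<open>\<open>C\<close> carries no sign, while powers of it occur as bounds.\<close>
  define D where "D = \<bar>C\<bar>"
  have D: "norm (A t x) \<le> D * norm x" "0 \<le> D" for t x
    unfolding D_def using order_trans[OF bd mult_right_mono[OF abs_ge_self norm_ge_zero]] by auto
  have ybd: "norm (y k t) \<le> norm x * D ^ k / fact k * \<bar>t\<bar> ^ k" for k t
  proof (induction k arbitrary: t)
    case (Suc k)
    have "norm (y (Suc k) t) \<le> (D * (norm x * D ^ k / fact k)) * \<bar>t\<bar> ^ Suc k / Suc k"
      unfolding ySuc
    proof (rule norm_sint_le_power[OF comp[OF ycont]])
      fix s
      have "norm (A s (y k s)) \<le> D * norm (y k s)" by (rule D)
      also have "\<dots> \<le> D * (norm x * D ^ k / fact k * \<bar>s\<bar> ^ k)" using Suc D by (intro mult_left_mono)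
      finally show "norm (A s (y k s)) \<le> D * (norm x * D ^ k / fact k) * \<bar>s\<bar> ^ k" by (simp add: mult.assoc)
    qed
    then show ?case by (simp add: field_simps)
  qed (simp add: y0)
  define Y where "Y t = (\<Sum>k. y k t)" for t
  define S where "S n t = (\<Sum>k<n. y k t)" for n t
  have unif: "uniform_limit {-R..R} S Y sequentially" for R
    unfolding S_def Y_def
  proof (rule Weierstrass_m_test)
    fix k s assume "s \<in> {-R..R}"
    then have "\<bar>s\<bar> ^ k \<le> \<bar>R\<bar> ^ k" by (intro power_mono) auto
    then have "norm x * D ^ k / fact k * \<bar>s\<bar> ^ k \<le> norm x * D ^ k / fact k * \<bar>R\<bar> ^ k"
      using D by (intro mult_left_mono) auto
    then show "norm (y k s) \<le> norm x * ((D * \<bar>R\<bar>) ^ k / fact k)"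
      using ybd[of k s] by (simp add: power_mult_distrib field_simps)
  next
    have "summable (\<lambda>k. (D * \<bar>R\<bar>) ^ k / fact k)"
      using summable_exp[of "D * \<bar>R\<bar>"] by (simp add: field_simps)
    then show "summable (\<lambda>k. norm x * ((D * \<bar>R\<bar>) ^ k / fact k))" by (rule summable_mult)
  qed
  have Scont: "continuous_on UNIV (S n)" for n
    unfolding S_def using ycont by (intro continuous_intros)
  have Ycont: "continuous_on UNIV Y"
  proof (rule continuous_at_imp_continuous_on, rule ballI)
    fix t
    have "continuous_on {-(\<bar>t\<bar>+1)..\<bar>t\<bar>+1} Y"
      by (rule uniform_limit_theorem[OF _ unif]) (auto intro!: always_eventually continuous_on_subset[OF Scont])
    then show "isCont Y t"
      by (rule continuous_on_interior) (auto simp: interior_atLeastAtMost_real)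
  qed
  have SSuc: "S (Suc n) t = x + sint (\<lambda>s. A s (S n s)) t" for n t
  proof (induction n)
    case 0
    have "(\<lambda>s. A s 0) = (\<lambda>s. 0)" using lin by (auto simp: linear_0)
    then show ?case by (simp add: S_def y0 sint_def)
  next
    case (Suc n)
    have "S (Suc (Suc n)) t = S (Suc n) t + y (Suc n) t" by (simp add: S_def)
    also have "\<dots> = x + (sint (\<lambda>s. A s (S n s)) t + sint (\<lambda>s. A s (y n s)) t)"
      unfolding Suc ySuc by simp
    also have "\<dots> = x + sint (\<lambda>s. A s (S n s) + A s (y n s)) t"
      by (subst sint_add) (auto intro!: comp Scont ycont)
    also have "(\<lambda>s. A s (S n s) + A s (y n s)) = (\<lambda>s. A s (S (Suc n) s))"
      using lin by (simp add: S_def linear_add)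
    finally show ?case .
  qed
  have Yeq: "Y t = x + sint (\<lambda>s. A s (Y s)) t" for t
  proof -
    have "norm (Y t - x - sint (\<lambda>s. A s (Y s)) t) \<le> e" if "e > 0" for e
    proof -
      \<comment> \<open>Chosen so that the two errors below, \<open>d\<close> and
        \<open>D * d * |t|\<close>, add up to \<open>e\<close>.\<close>
      define d where "d = e / (1 + D * \<bar>t\<bar>)"
      have pos: "1 + D * \<bar>t\<bar> > 0" using D by (simp add: add_pos_nonneg)
      have "d > 0" using that pos by (simp add: d_def)
      then obtain N where N: "\<And>n s. n \<ge> N \<Longrightarrow> s \<in> {-\<bar>t\<bar>..\<bar>t\<bar>} \<Longrightarrow> dist (S n s) (Y s) < d"
        using unif[of "\<bar>t\<bar>"] unfolding uniform_limit_iff eventually_sequentially by meson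
      have a: "norm (Y t - S (Suc N) t) \<le> d"
        using N[of "Suc N" t] abs_le_iff[of t "\<bar>t\<bar>"] by (simp add: dist_norm norm_minus_commute)
      have eq: "sint (\<lambda>s. A s (S N s)) t - sint (\<lambda>s. A s (Y s)) t = sint (\<lambda>s. A s (S N s) - A s (Y s)) t"
        by (rule sint_diff[symmetric]) (auto intro!: comp Scont Ycont)
      have "norm (sint (\<lambda>s. A s (S N s) - A s (Y s)) t) \<le> D * d * \<bar>t\<bar> ^ Suc 0 / Suc 0"
      proof (rule norm_sint_le_power)
        show "continuous_on UNIV (\<lambda>s. A s (S N s) - A s (Y s))"
          by (intro continuous_intros comp Scont Ycont)
        fix s assume s: "\<bar>s\<bar> \<le> \<bar>t\<bar>"
        have "norm (A s (S N s) - A s (Y s)) = norm (A s (S N s - Y s))" using lin by (simp add: linear_diff)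
        also have "\<dots> \<le> D * norm (S N s - Y s)" by (rule D)
        also have "\<dots> \<le> D * d" using N[of N s] s D by (intro mult_left_mono) (auto simp: dist_norm abs_le_iff)
        finally show "norm (A s (S N s) - A s (Y s)) \<le> D * d * \<bar>s\<bar> ^ 0" by simp
      qed
      then have b: "norm (sint (\<lambda>s. A s (S N s)) t - sint (\<lambda>s. A s (Y s)) t) \<le> D * d * \<bar>t\<bar>"
        by (simp add: eq)
      have "Y t - x - sint (\<lambda>s. A s (Y s)) t = (Y t - S (Suc N) t) +
          (sint (\<lambda>s. A s (S N s)) t - sint (\<lambda>s. A s (Y s)) t)"
        by (simp add: SSuc)
      then have "norm (Y t - x - sint (\<lambda>s. A s (Y s)) t) \<le> d + D * d * \<bar>t\<bar>"
        by (simp only:) (rule norm_triangle_mono[OF a b])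
      also have "\<dots> = d * (1 + D * \<bar>t\<bar>)" by (simp add: algebra_simps)
      also have "\<dots> = e" using pos by (simp add: d_def)
      finally show ?thesis .
    qed
    then have "norm (Y t - x - sint (\<lambda>s. A s (Y s)) t) \<le> 0" by (rule field_le_epsilon[of _ 0, simplified])
    then show ?thesis by (simp add: algebra_simps)
  qed
  have "(Y has_vector_derivative A t (Y t)) (at t)" for t
  proof -
    have "((\<lambda>t. x + sint (\<lambda>s. A s (Y s)) t) has_vector_derivative 0 + A t (Y t)) (at t)"
      by (intro has_vector_derivative_add has_vector_derivative_const
          sint_has_vector_derivative[of "\<lambda>s. A s (Y s)"] comp[OF Ycont])
    then show ?thesis by (subst (asm) Yeq[symmetric]) simp
  qed
  moreover have "Y 0 = x" using Yeq[of 0] by (simp add: sint_def)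
  ultimately show ?thesis by blast
qed

text \<open>In quotient form a derivative is a plain limit, so operators can be applied to it and
  the base point can be shifted by rewriting.\<close>

lemma has_vector_derivative_quotient_iff:
  "(f has_vector_derivative D) (at t) \<longleftrightarrow> ((\<lambda>h. (1 / h) *\<^sub>R (f (t + h) - f t)) \<longlongrightarrow> D) (at (0::real))"
proof -
  have "(f has_vector_derivative D) (at t) \<longleftrightarrow>
      ((\<lambda>h. norm (f (t + h) - f t - h *\<^sub>R D) / norm h) \<longlongrightarrow> 0) (at 0)"
    by (simp add: has_vector_derivative_def has_derivative_at bounded_linear_scaleR_left)
  also have "\<dots> \<longleftrightarrow> ((\<lambda>h. norm ((1 / h) *\<^sub>R (f (t + h) - f t) - D)) \<longlongrightarrow> 0) (at 0)"
  proof (rule filterlim_cong[OF refl refl])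
    have "norm (f (t + h) - f t - h *\<^sub>R D) / norm h = norm ((1 / h) *\<^sub>R (f (t + h) - f t) - D)" if "h \<noteq> 0" for h
    proof -
      have "(1 / h) *\<^sub>R (f (t + h) - f t) - D = (1 / h) *\<^sub>R (f (t + h) - f t - h *\<^sub>R D)"
        using that by (simp add: scaleR_diff_right)
      then show ?thesis by (simp add: divide_inverse mult.commute)
    qed
    then show "\<forall>\<^sub>F h in at 0. norm (f (t + h) - f t - h *\<^sub>R D) / norm h = norm ((1 / h) *\<^sub>R (f (t + h) - f t) - D)"
      by (simp add: eventually_at_filter)
  qed
  also have "\<dots> \<longleftrightarrow> ((\<lambda>h. (1 / h) *\<^sub>R (f (t + h) - f t)) \<longlongrightarrow> D) (at 0)"
    by (simp add: tendsto_norm_zero_iff LIM_zero_iff)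
  finally show ?thesis .
qed

lemma tendsto_strong_apply:
  fixes F :: "'i \<Rightarrow> 'a::real_normed_vector \<Rightarrow> 'b::real_normed_vector"
  assumes lin: "\<And>t. linear (F t)" and bd: "\<And>t x. norm (F t x) \<le> C * norm x"
    and F: "((\<lambda>t. F t y) \<longlongrightarrow> z) G" and g: "(g \<longlongrightarrow> y) G"
  shows "((\<lambda>t. F t (g t)) \<longlongrightarrow> z) G"
proof -
  have "((\<lambda>t. C * norm (g t - y)) \<longlongrightarrow> 0) G"
    using tendsto_mult_right_zero[OF tendsto_norm_zero[OF g[THEN LIM_zero]]] .
  then have "((\<lambda>t. F t (g t - y)) \<longlongrightarrow> 0) G"
    by (rule Lim_null_comparison[rotated]) (simp add: bd)
  from tendsto_add[OF this F] show ?thesis using lin by (simp add: linear_diff)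
qed

lemma has_vector_derivative_strong_apply:
  fixes F :: "real \<Rightarrow> 'a::real_normed_vector \<Rightarrow> 'b::real_normed_vector"
  assumes lin: "\<And>t. linear (F t)" and bd: "\<And>t x. norm (F t x) \<le> C * norm x"
    and cont: "\<And>x. continuous_on UNIV (\<lambda>t. F t x)"
    and dF: "((\<lambda>s. F s (g t)) has_vector_derivative d) (at t)"
    and dg: "(g has_vector_derivative g') (at t)"
  shows "((\<lambda>s. F s (g s)) has_vector_derivative d + F t g') (at t)"
proof -
  have g: "((\<lambda>h. (1 / h) *\<^sub>R (g (t + h) - g t)) \<longlongrightarrow> g') (at 0)"
    using dg by (simp add: has_vector_derivative_quotient_iff)
  have "isCont (\<lambda>s. F s g') t" using cont by (simp add: continuous_on_eq_continuous_at)
  then have "((\<lambda>h. F (t + h) g') \<longlongrightarrow> F t g') (at 0)" by (simp add: isCont_iff)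
  then have "((\<lambda>h. F (t + h) ((1 / h) *\<^sub>R (g (t + h) - g t))) \<longlongrightarrow> F t g') (at 0)"
    by (rule tendsto_strong_apply[of "\<lambda>h. F (t + h)", OF lin bd _ g])
  moreover have "((\<lambda>h. (1 / h) *\<^sub>R (F (t + h) (g t) - F t (g t))) \<longlongrightarrow> d) (at 0)"
    using dF by (simp add: has_vector_derivative_quotient_iff)
  ultimately have "((\<lambda>h. (1 / h) *\<^sub>R (F (t + h) (g t) - F t (g t)) +
      F (t + h) ((1 / h) *\<^sub>R (g (t + h) - g t))) \<longlongrightarrow> d + F t g') (at 0)"
    by (intro tendsto_add)
  moreover have "(\<lambda>h. (1 / h) *\<^sub>R (F (t + h) (g t) - F t (g t)) + F (t + h) ((1 / h) *\<^sub>R (g (t + h) - g t)))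
      = (\<lambda>h. (1 / h) *\<^sub>R (F (t + h) (g (t + h)) - F t (g t)))"
    using lin by (simp add: fun_eq_iff linear_diff linear_scale algebra_simps)
  ultimately show ?thesis by (simp add: has_vector_derivative_quotient_iff)
qed

section \<open>Isometric flows of bounded skew operators and their limits\<close>

definition flow :: "('a \<Rightarrow> 'a) \<Rightarrow> real \<Rightarrow> 'a \<Rightarrow> 'a::{real_inner, banach}" where
  "flow B t x = (SOME y. y 0 = x \<and> (\<forall>t. (y has_vector_derivative B (y t)) (at t))) t"

lemma skew_solution_norm:
  fixes y :: "real \<Rightarrow> 'a::real_inner"
  assumes skew: "\<And>x y. inner (B x) y = - inner x (B y)"
    and y: "\<And>t. (y has_vector_derivative B (y t)) (at t)"
  shows "norm (y t) = norm (y 0)"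
proof -
  have B0: "inner (B x) x = 0" for x using skew[of x x] by (simp add: inner_commute)
  have "((\<lambda>t. inner (y t) (y t)) has_real_derivative 0) (at t)" for t
  proof -
    have "((\<lambda>t. inner (y t) (y t)) has_vector_derivative inner (y t) (B (y t)) + inner (B (y t)) (y t)) (at t)"
      by (rule bounded_bilinear.has_vector_derivative[OF bounded_bilinear_inner y y])
    then show ?thesis using B0[of "y t"]
      by (simp add: has_real_derivative_iff_has_vector_derivative inner_commute)
  qed
  then have "inner (y t) (y t) = inner (y 0) (y 0)"
    using DERIV_isconst_all[of "\<lambda>t. inner (y t) (y t)"] by blast
  then show ?thesis by (simp add: norm_eq)
qed

locale skew_operator =
  fixes B :: "'a::{real_inner, banach} \<Rightarrow> 'a"
  assumes bounded: "bounded_linear B" and skew: "\<And>x y. inner (B x) y = - inner x (B y)"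
begin

lemma flow_exists: "\<exists>y. y 0 = x \<and> (\<forall>t. (y has_vector_derivative B (y t)) (at t))"
proof (rule linear_ode_exists)
  show "linear B" using bounded by (simp add: bounded_linear.linear)
  show "norm (B x) \<le> onorm B * norm x" for x by (rule onorm[OF bounded])
qed simp

lemma flow_0 [simp]: "flow B 0 x = x"
  and flow_deriv: "((\<lambda>t. flow B t x) has_vector_derivative B (flow B t x)) (at t)"
  using someI_ex[OF flow_exists[of x]] by (auto simp: flow_def)

lemma flow_unique:
  assumes "\<And>t. (y has_vector_derivative B (y t)) (at t)"
  shows "y t = flow B t (y 0)"
proof -
  define z where "z t = y t - flow B t (y 0)" for t
  have "(z has_vector_derivative B (z t)) (at t)" for t
  proof -
    have "B (y t - flow B t (y 0)) = B (y t) - B (flow B t (y 0))"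
      using bounded by (simp add: bounded_linear.linear linear_diff)
    then show ?thesis unfolding z_def using has_vector_derivative_diff[OF assms[of t] flow_deriv[of "y 0" t]] by simp
  qed
  then have "norm (z t) = norm (z 0)" by (rule skew_solution_norm[OF skew])
  then show ?thesis by (simp add: z_def)
qed

lemma flow_norm [simp]: "norm (flow B t x) = norm x"
  using skew_solution_norm[of B "\<lambda>t. flow B t x" t, OF skew flow_deriv] by simp

lemma flow_linear: "linear (flow B t)"
proof (rule linearI)
  interpret bounded_linear B by (rule bounded)
  show "flow B t (x + y) = flow B t x + flow B t y" for x y
    using flow_unique[of "\<lambda>t. flow B t x + flow B t y" t]
      has_vector_derivative_add[OF flow_deriv flow_deriv] by (simp add: add)
  show "flow B t (r *\<^sub>R x) = r *\<^sub>R flow B t x" for r x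
    using flow_unique[of "\<lambda>t. r *\<^sub>R flow B t x" t]
      bounded_linear.has_vector_derivative[OF bounded_linear_scaleR_right flow_deriv] by (simp add: scaleR)
qed

lemma flow_commute:
  assumes C: "bounded_linear C" and "\<And>x. B (C x) = C (B x)"
  shows "C (flow B t x) = flow B t (C x)"
  using flow_unique[of "\<lambda>t. C (flow B t x)" t] bounded_linear.has_vector_derivative[OF C flow_deriv]
  by (simp add: assms(2))

lemma flow_continuous: "continuous_on UNIV (\<lambda>t. flow B t x)"
  by (rule has_vector_derivative_imp_continuous_on[OF flow_deriv])

lemma flow_flow: "flow B t (flow B s x) = flow B (t + s) x"
proof -
  have "((\<lambda>t. flow B (t + s) x) has_vector_derivative B (flow B (t + s) x)) (at t)" for t
    using flow_deriv[of x "t + s"] unfolding has_vector_derivative_quotient_iff by (simp add: add_ac)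
  from flow_unique[OF this, of t] show ?thesis by simp
qed

text \<open>\<open>B\<close> commutes with its own flow, so the orbit has the constant speed
  \<open>norm (B x)\<close>.\<close>

lemma flow_displacement: "norm (flow B t x - x) \<le> \<bar>t\<bar> * norm (B x)"
proof -
  have "norm (flow B t x - flow B 0 x) \<le> norm (B x) * norm (t - 0)"
  proof (rule differentiable_bound[OF convex_UNIV, where f' = "\<lambda>t h. h *\<^sub>R B (flow B t x)"])
    fix s
    show "((\<lambda>t. flow B t x) has_derivative (\<lambda>h. h *\<^sub>R B (flow B s x))) (at s within UNIV)"
      using flow_deriv[of x s] by (simp add: has_vector_derivative_def)
    have "norm (B (flow B s x)) = norm (B x)" using flow_commute[OF bounded, of s x] by simp
    then show "onorm (\<lambda>h. h *\<^sub>R B (flow B s x)) \<le> norm (B x)"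
      by (intro onorm_le) (simp add: mult.commute)
  qed auto
  then show ?thesis by (simp add: mult.commute)
qed

end

text \<open>For commuting generators the flow of \<open>B\<close> is the flow of \<open>C\<close>
  composed with that of \<open>B - C\<close>. The flow of \<open>C\<close> is an isometry and drops
  out, which leaves a displacement under the flow of \<open>B - C\<close>. The estimate involves the
  generators at the one vector \<open>x\<close> and no operator norm; this is what permits an
  unbounded limit.\<close>

lemma flow_compare:
  assumes B: "skew_operator B" and C: "skew_operator C" and comm: "\<And>x. B (C x) = C (B x)"
  shows "norm (flow B t x - flow C t x) \<le> \<bar>t\<bar> * norm (B x - C x)"
proof -
  interpret B: skew_operator B by fact
  interpret C: skew_operator C by fact
  have S: "skew_operator (\<lambda>x. B x - C x)"
  proof (rule skew_operator.intro)
    show "bounded_linear (\<lambda>x. B x - C x)" by (intro bounded_linear_sub B.bounded C.bounded)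
    show "inner (B x - C x) y = - inner x (B y - C y)" for x y
      by (simp add: inner_diff_left inner_diff_right B.skew C.skew)
  qed
  interpret S: skew_operator "\<lambda>x. B x - C x" by (rule S)
  have SC: "B (flow (\<lambda>x. B x - C x) t x) - C (flow (\<lambda>x. B x - C x) t x) =
      flow (\<lambda>x. B x - C x) t (B x - C x)" for t x
    by (rule S.flow_commute[OF S.bounded]) simp
  have lB: "linear B" and lC: "linear C" using B.bounded C.bounded by (auto simp: bounded_linear.linear)
  define y where "y t = flow C t (flow (\<lambda>x. B x - C x) t x)" for t
  have "(y has_vector_derivative B (y t)) (at t)" for t
  proof -
    let ?S = "flow (\<lambda>x. B x - C x) t x"
    have "(y has_vector_derivative C (flow C t ?S) + flow C t (B ?S - C ?S)) (at t)"
      unfolding y_def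
      by (rule has_vector_derivative_strong_apply[where C=1])
         (auto intro: C.flow_linear C.flow_continuous C.flow_deriv S.flow_deriv)
    moreover have "B (flow C t ?S) = flow C t (B ?S)" "C (flow C t ?S) = flow C t (C ?S)"
      by (rule C.flow_commute; simp add: B.bounded C.bounded comm)+
    ultimately show ?thesis using C.flow_linear[of t] by (simp add: y_def linear_diff)
  qed
  from B.flow_unique[OF this, of t] have "flow B t x = y t" by (simp add: y_def)
  then have "flow B t x - flow C t x = flow C t (flow (\<lambda>x. B x - C x) t x - x)"
    using C.flow_linear[of t] by (simp add: y_def linear_diff)
  then show ?thesis using S.flow_displacement[of t x] by simp
qed

text \<open>Where \<open>B k y\<close> converges, \<open>flow_compare\<close> makes the flows
  Cauchy, uniformly for bounded times, and isometry carries this from the dense set to all vectors.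
  Commutation of the \<open>B k\<close> is what reduces the comparison of flows to a comparison of
  generators at one vector.\<close>

lemma flow_limit_exists:
  fixes B :: "nat \<Rightarrow> 'a::{real_inner, banach} \<Rightarrow> 'a"
  assumes B: "\<And>k. skew_operator (B k)" and comm: "\<And>k l x. B k (B l x) = B l (B k x)"
    and dense: "\<And>x e. e > 0 \<Longrightarrow> \<exists>y. norm (y - x) < e \<and> convergent (\<lambda>k. B k y)"
  obtains U :: "real \<Rightarrow> 'a \<Rightarrow> 'a" where "\<And>t. linear (U t)" "\<And>t x. norm (U t x) = norm x" "\<And>x. U 0 x = x"
    "\<And>t x. U t (U (- t) x) = x" "\<And>x. continuous_on UNIV (\<lambda>t. U t x)"
    "\<And>x y t. (\<lambda>k. B k x) \<longlonglongrightarrow> y \<Longrightarrow> ((\<lambda>t. U t x) has_vector_derivative U t y) (at t)"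
proof -
  note lin = skew_operator.flow_linear[OF B]
  note nrm = skew_operator.flow_norm[OF B]
  have ucauchy: "uniformly_Cauchy_on {-R..R} (\<lambda>k t. flow (B k) t x)" for x R
  proof (rule uniformly_Cauchy_onI)
    fix e :: real assume "e > 0"
    then obtain y where y: "norm (y - x) < e / 4" "convergent (\<lambda>k. B k y)" using dense[of "e/4" x] by auto
    \<comment> \<open>Generators within \<open>d\<close> give flows within \<open>e / 4\<close> over
      times up to \<open>|R|\<close>; replacing \<open>x\<close> by \<open>y\<close> in each of the
      two flows costs another \<open>e / 4\<close>.\<close>
    define d where "d = e / (4 * (\<bar>R\<bar> + 1))"
    have d: "d > 0" "\<bar>R\<bar> * d \<le> e / 4" using \<open>e > 0\<close> by (auto simp: d_def field_simps)
    obtain M where M: "\<And>m n. m \<ge> M \<Longrightarrow> n \<ge> M \<Longrightarrow> dist (B m y) (B n y) < d"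
      using convergent_Cauchy[OF y(2)] d(1) unfolding Cauchy_def by meson
    have "dist (flow (B m) t x) (flow (B n) t x) < e" if "m \<ge> M" "n \<ge> M" "t \<in> {-R..R}" for m n t
    proof -
      have 1: "norm (flow (B m) t y - flow (B n) t y) \<le> e / 4"
      proof -
        have "norm (flow (B m) t y - flow (B n) t y) \<le> \<bar>t\<bar> * norm (B m y - B n y)"
          by (rule flow_compare[of "B m" "B n", OF B B comm])
        also have "\<dots> \<le> \<bar>R\<bar> * d"
          using M[of m n] that by (intro mult_mono) (auto simp: dist_norm)
        finally show ?thesis using d by simp
      qed
      have 2: "norm (flow (B k) t x - flow (B k) t y) < e / 4" for k
        using nrm[of k t "x - y"] y(1) lin[of k t] by (simp add: linear_diff norm_minus_commute)
      have "flow (B m) t x - flow (B n) t x = (flow (B m) t x - flow (B m) t y) +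
          (flow (B m) t y - flow (B n) t y) - (flow (B n) t x - flow (B n) t y)" by simp
      from arg_cong[OF this, of norm]
      have "norm (flow (B m) t x - flow (B n) t x) \<le> norm (flow (B m) t x - flow (B m) t y) +
          norm (flow (B m) t y - flow (B n) t y) + norm (flow (B n) t x - flow (B n) t y)"
        using norm_triangle_ineq4[of "(flow (B m) t x - flow (B m) t y) + (flow (B m) t y - flow (B n) t y)"
            "flow (B n) t x - flow (B n) t y"]
          norm_triangle_ineq[of "flow (B m) t x - flow (B m) t y" "flow (B m) t y - flow (B n) t y"] by linarith
      then show ?thesis using 1 2[of m] 2[of n] \<open>e > 0\<close> by (simp add: dist_norm)
    qed
    then show "\<exists>M. \<forall>t\<in>{-R..R}. \<forall>m\<ge>M. \<forall>n\<ge>M. dist (flow (B m) t x) (flow (B n) t x) < e" by blast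
  qed
  define U where "U t x = lim (\<lambda>k. flow (B k) t x)" for t x
  have unif: "uniform_limit {-R..R} (\<lambda>k t. flow (B k) t x) (\<lambda>t. U t x) sequentially" for R x
    using Cauchy_uniformly_convergent[OF ucauchy[of R x]]
    unfolding U_def uniformly_convergent_uniform_limit_iff .
  have lim: "(\<lambda>k. flow (B k) t x) \<longlonglongrightarrow> U t x" for t x
  proof -
    have "t \<in> {-\<bar>t\<bar>..\<bar>t\<bar>}" by auto
    from tendsto_uniform_limitI[OF unif this] show ?thesis .
  qed
  have Ulin: "linear (U t)" for t
  proof (rule linearI)
    show "U t (x + y) = U t x + U t y" for x y
      using tendsto_add[OF lim[of t x] lim[of t y]] lim[of t "x + y"] lin
      by (auto simp: linear_add intro: LIMSEQ_unique)
    show "U t (r *\<^sub>R x) = r *\<^sub>R U t x" for r x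
      using tendsto_scaleR[OF tendsto_const[of r] lim[of t x]] lim[of t "r *\<^sub>R x"] lin
      by (auto simp: linear_scale intro: LIMSEQ_unique)
  qed
  have Unorm: "norm (U t x) = norm x" for t x
    using tendsto_norm[OF lim[of t x]] nrm by (simp add: LIMSEQ_const_iff)
  have Uinv: "U t (U (- t) x) = x" for t x
  proof -
    have "(\<lambda>k. flow (B k) t (flow (B k) (- t) x)) \<longlonglongrightarrow> U t (U (- t) x)"
      by (rule tendsto_strong_apply[where C=1, OF lin _ lim lim]) (simp add: nrm)
    moreover have "flow (B k) t (flow (B k) (- t) x) = x" for k
      using skew_operator.flow_flow[OF B] skew_operator.flow_0[OF B] by simp
    ultimately show ?thesis by (simp add: LIMSEQ_const_iff)
  qed
  have Ucont: "continuous_on UNIV (\<lambda>t. U t x)" for x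
  proof (rule continuous_at_imp_continuous_on, rule ballI)
    fix t
    have "continuous_on {-(\<bar>t\<bar>+1)..\<bar>t\<bar>+1} (\<lambda>t. U t x)"
      by (rule uniform_limit_theorem[OF _ unif])
        (auto intro!: always_eventually continuous_on_subset[OF skew_operator.flow_continuous[OF B]])
    then show "isCont (\<lambda>t. U t x) t"
      by (rule continuous_on_interior) (auto simp: interior_atLeastAtMost_real)
  qed
  have Uder: "((\<lambda>t. U t x) has_vector_derivative U t y) (at t)" if xy: "(\<lambda>k. B k x) \<longlonglongrightarrow> y" for x y t
  proof -
    define R where "R = \<bar>t\<bar> + 1"
    \<comment> \<open>The velocities are \<open>flow (B k) s (B k x)\<close>, because
      \<open>B k\<close> commutes with its flow, and they converge to \<open>U s y\<close> uniformly
      on \<open>{-R..R}\<close>. Hence limit and differentiation may be exchanged.\<close>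
    have "\<exists>g. \<forall>s\<in>{-R..R}. (\<lambda>k. flow (B k) s x) \<longlonglongrightarrow> g s \<and>
        (g has_derivative (\<lambda>h. h *\<^sub>R U s y)) (at s within {-R..R})"
    proof (rule has_derivative_sequence[where f' = "\<lambda>k s h. h *\<^sub>R flow (B k) s (B k x)"])
      fix k s
      have "B k (flow (B k) s x) = flow (B k) s (B k x)"
        by (rule skew_operator.flow_commute[OF B skew_operator.bounded[OF B] refl])
      then show "((\<lambda>t. flow (B k) t x) has_derivative (\<lambda>h. h *\<^sub>R flow (B k) s (B k x))) (at s within {-R..R})"
        using skew_operator.flow_deriv[OF B, of k x s]
        by (simp add: has_vector_derivative_def has_derivative_at_withinI)
    next
      fix e :: real assume e: "e > 0"
      have "\<forall>\<^sub>F k in sequentially. \<forall>s\<in>{-R..R}. dist (flow (B k) s y) (U s y) < e / 2"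
        using unif[where R = R and x = y] e unfolding uniform_limit_iff by (meson half_gt_zero)
      moreover have "\<forall>\<^sub>F k in sequentially. dist (B k x) y < e / 2"
        using tendstoD[OF xy, of "e / 2"] e by simp
      ultimately show "\<forall>\<^sub>F k in sequentially. \<forall>s\<in>{-R..R}. \<forall>h.
          norm (h *\<^sub>R flow (B k) s (B k x) - h *\<^sub>R U s y) \<le> e * norm h"
      proof eventually_elim
        case (elim k)
        show ?case
        proof (intro ballI allI)
          fix s h assume s: "s \<in> {-R..R}"
          have "flow (B k) s (B k x) - U s y = flow (B k) s (B k x - y) + (flow (B k) s y - U s y)"
            using lin by (simp add: linear_diff)
          then have "norm (flow (B k) s (B k x) - U s y) \<le> norm (B k x - y) + norm (flow (B k) s y - U s y)"
            using norm_triangle_ineq[of "flow (B k) s (B k x - y)" "flow (B k) s y - U s y"] by (simp add: nrm algebra_simps)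
          also have "\<dots> \<le> e" using elim s by (force simp: dist_norm)
          finally have "norm (h *\<^sub>R (flow (B k) s (B k x) - U s y)) \<le> e * norm h"
            unfolding norm_scaleR real_norm_def by (subst mult.commute[of e]) (rule mult_left_mono, simp_all)
          then show "norm (h *\<^sub>R flow (B k) s (B k x) - h *\<^sub>R U s y) \<le> e * norm h"
            by (simp add: scaleR_diff_right)
        qed
      qed
    qed (use lim in \<open>auto simp: R_def\<close>)
    then obtain g where g: "\<And>s. s \<in> {-R..R} \<Longrightarrow> (\<lambda>k. flow (B k) s x) \<longlonglongrightarrow> g s"
      "\<And>s. s \<in> {-R..R} \<Longrightarrow> (g has_derivative (\<lambda>h. h *\<^sub>R U s y)) (at s within {-R..R})" by blast
    have gU: "g s = U s x" if "s \<in> {-R..R}" for s using g(1)[OF that] lim LIMSEQ_unique by blast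
    have "at t within {-R..R} = at t" by (rule at_within_interior) (auto simp: R_def)
    moreover have "t \<in> {-R..R}" by (auto simp: R_def)
    ultimately have "(g has_vector_derivative U t y) (at t)"
      using g(2)[of t] by (simp add: has_vector_derivative_def)
    then show ?thesis
      by (rule has_vector_derivative_transform_within_open[where S="{-R<..<R}"]) (auto simp: gU R_def)
  qed
  have "U 0 x = x" for x using lim[of 0 x] skew_operator.flow_0[OF B] by (simp add: LIMSEQ_const_iff)
  with Ulin Unorm Uinv Ucont Uder show ?thesis using that by blast
qed

text \<open>With \<open>N\<close> the integral of a majorant of the velocity,
  \<open>exp (- (C * s)) * N s\<close> grows no faster than the integral of
  \<open>norm (b s)\<close>. The bound keeps the time integral of the forcing instead of its
  supremum, since it is this integral that is small for a fast packet.\<close>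

lemma gronwall_affine:
  fixes q :: "real \<Rightarrow> 'a::banach"
  assumes q: "\<And>t. (q has_vector_derivative A t (q t) + b t) (at t)" and q0: "q 0 = 0"
    and bd: "\<And>t x. norm (A t x) \<le> C * norm x" and C: "0 \<le> C"
    and Acont: "continuous_on UNIV (\<lambda>t. A t (q t))" and b: "continuous_on UNIV b" and t: "0 \<le> t"
  shows "norm (q t) \<le> exp (C * t) * integral {0..t} (\<lambda>s. norm (b s))"
proof -
  have qc: "continuous_on UNIV q"
    by (rule has_vector_derivative_imp_continuous_on[OF q])
  have Nc: "continuous_on UNIV (\<lambda>s. C * norm (q s) + norm (b s))" and bc: "continuous_on UNIV (\<lambda>s. norm (b s))"
    by (intro continuous_intros qc b)+
  define N where "N = sint (\<lambda>s. C * norm (q s) + norm (b s))"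
  define \<beta> where "\<beta> = sint (\<lambda>s. norm (b s))"
  have N': "(N has_real_derivative C * norm (q s) + norm (b s)) (at s)" for s
    unfolding N_def has_real_derivative_iff_has_vector_derivative by (rule sint_has_vector_derivative[OF Nc])
  have \<beta>': "(\<beta> has_real_derivative norm (b s)) (at s)" for s
    unfolding \<beta>_def has_real_derivative_iff_has_vector_derivative by (rule sint_has_vector_derivative[OF bc])
  have qN: "norm (q s) \<le> N s" if "0 \<le> s" for s
  proof -
    have "((\<lambda>s. A s (q s) + b s) has_integral q s - q 0) {0..s}"
      by (rule fundamental_theorem_of_calculus[OF that]) (rule has_vector_derivative_at_within[OF q])
    then have "q s = integral {0..s} (\<lambda>s. A s (q s) + b s)"
      and int: "(\<lambda>s. A s (q s) + b s) integrable_on {0..s}"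
      using q0 by (auto simp: integral_unique)
    moreover have "norm (integral {0..s} (\<lambda>s. A s (q s) + b s)) \<le> integral {0..s} (\<lambda>s. C * norm (q s) + norm (b s))"
    proof (rule integral_norm_bound_integral[OF int])
      show "(\<lambda>s. C * norm (q s) + norm (b s)) integrable_on {0..s}"
        by (rule integrable_continuous_real) (rule continuous_on_subset[OF Nc], simp)
      show "norm (A s (q s) + b s) \<le> C * norm (q s) + norm (b s)" for s
        using bd[of s "q s"] norm_triangle_ineq[of "A s (q s)" "b s"] by linarith
    qed
    ultimately show ?thesis by (simp only: N_def sint_pos[OF that])
  qed
  define M where "M s = exp (- (C * s)) * N s - \<beta> s" for s
  have "M t \<le> M 0"
  proof (rule DERIV_nonpos_imp_nonincreasing[OF t])
    fix s assume s: "0 \<le> s" "s \<le> t"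
    let ?D = "exp (- (C * s)) * (C * norm (q s) + norm (b s)) - C * exp (- (C * s)) * N s - norm (b s)"
    have "(M has_real_derivative ?D) (at s)"
      unfolding M_def by (rule derivative_eq_intros N' \<beta>' refl | simp)+
    moreover have "?D \<le> 0"
    proof -
      have "exp (- (C * s)) * norm (b s) \<le> 1 * norm (b s)"
        by (rule mult_right_mono) (use C s in auto)
      moreover have "exp (- (C * s)) * (C * norm (q s)) \<le> exp (- (C * s)) * (C * N s)"
        using qN[OF s(1)] C by (intro mult_left_mono) auto
      ultimately show ?thesis by (simp add: algebra_simps)
    qed
    ultimately show "\<exists>y. (M has_real_derivative y) (at s) \<and> y \<le> 0" by blast
  qed
  moreover have "M 0 = 0" by (simp add: M_def N_def \<beta>_def sint_def)
  ultimately have "exp (- (C * t)) * N t \<le> \<beta> t" by (simp add: M_def)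
  then have "N t \<le> exp (C * t) * \<beta> t" by (simp add: exp_minus field_simps)
  with qN[OF t] show ?thesis using sint_pos[OF t, of "\<lambda>s. norm (b s)"] by (simp add: \<beta>_def)
qed

section \<open>Strongly continuous isometric groups and their bounded perturbations\<close>

locale isometric_group =
  fixes U :: "real \<Rightarrow> 'a::{real_inner, banach} \<Rightarrow> 'a"
  assumes U_linear: "linear (U t)" and U_norm [simp]: "norm (U t x) = norm x" and U_0 [simp]: "U 0 x = x"
    and U_inverse [simp]: "U t (U (- t) x) = x" and U_continuous: "continuous_on UNIV (\<lambda>t. U t x)"
begin

text \<open>A relation in place of an unbounded operator: \<open>x\<close> lies in the domain of the
  generator and \<open>y\<close> is its image.\<close>

definition generates :: "'a \<Rightarrow> 'a \<Rightarrow> bool" where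
  "generates x y \<longleftrightarrow> (\<forall>t. ((\<lambda>t. U t x) has_vector_derivative U t y) (at t))"

lemma U_inner: "inner (U t x) (U t y) = inner x y"
  using U_linear[of t] by (simp add: dot_norm linear_add[symmetric])

lemma U_adjoint: "inner (U t x) y = inner x (U (- t) y)"
  using U_inner[of t x "U (- t) y"] by simp

lemma U_continuous_minus: "continuous_on UNIV (\<lambda>t. U (- t) x)"
  by (intro continuous_on_compose2[OF U_continuous] continuous_intros) auto

lemma U_apply_continuous: "continuous_on UNIV g \<Longrightarrow> continuous_on UNIV (\<lambda>t. U t (g t))"
  by (rule continuous_on_strong_apply[where C=1]) (auto intro: U_linear U_continuous)

lemma U_minus_apply_continuous: "continuous_on UNIV g \<Longrightarrow> continuous_on UNIV (\<lambda>t. U (- t) (g t))"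
  by (rule continuous_on_strong_apply[where C=1]) (auto intro: U_linear U_continuous_minus)

lemma generates_minus:
  assumes "generates x y"
  shows "((\<lambda>t. U (- t) x) has_vector_derivative - U (- t) y) (at t)"
proof -
  have "((\<lambda>t. U t x) has_vector_derivative U (- t) y) (at (- t))"
    using assms by (simp add: generates_def)
  moreover have "((\<lambda>t::real. - t) has_vector_derivative - 1) (at t)"
    by (auto intro!: derivative_eq_intros)
  ultimately show ?thesis
    using vector_diff_chain_at[of "\<lambda>t. - t" "-1" t "\<lambda>t. U t x" "U (- t) y"] by (simp add: o_def)
qed

text \<open>Passing to the interaction picture removes the generator: only the defect
  \<open>w' - g\<close> of the free equation remains.\<close>

lemma U_minus_deriv:
  assumes "generates (w t) g" "(w has_vector_derivative w') (at t)"
  shows "((\<lambda>t. U (- t) (w t)) has_vector_derivative U (- t) (w' - g)) (at t)"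
proof -
  have "((\<lambda>s. U (- s) (w s)) has_vector_derivative - U (- t) g + U (- t) w') (at t)"
    by (rule has_vector_derivative_strong_apply[where F = "\<lambda>s. U (- s)" and g = w and C = 1, OF _ _ _ generates_minus[OF assms(1)] assms(2)])
       (auto intro: U_linear U_continuous_minus)
  then show ?thesis using U_linear[of "- t"] by (simp add: linear_diff)
qed

lemma solution_unique:
  assumes "\<And>t. generates (w t) (w' t)" "\<And>t. (w has_vector_derivative w' t) (at t)"
  shows "w t = U t (w 0)"
proof -
  have "((\<lambda>t. U (- t) (w t)) has_vector_derivative U (- s) (w' s - w' s)) (at s within UNIV)" for s
    using U_minus_deriv[of w s "w' s" "w' s"] assms by simp
  moreover have "U (- s) 0 = 0" for s using U_linear by (simp add: linear_0)
  ultimately have "U (- t) (w t) = U (- 0) (w 0)"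
    using has_vector_derivative_zero_constant[of UNIV "\<lambda>t. U (- t) (w t)"] by (metis UNIV_I convex_UNIV diff_self)
  then show ?thesis by (metis U_0 U_inverse minus_zero)
qed

lemma perturbed_evolution:
  assumes P: "linear P" and PC: "\<And>x. norm (P x) \<le> C * norm x" and C: "0 \<le> C"
  obtains v where "v 0 = x" "\<And>t. (v has_vector_derivative U (- t) (P (U t (v t)))) (at t)"
    "\<And>t. 0 \<le> t \<Longrightarrow> norm (v t - x) \<le> exp (C * t) * integral {0..t} (\<lambda>s. norm (P (U s x)))"
proof -
  define A where "A t y = U (- t) (P (U t y))" for t y
  have lin: "linear (A t)" for t
    unfolding A_def using linear_compose[OF linear_compose[OF U_linear P] U_linear] by (simp add: o_def)
  have bd: "norm (A t y) \<le> C * norm y" for t y using PC[of "U t y"] by (simp add: A_def)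
  have "bounded_linear P" using P PC
    by (simp add: bounded_linear_def bounded_linear_axioms_def) (metis mult.commute)
  then have Pc: "continuous_on UNIV (\<lambda>t. P (g t))" if "continuous_on UNIV g" for g :: "real \<Rightarrow> 'a"
    using bounded_linear.continuous_on that by blast
  have cont: "continuous_on UNIV (\<lambda>t. A t y)" for y
    unfolding A_def by (intro U_minus_apply_continuous Pc U_continuous)
  obtain v where v0: "v 0 = x" and v: "\<And>t. (v has_vector_derivative A t (v t)) (at t)"
    using linear_ode_exists[OF lin bd cont] by blast
  have vc: "continuous_on UNIV v"
    by (rule has_vector_derivative_imp_continuous_on[OF v])
  have "norm (v t - x) \<le> exp (C * t) * integral {0..t} (\<lambda>s. norm (A s x))" if "0 \<le> t" for t
  proof (rule gronwall_affine[OF _ _ bd C _ cont that])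
    show "((\<lambda>t. v t - x) has_vector_derivative A t (v t - x) + A t x) (at t)" for t
      using has_vector_derivative_diff_const[of v x] v[of t] lin[of t] by (simp add: linear_diff)
    show "continuous_on UNIV (\<lambda>t. A t (v t - x))"
      by (rule continuous_on_strong_apply[OF lin bd cont]) (intro continuous_intros vc)
  qed (simp add: v0)
  then show ?thesis using that[of v] v0 v by (simp add: A_def)
qed

text \<open>Moving \<open>U t\<close> onto the test curve puts the demand for regularity on
  \<open>w\<close>, which lies in the domain of the generator; the perturbed state
  \<open>U t (v t)\<close> itself may fail to be differentiable.\<close>

lemma perturbed_pairing:
  assumes v: "(v has_vector_derivative U (- t) (P (U t (v t)))) (at t)"
    and "generates (w t) g" "(w has_vector_derivative w') (at t)"
  shows "((\<lambda>t. inner (U t (v t)) (w t)) has_vector_derivative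
      inner (P (U t (v t))) (w t) + inner (U t (v t)) (w' - g)) (at t)"
proof -
  have "((\<lambda>t. inner (v t) (U (- t) (w t))) has_vector_derivative
      inner (v t) (U (- t) (w' - g)) + inner (U (- t) (P (U t (v t)))) (U (- t) (w t))) (at t)"
    by (rule bounded_bilinear.has_vector_derivative[OF bounded_bilinear_inner v U_minus_deriv[OF assms(2,3)]])
  then show ?thesis by (simp add: U_adjoint U_inner add.commute)
qed

end

section \<open>The Hilbert space of square integrable functions\<close>

definition sqint :: "('a::euclidean_space \<Rightarrow> complex) \<Rightarrow> bool" where
  "sqint f \<longleftrightarrow> f \<in> borel_measurable borel \<and> integrable lborel (\<lambda>x. (cmod (f x))\<^sup>2)"

lemma sqint_measurable [measurable_dest]: "sqint f \<Longrightarrow> f \<in> borel_measurable borel"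
  and sqint_integrable: "sqint f \<Longrightarrow> integrable lborel (\<lambda>x. (cmod (f x))\<^sup>2)"
  by (simp_all add: sqint_def)

lemma sqint_bound:
  assumes f [measurable]: "f \<in> borel_measurable borel" and g: "integrable lborel g"
    and le: "AE x in lborel. (cmod (f x))\<^sup>2 \<le> g x"
  shows "sqint f"
  unfolding sqint_def
  by (intro conjI f Bochner_Integration.integrable_bound[OF g]) (use le in auto)

lemma sqint_0 [simp]: "sqint (\<lambda>x. 0)" by (simp add: sqint_def)

lemma norm_sum_square_le: "(norm (a + b))\<^sup>2 \<le> 2 * (norm a)\<^sup>2 + 2 * (norm (b::'a::real_normed_vector))\<^sup>2"
proof -
  have "(norm (a + b))\<^sup>2 \<le> (norm a + norm b)\<^sup>2" by (intro power_mono norm_triangle_ineq) simp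
  also have "\<dots> \<le> 2 * (norm a)\<^sup>2 + 2 * (norm b)\<^sup>2"
    using zero_le_power2[of "norm a - norm b"] by (simp add: power2_eq_square algebra_simps)
  finally show ?thesis .
qed

lemma sqint_add [simp]:
  assumes [simp]: "sqint f" "sqint g" shows "sqint (\<lambda>x. f x + g x)"
proof (rule sqint_bound)
  note [measurable] = sqint_measurable[OF assms(1)] sqint_measurable[OF assms(2)]
  show "(\<lambda>x. f x + g x) \<in> borel_measurable borel" by measurable
  show "integrable lborel (\<lambda>x. 2 * (cmod (f x))\<^sup>2 + 2 * (cmod (g x))\<^sup>2)"
    by (intro Bochner_Integration.integrable_add integrable_mult_right sqint_integrable assms)
qed (simp add: norm_sum_square_le)

lemma sqint_mult:
  assumes [simp]: "sqint f" and V [measurable]: "V \<in> borel_measurable borel"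
    and bd: "AE x in lborel. cmod (V x) \<le> C"
  shows "sqint (\<lambda>x. V x * f x)"
proof (rule sqint_bound)
  note [measurable] = sqint_measurable[OF assms(1)]
  show "(\<lambda>x. V x * f x) \<in> borel_measurable borel" by measurable
  show "integrable lborel (\<lambda>x. C\<^sup>2 * (cmod (f x))\<^sup>2)" by (simp add: sqint_integrable)
  show "AE x in lborel. (cmod (V x * f x))\<^sup>2 \<le> C\<^sup>2 * (cmod (f x))\<^sup>2"
    using bd by eventually_elim (auto simp: norm_mult power_mult_distrib intro!: mult_right_mono power_mono)
qed

lemma sqint_cmult [simp]: "sqint f \<Longrightarrow> sqint (\<lambda>x. c * f x)"
  by (rule sqint_mult[where C="cmod c"]) auto

lemma sqint_scaleR [simp]: "sqint f \<Longrightarrow> sqint (\<lambda>x. r *\<^sub>R f x)"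
  by (simp add: scaleR_conv_of_real)

lemma sqint_uminus [simp]: "sqint f \<Longrightarrow> sqint (\<lambda>x. - f x)"
  using sqint_cmult[of f "-1"] by simp

lemma sqint_diff [simp]: "sqint f \<Longrightarrow> sqint g \<Longrightarrow> sqint (\<lambda>x. f x - g x)"
  using sqint_add[of f "\<lambda>x. - g x"] by simp

lemma borel_measurable_cnj [measurable]: "cnj \<in> borel_measurable borel"
  by (intro borel_measurable_continuous_onI continuous_intros)

lemma sqint_cnj [simp]: "sqint f \<Longrightarrow> sqint (\<lambda>x. cnj (f x))"
  unfolding sqint_def by auto

lemma sqint_sum: "(\<And>i. i \<in> I \<Longrightarrow> sqint (f i)) \<Longrightarrow> sqint (\<lambda>x. \<Sum>i\<in>I. f i x)"
  by (induction I rule: infinite_finite_induct) auto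

lemma sqint_prod_integrable:
  assumes "sqint f" "sqint g" shows "integrable lborel (\<lambda>x. f x * g x)"
proof (rule Bochner_Integration.integrable_bound)
  note [measurable] = sqint_measurable[OF assms(1)] sqint_measurable[OF assms(2)]
  show "integrable lborel (\<lambda>x. (cmod (f x))\<^sup>2 + (cmod (g x))\<^sup>2)"
    by (intro Bochner_Integration.integrable_add sqint_integrable assms)
  show "(\<lambda>x. f x * g x) \<in> borel_measurable lborel" by measurable
  have "cmod (f x) * cmod (g x) \<le> (cmod (f x))\<^sup>2 + (cmod (g x))\<^sup>2" for x
    using zero_le_power2[of "cmod (f x) - cmod (g x)"] zero_le_power2[of "cmod (f x)"] zero_le_power2[of "cmod (g x)"]
    unfolding power2_diff by linarith
  then show "AE x in lborel. norm (f x * g x) \<le> norm ((cmod (f x))\<^sup>2 + (cmod (g x))\<^sup>2)"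
    by (simp add: norm_mult)
qed

text \<open>The chosen function depends only on the almost-everywhere class of \<open>f\<close>,
  because the predicate under the choice does. The square integrable fixed points of
  \<open>canon\<close> are thus genuine functions, one for each class, and L2 becomes a type without
  a quotient construction.\<close>

definition canon :: "('a::euclidean_space \<Rightarrow> complex) \<Rightarrow> 'a \<Rightarrow> complex" where
  "canon f = (SOME g. g \<in> borel_measurable borel \<and> (AE x in lborel. g x = f x))"

lemma canon:
  assumes "f \<in> borel_measurable borel"
  shows "canon f \<in> borel_measurable borel" "AE x in lborel. canon f x = f x"
  using someI[of "\<lambda>g. g \<in> borel_measurable borel \<and> (AE x in lborel. g x = f x)" f] assms
  by (auto simp: canon_def)

lemma canon_cong:
  assumes "AE x in lborel. f x = g x" shows "canon f = canon g"
proof -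
  have "(AE x in lborel. h x = f x) \<longleftrightarrow> (AE x in lborel. h x = g x)" for h
    using assms by (auto elim: eventually_elim2)
  then show ?thesis by (simp add: canon_def)
qed

lemma sqint_cong_AE:
  assumes "sqint f" "g \<in> borel_measurable borel" "AE x in lborel. g x = f x"
  shows "sqint g"
  by (rule sqint_bound[OF assms(2) sqint_integrable[OF assms(1)]]) (use assms(3) in auto)

typedef (overloaded) 'a l2 = "{f::'a::euclidean_space \<Rightarrow> complex. sqint f \<and> canon f = f}"
  morphisms rep_l2 Abs_l2
proof
  let ?z = "canon (\<lambda>x::'a. 0)"
  have "AE x in lborel. ?z x = 0" "?z \<in> borel_measurable borel" using canon[of "\<lambda>x::'a. 0"] by auto
  then show "?z \<in> {f. sqint f \<and> canon f = f}"
    using sqint_cong_AE[OF sqint_0] canon_cong[of ?z "\<lambda>x. 0"] by auto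
qed

definition l2_of :: "('a::euclidean_space \<Rightarrow> complex) \<Rightarrow> 'a l2" where "l2_of f = Abs_l2 (canon f)"

lemma rep_l2_of: "sqint f \<Longrightarrow> AE x in lborel. rep_l2 (l2_of f) x = f x"
proof -
  assume f: "sqint f"
  have c: "canon f \<in> borel_measurable borel" "AE x in lborel. canon f x = f x"
    using canon f by (auto simp: sqint_def)
  have "canon f \<in> {f. sqint f \<and> canon f = f}" using sqint_cong_AE[OF f c] canon_cong[OF c(2)] by simp
  then show ?thesis using c(2) by (simp add: l2_of_def Abs_l2_inverse)
qed

lemma sqint_rep [simp]: "sqint (rep_l2 a)" and l2_of_rep [simp]: "l2_of (rep_l2 a) = a"
  using rep_l2[of a] by (auto simp: l2_of_def rep_l2_inverse)

lemma rep_l2_measurable [measurable]: "rep_l2 a \<in> borel_measurable borel"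
  by (rule sqint_measurable) simp

lemma l2_of_cong: "AE x in lborel. f x = g x \<Longrightarrow> l2_of f = l2_of g"
  by (simp add: l2_of_def canon_cong)

lemma l2_of_eqD: "l2_of f = l2_of g \<Longrightarrow> sqint f \<Longrightarrow> sqint g \<Longrightarrow> AE x in lborel. f x = g x"
  using rep_l2_of[of f] rep_l2_of[of g] by (auto elim: eventually_elim2)

instantiation l2 :: (euclidean_space) real_vector
begin

definition "0 = l2_of (\<lambda>x. 0)"
definition "a + b = l2_of (\<lambda>x. rep_l2 a x + rep_l2 b x)"
definition "- a = l2_of (\<lambda>x. - rep_l2 a x)"
definition "a - b = l2_of (\<lambda>x. rep_l2 a x - rep_l2 b x)"
definition "r *\<^sub>R a = l2_of (\<lambda>x. r *\<^sub>R rep_l2 a x)"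

lemma l2_of_add: "sqint f \<Longrightarrow> sqint g \<Longrightarrow> l2_of f + l2_of g = l2_of (\<lambda>x. f x + g x)"
  unfolding plus_l2_def
  by (rule l2_of_cong) (use rep_l2_of[of f] rep_l2_of[of g] in \<open>auto elim: eventually_elim2\<close>)

lemma l2_of_diff: "sqint f \<Longrightarrow> sqint g \<Longrightarrow> l2_of f - l2_of g = l2_of (\<lambda>x. f x - g x)"
  unfolding minus_l2_def
  by (rule l2_of_cong) (use rep_l2_of[of f] rep_l2_of[of g] in \<open>auto elim: eventually_elim2\<close>)

lemma l2_of_uminus: "sqint f \<Longrightarrow> - l2_of f = l2_of (\<lambda>x. - f x)"
  unfolding uminus_l2_def
  by (rule l2_of_cong) (use rep_l2_of[of f] in \<open>auto elim: eventually_mono\<close>)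

lemma l2_of_scaleR: "sqint f \<Longrightarrow> r *\<^sub>R l2_of f = l2_of (\<lambda>x. r *\<^sub>R f x)"
  unfolding scaleR_l2_def
  by (rule l2_of_cong) (use rep_l2_of[of f] in \<open>auto elim: eventually_mono\<close>)

instance
proof
  fix a b c :: "'a l2" and r s :: real
  have l: "x = l2_of (rep_l2 x)" for x :: "'a l2" by simp
  note h = l2_of_add l2_of_diff l2_of_uminus l2_of_scaleR zero_l2_def
  show "a + b + c = a + (b + c)"
    by (subst (1 2 3 4 5 6) l) (simp add: h add.assoc del: l2_of_rep)
  show "a + b = b + a" by (simp add: plus_l2_def add.commute)
  show "0 + a = a" by (subst (1 2) l) (simp add: h del: l2_of_rep)
  show "- a + a = 0" by (subst (1 2) l) (simp add: h del: l2_of_rep)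
  show "a - b = a + - b" by (subst (1 2 3 4) l) (simp add: h del: l2_of_rep)
  show "r *\<^sub>R (a + b) = r *\<^sub>R a + r *\<^sub>R b" by (subst (1 2 3 4) l) (simp add: h scaleR_add_right del: l2_of_rep)
  show "(r + s) *\<^sub>R a = r *\<^sub>R a + s *\<^sub>R a" by (subst (1 2 3) l) (simp add: h scaleR_add_left del: l2_of_rep)
  show "r *\<^sub>R s *\<^sub>R a = (r * s) *\<^sub>R a" by (subst (1 2) l) (simp add: h del: l2_of_rep)
  show "1 *\<^sub>R a = a" by (subst (1 2) l) (simp add: h del: l2_of_rep)
qed

end

text \<open>The real part makes L2 a real Hilbert space. Multiplication by \<i> is kept as a
  separate skew operator, and testing against it recovers the imaginary part.\<close>

definition l2_ip :: "'a::euclidean_space l2 \<Rightarrow> 'a l2 \<Rightarrow> real" where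
  "l2_ip a b = Re (\<integral>x. rep_l2 a x * cnj (rep_l2 b x) \<partial>lborel)"

lemma l2_ip_of:
  assumes f: "sqint f" and g: "sqint g"
  shows "l2_ip (l2_of f) (l2_of g) = Re (\<integral>x. f x * cnj (g x) \<partial>lborel)"
proof -
  note [measurable] = sqint_measurable[OF f] sqint_measurable[OF g]
  have "(\<integral>x. rep_l2 (l2_of f) x * cnj (rep_l2 (l2_of g) x) \<partial>lborel) = (\<integral>x. f x * cnj (g x) \<partial>lborel)"
  proof (rule integral_cong_AE)
    show "AE x in lborel. rep_l2 (l2_of f) x * cnj (rep_l2 (l2_of g) x) = f x * cnj (g x)"
      using rep_l2_of[OF f] rep_l2_of[OF g] by eventually_elim simp
  qed measurable
  then show ?thesis by (simp add: l2_ip_def)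
qed

lemma l2_ip_self: "l2_ip a a = (\<integral>x. (cmod (rep_l2 a x))\<^sup>2 \<partial>lborel)"
proof -
  have "(\<integral>x. rep_l2 a x * cnj (rep_l2 a x) \<partial>lborel) = (\<integral>x. complex_of_real ((cmod (rep_l2 a x))\<^sup>2) \<partial>lborel)"
    by (rule Bochner_Integration.integral_cong) (simp_all only: complex_norm_square)
  then show ?thesis by (simp only: l2_ip_def integral_complex_of_real Re_complex_of_real)
qed

instantiation l2 :: (euclidean_space) real_inner
begin

definition "inner a b = l2_ip a b"
definition "norm (a::'a l2) = sqrt (inner a a)"
definition "sgn (a::'a l2) = a /\<^sub>R norm a"
definition "dist (a::'a l2) b = norm (a - b)"
definition [code del]: "(uniformity :: ('a l2 \<times> 'a l2) filter) = (INF e\<in>{0<..}. principal {(x, y). dist x y < e})"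
definition [code del]: "open (U :: 'a l2 set) \<longleftrightarrow> (\<forall>x\<in>U. eventually (\<lambda>(x', y). x' = x \<longrightarrow> y \<in> U) uniformity)"

instance
proof
  fix a b c :: "'a l2" and r :: real and U :: "'a l2 set"
  show "dist a b = norm (a - b)" by (rule dist_l2_def)
  show "sgn a = a /\<^sub>R norm a" by (rule sgn_l2_def)
  show "(uniformity :: ('a l2 \<times> 'a l2) filter) = (INF e\<in>{0<..}. principal {(x, y). dist x y < e})"
    by (rule uniformity_l2_def)
  show "open U \<longleftrightarrow> (\<forall>x\<in>U. eventually (\<lambda>(x', y). x' = x \<longrightarrow> y \<in> U) uniformity)"
    by (rule open_l2_def)
  have int: "integrable lborel (\<lambda>x. rep_l2 a x * cnj (rep_l2 b x))" for a b :: "'a l2"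
    by (rule sqint_prod_integrable) auto
  show "inner a b = inner b a"
  proof -
    have "(\<integral>x. rep_l2 b x * cnj (rep_l2 a x) \<partial>lborel) = cnj (\<integral>x. rep_l2 a x * cnj (rep_l2 b x) \<partial>lborel)"
      by (subst Bochner_Integration.integral_cnj[symmetric]) (simp add: mult.commute)
    then show ?thesis by (simp add: inner_l2_def l2_ip_def)
  qed
  show "inner (a + b) c = inner a c + inner b c"
  proof -
    have "inner (a + b) c = inner (l2_of (\<lambda>x. rep_l2 a x + rep_l2 b x)) (l2_of (rep_l2 c))"
      by (simp add: plus_l2_def)
    also have "\<dots> = Re (\<integral>x. rep_l2 a x * cnj (rep_l2 c x) + rep_l2 b x * cnj (rep_l2 c x) \<partial>lborel)"
      unfolding inner_l2_def by (subst l2_ip_of) (simp_all add: distrib_right)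
    finally show ?thesis by (simp add: int inner_l2_def l2_ip_def)
  qed
  show "inner (r *\<^sub>R a) b = r * inner a b"
  proof -
    have "inner (r *\<^sub>R a) b = inner (l2_of (\<lambda>x. r *\<^sub>R rep_l2 a x)) (l2_of (rep_l2 b))"
      by (simp add: scaleR_l2_def)
    also have "\<dots> = Re (\<integral>x. r *\<^sub>R (rep_l2 a x * cnj (rep_l2 b x)) \<partial>lborel)"
      unfolding inner_l2_def by (subst l2_ip_of) simp_all
    also have "\<dots> = r * inner a b"
      by (subst integral_scaleR_right) (simp_all add: inner_l2_def l2_ip_def)
    finally show ?thesis .
  qed
  show "0 \<le> inner a a" by (simp add: inner_l2_def l2_ip_self)
  show "inner a a = 0 \<longleftrightarrow> a = 0"
  proof
    assume "inner a a = 0"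
    then have "AE x in lborel. (cmod (rep_l2 a x))\<^sup>2 = 0"
      using integral_nonneg_eq_0_iff_AE[OF sqint_integrable[OF sqint_rep[of a]]]
      by (simp add: inner_l2_def l2_ip_self)
    then have "l2_of (rep_l2 a) = l2_of (\<lambda>x. 0)" by (intro l2_of_cong) auto
    then show "a = 0" by (simp add: zero_l2_def)
  next
    assume "a = 0"
    then show "inner a a = 0" unfolding zero_l2_def inner_l2_def by (simp add: l2_ip_of)
  qed
  show "norm a = sqrt (inner a a)" by (rule norm_l2_def)
qed

end

lemma inner_l2_of:
  "sqint f \<Longrightarrow> sqint g \<Longrightarrow> inner (l2_of f) (l2_of g) = Re (\<integral>x. f x * cnj (g x) \<partial>lborel)"
  by (simp add: inner_l2_def l2_ip_of)

lemma norm_l2_square: "(norm a)\<^sup>2 = (\<integral>x. (cmod (rep_l2 a x))\<^sup>2 \<partial>lborel)"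
  by (simp add: norm_l2_def inner_l2_def l2_ip_self)

lemma norm_l2_of_square:
  assumes f: "sqint f" shows "(norm (l2_of f))\<^sup>2 = (\<integral>x. (cmod (f x))\<^sup>2 \<partial>lborel)"
  unfolding norm_l2_square
  by (rule integral_cong_AE) (use f rep_l2_of[OF f] in \<open>auto dest: sqint_measurable\<close>)

lemma l2_of_sum: "finite I \<Longrightarrow> (\<And>i. i \<in> I \<Longrightarrow> sqint (f i)) \<Longrightarrow> (\<Sum>i\<in>I. l2_of (f i)) = l2_of (\<lambda>x. \<Sum>i\<in>I. f i x)"
  by (induction I rule: finite_induct) (auto simp: zero_l2_def l2_of_add sqint_sum)

lemma nn_integral_l2_diff:
  assumes "sqint f" "sqint g"
  shows "(\<integral>\<^sup>+x. ennreal ((cmod (f x - g x))\<^sup>2) \<partial>lborel) = ennreal ((norm (l2_of f - l2_of g))\<^sup>2)"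
  using assms
  by (subst nn_integral_eq_integral) (simp_all add: l2_of_diff norm_l2_of_square sqint_integrable)

text \<open>Riesz--Fischer: along a subsequence whose increments decay geometrically, the weighted sum
  of the squared increments is integrable, so the subsequence converges almost everywhere.\<close>

lemma l2_complete:
  fixes X :: "nat \<Rightarrow> 'a::euclidean_space l2"
  assumes X: "Cauchy X" shows "convergent X"
proof -
  have "\<exists>r. strict_mono r \<and> (\<forall>k. \<forall>m\<ge>r k. \<forall>n\<ge>r k. dist (X m) (X n) < (1/4) ^ k)"
  proof -
    have ex: "\<exists>N. \<forall>m\<ge>N. \<forall>n\<ge>N. dist (X m) (X n) < (1/4) ^ k" for k
      using X unfolding Cauchy_def by (meson zero_less_divide_1_iff zero_less_numeral zero_less_power)
    define N where "N k = (SOME N. \<forall>m\<ge>N. \<forall>n\<ge>N. dist (X m) (X n) < (1/4) ^ k)" for k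
    have N: "\<forall>m\<ge>N k. \<forall>n\<ge>N k. dist (X m) (X n) < (1/4) ^ k" for k
      unfolding N_def by (rule someI_ex[OF ex])
    define r where "r k = (\<Sum>i\<le>k. N i) + k" for k
    have "strict_mono r" by (rule strict_monoI_Suc) (simp add: r_def)
    moreover have "N k \<le> r k" for k
      unfolding r_def by (intro trans_le_add1 member_le_sum) auto
    ultimately show ?thesis using N by (meson order_trans)
  qed
  then obtain r where r: "strict_mono r" and rd: "\<And>k m n. m \<ge> r k \<Longrightarrow> n \<ge> r k \<Longrightarrow> dist (X m) (X n) < (1/4) ^ k"
    by blast
  define f where "f k = rep_l2 (X (r k))" for k
  have f [simp]: "sqint (f k)" for k by (simp add: f_def)
  have [measurable]: "f k \<in> borel_measurable borel" for k by (rule sqint_measurable) simp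
  have fr [simp]: "l2_of (f k) = X (r k)" for k by (simp add: f_def)
  have rmono: "r k \<le> r m" if "k \<le> m" for k m using r that by (simp add: strict_mono_less_eq)
  \<comment> \<open>The squared increments have integrals at most \<open>(1/16) ^ k\<close>, so the
    weight \<open>4 ^ k\<close> leaves a convergent sum; its finiteness at a point forces increments
    there of order \<open>(1/2) ^ k\<close>.\<close>
  have AEfin: "AE x in lborel. (\<Sum>k. ennreal (4 ^ k * (cmod (f (Suc k) x - f k x))\<^sup>2)) \<noteq> \<infinity>"
  proof (rule nn_integral_PInf_AE)
    have "(\<integral>\<^sup>+x. (\<Sum>k. ennreal (4 ^ k * (cmod (f (Suc k) x - f k x))\<^sup>2)) \<partial>lborel)
        = (\<Sum>k. \<integral>\<^sup>+x. ennreal (4 ^ k * (cmod (f (Suc k) x - f k x))\<^sup>2) \<partial>lborel)"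
      by (rule nn_integral_suminf) measurable
    also have "\<dots> = (\<Sum>k. ennreal (4 ^ k * (norm (X (r (Suc k)) - X (r k)))\<^sup>2))"
    proof (rule suminf_cong)
      fix k
      have "(\<integral>\<^sup>+x. ennreal (4 ^ k * (cmod (f (Suc k) x - f k x))\<^sup>2) \<partial>lborel)
          = (\<integral>\<^sup>+x. ennreal (4 ^ k) * ennreal ((cmod (f (Suc k) x - f k x))\<^sup>2) \<partial>lborel)"
        by (simp add: ennreal_mult)
      also have "\<dots> = ennreal (4 ^ k) * (\<integral>\<^sup>+x. ennreal ((cmod (f (Suc k) x - f k x))\<^sup>2) \<partial>lborel)"
        by (rule nn_integral_cmult) measurable
      finally show "(\<integral>\<^sup>+x. ennreal (4 ^ k * (cmod (f (Suc k) x - f k x))\<^sup>2) \<partial>lborel)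
          = ennreal (4 ^ k * (norm (X (r (Suc k)) - X (r k)))\<^sup>2)"
        by (simp add: nn_integral_l2_diff ennreal_mult)
    qed
    also have "\<dots> \<le> (\<Sum>k. ennreal ((1/4) ^ k))"
    proof (rule suminf_le)
      fix k
      have "norm (X (r (Suc k)) - X (r k)) \<le> (1/4) ^ k"
        using rd[where k=k and m="r (Suc k)" and n="r k"] rmono[of k "Suc k"] by (simp add: dist_norm)
      then have "(norm (X (r (Suc k)) - X (r k)))\<^sup>2 \<le> ((1/4) ^ k)\<^sup>2" by (intro power_mono) auto
      then have "4 ^ k * (norm (X (r (Suc k)) - X (r k)))\<^sup>2 \<le> 4 ^ k * ((1/4) ^ k)\<^sup>2" by simp
      also have "\<dots> = (1/4) ^ k"
        by (simp add: power2_eq_square power_mult_distrib[symmetric] flip: mult.assoc)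
      finally show "ennreal (4 ^ k * (norm (X (r (Suc k)) - X (r k)))\<^sup>2) \<le> ennreal ((1/4) ^ k)"
        by (rule ennreal_leI)
    qed auto
    also have "\<dots> = ennreal (\<Sum>k. (1/4) ^ k)"
      by (rule suminf_ennreal2) (auto intro: summable_geometric)
    finally show "(\<integral>\<^sup>+x. (\<Sum>k. ennreal (4 ^ k * (cmod (f (Suc k) x - f k x))\<^sup>2)) \<partial>lborel) \<noteq> \<infinity>"
      by (auto simp: top_unique)
  qed measurable
  define g where "g x = lim (\<lambda>k. f k x)" for x
  have [measurable]: "g \<in> borel_measurable borel" unfolding g_def by measurable
  have conv: "AE x in lborel. (\<lambda>k. f k x) \<longlonglongrightarrow> g x"
    using AEfin
  proof eventually_elim
    case (elim x)
    let ?S = "\<Sum>k. ennreal (4 ^ k * (cmod (f (Suc k) x - f k x))\<^sup>2)"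
    define B where "B = enn2real ?S"
    have "x = ennreal (enn2real x)" if "x \<noteq> \<infinity>" for x :: ennreal
      using that by (simp add: less_top)
    from this[OF elim] have B: "B \<ge> 0" "?S = ennreal B" by (simp_all only: B_def enn2real_nonneg)
    have "cmod (f (Suc k) x - f k x) \<le> sqrt B * (1/2) ^ k" for k
    proof -
      have "ennreal (4 ^ k * (cmod (f (Suc k) x - f k x))\<^sup>2) \<le> ?S"
      proof -
        have "g k \<le> suminf g" for g :: "nat \<Rightarrow> ennreal"
          using sum_le_suminf[OF summableI, of "{k}" g] by simp
        then show ?thesis .
      qed
      then have "4 ^ k * (cmod (f (Suc k) x - f k x))\<^sup>2 \<le> B" unfolding B(2) using B(1) by simp
      moreover have "(4::real) ^ k = (2 ^ k)\<^sup>2" by (simp add: power2_eq_square flip: power_mult_distrib)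
      ultimately have "(2 ^ k * cmod (f (Suc k) x - f k x))\<^sup>2 \<le> B" by (simp add: power_mult_distrib)
      then have "2 ^ k * cmod (f (Suc k) x - f k x) \<le> sqrt B" by (rule real_le_rsqrt)
      then show ?thesis by (simp add: field_simps)
    qed
    moreover have "summable (\<lambda>k. sqrt B * (1/2) ^ k)" by (intro summable_mult summable_geometric) simp
    ultimately have "summable (\<lambda>k. f (Suc k) x - f k x)"
      using summable_comparison_test'[of "\<lambda>k. sqrt B * (1/2) ^ k" 0 "\<lambda>k. f (Suc k) x - f k x"] by blast
    then have "convergent (\<lambda>n. \<Sum>k<n. f (Suc k) x - f k x)" by (simp add: summable_iff_convergent)
    then have "convergent (\<lambda>n. f n x - f 0 x)" by (simp only: sum_lessThan_telescope[of "\<lambda>n. f n x"])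
    then have "convergent (\<lambda>n. (f n x - f 0 x) + f 0 x)" by (rule convergent_add[OF _ convergent_const])
    then have "convergent (\<lambda>n. f n x)" by (simp only: diff_add_cancel)
    then show ?case by (simp only: g_def convergent_LIMSEQ_iff)
  qed
  \<comment> \<open>Fatou's lemma in the index \<open>m\<close> passes the Cauchy bound to the limit
    function.\<close>
  have close: "(\<integral>\<^sup>+x. ennreal ((cmod (g x - f k x))\<^sup>2) \<partial>lborel) \<le> ennreal (((1/4) ^ k)\<^sup>2)" for k
  proof -
    have "(\<integral>\<^sup>+x. ennreal ((cmod (g x - f k x))\<^sup>2) \<partial>lborel)
        = (\<integral>\<^sup>+x. liminf (\<lambda>m. ennreal ((cmod (f m x - f k x))\<^sup>2)) \<partial>lborel)"
    proof (rule nn_integral_cong_AE)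
      show "AE x in lborel. ennreal ((cmod (g x - f k x))\<^sup>2) = liminf (\<lambda>m. ennreal ((cmod (f m x - f k x))\<^sup>2))"
        using conv
      proof eventually_elim
        case (elim x)
        then have "(\<lambda>m. ennreal ((cmod (f m x - f k x))\<^sup>2)) \<longlonglongrightarrow> ennreal ((cmod (g x - f k x))\<^sup>2)"
          by (intro tendsto_intros)
        then show ?case by (intro lim_imp_Liminf[symmetric]) auto
      qed
    qed
    also have "\<dots> \<le> liminf (\<lambda>m. \<integral>\<^sup>+x. ennreal ((cmod (f m x - f k x))\<^sup>2) \<partial>lborel)"
      by (rule nn_integral_liminf) measurable
    also have "\<dots> \<le> ennreal (((1/4) ^ k)\<^sup>2)"
    proof (rule Liminf_le)
      show "\<forall>\<^sub>F m in sequentially. (\<integral>\<^sup>+x. ennreal ((cmod (f m x - f k x))\<^sup>2) \<partial>lborel) \<le> ennreal (((1/4) ^ k)\<^sup>2)"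
        unfolding eventually_sequentially
      proof (intro exI allI impI)
        fix m assume "k \<le> m"
        then have "norm (X (r m) - X (r k)) \<le> (1/4) ^ k"
          using rd[where k=k and m="r m" and n="r k"] rmono[of k m] by (simp add: dist_norm)
        then show "(\<integral>\<^sup>+x. ennreal ((cmod (f m x - f k x))\<^sup>2) \<partial>lborel) \<le> ennreal (((1/4) ^ k)\<^sup>2)"
          by (simp add: nn_integral_l2_diff ennreal_leI power_mono)
      qed
    qed simp
    finally show ?thesis .
  qed
  have gf: "sqint (\<lambda>x. g x - f k x)" for k
  proof -
    have "(\<integral>\<^sup>+x. ennreal (norm ((cmod (g x - f k x))\<^sup>2)) \<partial>lborel) < \<infinity>"
      using close[of k] by (simp add: le_less_trans)
    then show ?thesis unfolding sqint_def integrable_iff_bounded by simp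
  qed
  have g: "sqint g" using sqint_add[OF gf[of 0] f[of 0]] by simp
  have lim: "norm (l2_of g - X (r k)) \<le> (1/4) ^ k" for k
  proof -
    have "ennreal ((norm (l2_of g - l2_of (f k)))\<^sup>2) \<le> ennreal (((1/4) ^ k)\<^sup>2)"
      using close[of k] by (simp only: nn_integral_l2_diff[OF g f])
    then have "(norm (l2_of g - X (r k)))\<^sup>2 \<le> ((1/4) ^ k)\<^sup>2" by simp
    then show ?thesis by (rule power2_le_imp_le) simp
  qed
  have "(\<lambda>k. X (r k)) \<longlonglongrightarrow> l2_of g"
  proof (rule LIMSEQ_iff[THEN iffD2, rule_format, OF _])
    fix e :: real assume "e > 0"
    then obtain K where K: "(1/4) ^ K < e" using real_arch_pow_inv[of e "1/4"] by auto
    have "norm (X (r k) - l2_of g) < e" if "k \<ge> K" for k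
    proof -
      have "(1/4::real) ^ k \<le> (1/4) ^ K" using that by (intro power_decreasing) auto
      then show ?thesis using lim[of k] K norm_minus_commute[of "X (r k)" "l2_of g"] by linarith
    qed
    then show "\<exists>no. \<forall>k\<ge>no. norm (X (r k) - l2_of g) < e" by blast
  qed
  then have "(X \<circ> r) \<longlonglongrightarrow> l2_of g" by (simp add: o_def)
  then have "X \<longlonglongrightarrow> l2_of g" by (rule Cauchy_converges_subseq[OF X r])
  then show ?thesis by (rule convergentI)
qed

instance l2 :: (euclidean_space) banach
  by standard (rule l2_complete)

section \<open>Multiplication operators and translations\<close>

definition mulop :: "('a::euclidean_space \<Rightarrow> complex) \<Rightarrow> 'a l2 \<Rightarrow> 'a l2" where
  "mulop V a = l2_of (\<lambda>x. V x * rep_l2 a x)"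

context
  fixes V :: "'a::euclidean_space \<Rightarrow> complex" and C :: real
  assumes V [measurable]: "V \<in> borel_measurable borel" and C: "\<And>x. cmod (V x) \<le> C"
begin

lemma sqint_mulop: "sqint f \<Longrightarrow> sqint (\<lambda>x. V x * f x)"
  by (rule sqint_mult[where C=C]) (auto simp: C)

lemma mulop_l2_of: "sqint f \<Longrightarrow> mulop V (l2_of f) = l2_of (\<lambda>x. V x * f x)"
  unfolding mulop_def by (rule l2_of_cong) (use rep_l2_of[of f] in \<open>auto elim: eventually_mono\<close>)

lemma mulop_linear: "linear (mulop V)"
proof (rule linearI)
  have l: "x = l2_of (rep_l2 x)" for x :: "'a l2" by simp
  show "mulop V (a + b) = mulop V a + mulop V b" for a b
    by (subst (1 2 3 4) l) (simp add: l2_of_add mulop_l2_of sqint_mulop distrib_left del: l2_of_rep)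
  show "mulop V (r *\<^sub>R a) = r *\<^sub>R mulop V a" for r a
    by (subst (1 2) l) (simp add: l2_of_scaleR mulop_l2_of sqint_mulop del: l2_of_rep)
qed

lemma norm_mulop_le: "norm (mulop V a) \<le> C * norm a"
proof -
  have C0: "0 \<le> C" using C[of 0] norm_ge_zero[of "V 0"] by linarith
  have "(norm (mulop V a))\<^sup>2 = (\<integral>x. (cmod (V x * rep_l2 a x))\<^sup>2 \<partial>lborel)"
    unfolding mulop_def by (rule norm_l2_of_square) (simp add: sqint_mulop)
  also have "\<dots> \<le> (\<integral>x. C\<^sup>2 * (cmod (rep_l2 a x))\<^sup>2 \<partial>lborel)"
  proof (rule integral_mono)
    show "(cmod (V x * rep_l2 a x))\<^sup>2 \<le> C\<^sup>2 * (cmod (rep_l2 a x))\<^sup>2" for x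
      using C[of x] by (auto simp: norm_mult power_mult_distrib intro!: mult_right_mono power_mono)
  qed (auto intro!: sqint_integrable sqint_mulop)
  also have "\<dots> = (C * norm a)\<^sup>2" by (simp add: norm_l2_square power_mult_distrib)
  finally show ?thesis by (rule power2_le_imp_le) (simp add: C0)
qed

lemma mulop_bounded_linear: "bounded_linear (mulop V)"
  by (rule bounded_linear_intro[where K=C])
     (use mulop_linear norm_mulop_le in \<open>auto simp: linear_add linear_scale mult.commute\<close>)

lemma mulop_adjoint: "inner (mulop V a) b = inner a (mulop (\<lambda>x. cnj (V x)) b)"
proof -
  have b: "sqint (\<lambda>x. cnj (V x) * rep_l2 b x)"
    by (rule sqint_mult[where C=C]) (auto simp: C)
  have "inner (mulop V a) (l2_of (rep_l2 b)) = inner (l2_of (rep_l2 a)) (mulop (\<lambda>x. cnj (V x)) b)"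
    unfolding mulop_def
    by (subst (1 2) inner_l2_of) (simp_all add: sqint_mulop b, simp add: mult_ac)
  then show ?thesis by simp
qed

end

section \<open>Translations\<close>

lemma AE_lborel_shift:
  assumes "AE x in lborel. P x" shows "AE x in lborel. P (x + (v::'a::euclidean_space))"
proof -
  have "AE x in distr lborel borel ((+) v). P x" by (subst lborel_distr_plus) (rule assms)
  from AE_distrD[OF _ this] show ?thesis by (simp add: add.commute)
qed

lemma integral_lborel_shift:
  fixes f :: "'a::euclidean_space \<Rightarrow> 'b::{banach, second_countable_topology}"
  assumes [measurable]: "f \<in> borel_measurable borel"
  shows "(\<integral>x. f (x + v) \<partial>lborel) = (\<integral>x. f x \<partial>lborel)"
proof -
  have "(\<integral>x. f x \<partial>lborel) = (\<integral>x. f x \<partial>distr lborel borel ((+) v))" by (simp add: lborel_distr_plus)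
  also have "\<dots> = (\<integral>x. f (v + x) \<partial>lborel)" by (rule integral_distr) measurable
  finally show ?thesis by (simp add: add.commute)
qed

lemma integrable_lborel_shift:
  fixes f :: "'a::euclidean_space \<Rightarrow> 'b::{banach, second_countable_topology}"
  assumes "integrable lborel f"
  shows "integrable lborel (\<lambda>x. f (x + v))"
proof -
  have [measurable]: "f \<in> borel_measurable borel" using assms by auto
  have "integrable (distr lborel borel ((+) v)) f" using assms by (simp add: lborel_distr_plus)
  then have "integrable lborel (\<lambda>x. f (v + x))" by (subst (asm) integrable_distr_eq) auto
  then show ?thesis by (simp add: add.commute)
qed

lemma sqint_shift: "sqint f \<Longrightarrow> sqint (\<lambda>x. f (x + v))"
  using integrable_lborel_shift[of "\<lambda>x. (cmod (f x))\<^sup>2" v] by (auto simp: sqint_def)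

definition translate :: "'a::euclidean_space \<Rightarrow> 'a l2 \<Rightarrow> 'a l2" where
  "translate v a = l2_of (\<lambda>x. rep_l2 a (x + v))"

lemma translate_l2_of: "sqint f \<Longrightarrow> translate v (l2_of f) = l2_of (\<lambda>x. f (x + v))"
  unfolding translate_def by (rule l2_of_cong) (rule AE_lborel_shift[OF rep_l2_of])

lemma translate_linear: "linear (translate v)"
proof (rule linearI)
  have l: "x = l2_of (rep_l2 x)" for x :: "'a l2" by simp
  show "translate v (a + b) = translate v a + translate v b" for a b
    by (subst (1 2 3 4) l) (simp add: l2_of_add translate_l2_of sqint_shift del: l2_of_rep)
  show "translate v (r *\<^sub>R a) = r *\<^sub>R translate v a" for r a
    by (subst (1 2) l) (simp add: l2_of_scaleR translate_l2_of sqint_shift del: l2_of_rep)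
qed

lemma translate_trans: "translate v (translate w a) = translate (v + w) a"
proof -
  have "translate v (translate w (l2_of (rep_l2 a))) = translate (v + w) (l2_of (rep_l2 a))"
    by (simp add: translate_l2_of sqint_shift add_ac del: l2_of_rep)
  then show ?thesis by simp
qed

lemma translate_0 [simp]: "translate 0 a = a"
  by (simp add: translate_def)

lemma translate_inner: "inner (translate v a) (translate v b) = inner a b"
  unfolding translate_def
  by (subst inner_l2_of)
     (simp_all add: sqint_shift integral_lborel_shift[of "\<lambda>x. rep_l2 a x * cnj (rep_l2 b x)" v] inner_l2_def l2_ip_def)

lemma translate_norm [simp]: "norm (translate v a) = norm a"
  using translate_inner[of v a a] by (simp add: norm_eq)

lemma translate_bounded_linear: "bounded_linear (translate v)"
  by (rule bounded_linear_intro[where K=1])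
     (use translate_linear[of v] in \<open>auto simp: linear_add linear_scale\<close>)

lemma translate_adjoint: "inner (translate v a) b = inner a (translate (- v) b)"
  using translate_inner[of v a "translate (- v) b"] by (simp add: translate_trans)

section \<open>Dominated convergence and differentiation of curves in L2\<close>

lemma l2_dominated_convergence:
  fixes s :: "nat \<Rightarrow> 'a::euclidean_space \<Rightarrow> complex"
  assumes s: "\<And>n. sqint (s n)" and f: "f \<in> borel_measurable borel"
    and lim: "AE x in lborel. (\<lambda>n. s n x) \<longlonglongrightarrow> f x"
    and bd: "\<And>n. AE x in lborel. cmod (s n x) \<le> w x" and w: "integrable lborel (\<lambda>x. (w x)\<^sup>2)"
  shows "sqint f" "(\<lambda>n. l2_of (s n)) \<longlonglongrightarrow> l2_of f"
proof -
  note [measurable] = f sqint_measurable[OF s]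
  have "AE x in lborel. \<forall>n. cmod (s n x) \<le> w x" using bd by (simp add: AE_all_countable)
  with lim have fw: "AE x in lborel. (\<forall>n. cmod (s n x) \<le> w x) \<and> cmod (f x) \<le> w x"
  proof eventually_elim
    case (elim x)
    then have "cmod (f x) \<le> w x" by (intro LIMSEQ_le_const2[OF tendsto_norm[OF elim(1)]]) auto
    with elim show ?case by simp
  qed
  show f': "sqint f"
  proof (rule sqint_bound[OF f w])
    show "AE x in lborel. (cmod (f x))\<^sup>2 \<le> (w x)\<^sup>2"
      using fw by eventually_elim (auto intro: power_mono)
  qed
  have "(\<lambda>n. \<integral>x. (cmod (s n x - f x))\<^sup>2 \<partial>lborel) \<longlonglongrightarrow> integral\<^sup>L lborel (\<lambda>x::'a. 0)"
  proof (rule integral_dominated_convergence[where f = "\<lambda>x::'a. 0::real" and w = "\<lambda>x. 4 * (w x)\<^sup>2"])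
    show "integrable lborel (\<lambda>x. 4 * (w x)\<^sup>2)" using w by simp
    show "AE x in lborel. (\<lambda>n. (cmod (s n x - f x))\<^sup>2) \<longlonglongrightarrow> 0"
      using lim
    proof eventually_elim
      case (elim x)
      then have "(\<lambda>n. (cmod (s n x - f x))\<^sup>2) \<longlonglongrightarrow> (cmod (f x - f x))\<^sup>2" by (intro tendsto_intros)
      then show ?case by simp
    qed
    show "AE x in lborel. norm ((cmod (s n x - f x))\<^sup>2) \<le> 4 * (w x)\<^sup>2" for n
      using fw
    proof eventually_elim
      case (elim x)
      then have "cmod (s n x - f x) \<le> 2 * w x" using norm_triangle_ineq4[of "s n x" "f x"]
        by (smt (verit))
      then have "(cmod (s n x - f x))\<^sup>2 \<le> (2 * w x)\<^sup>2" by (intro power_mono) auto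
      then show ?case by (simp add: power_mult_distrib)
    qed
  qed measurable
  then have "(\<lambda>n. (norm (l2_of (s n) - l2_of f))\<^sup>2) \<longlonglongrightarrow> 0"
    using s f' by (simp add: l2_of_diff norm_l2_of_square)
  then have "(\<lambda>n. sqrt ((norm (l2_of (s n) - l2_of f))\<^sup>2)) \<longlonglongrightarrow> sqrt 0" by (rule tendsto_real_sqrt)
  then show "(\<lambda>n. l2_of (s n)) \<longlonglongrightarrow> l2_of f"
    by (simp add: tendsto_norm_zero_iff LIM_zero_iff)
qed

lemma l2_dominated_convergence_at:
  fixes s :: "real \<Rightarrow> 'a::euclidean_space \<Rightarrow> complex"
  assumes s: "\<And>h. sqint (s h)" and f: "f \<in> borel_measurable borel"
    and lim: "AE x in lborel. ((\<lambda>h. s h x) \<longlongrightarrow> f x) (at 0)"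
    and d: "d > 0" and bd: "\<And>h. h \<noteq> 0 \<Longrightarrow> \<bar>h\<bar> < d \<Longrightarrow> AE x in lborel. cmod (s h x) \<le> w x"
    and w: "integrable lborel (\<lambda>x. (w x)\<^sup>2)"
  shows "sqint f" "((\<lambda>h. l2_of (s h)) \<longlongrightarrow> l2_of f) (at 0)"
proof -
  have seq: "sqint f \<and> (\<lambda>n. l2_of (s (X n))) \<longlonglongrightarrow> l2_of f"
    if X: "X \<longlonglongrightarrow> 0" "\<And>n. X n \<noteq> 0" for X
  proof -
    obtain N where N: "\<And>n. n \<ge> N \<Longrightarrow> \<bar>X n\<bar> < d" using LIMSEQ_D[OF X(1) d] by auto
    have "AE x in lborel. (\<lambda>n. s (X (n + N)) x) \<longlonglongrightarrow> f x"
      using lim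
    proof eventually_elim
      case (elim x)
      have "(\<lambda>n. s (X n) x) \<longlonglongrightarrow> f x"
        using elim X by (auto simp: tendsto_at_iff_sequentially o_def)
      then show ?case by (rule LIMSEQ_ignore_initial_segment)
    qed
    from l2_dominated_convergence[OF s f this bd w] X(2) N
    have "sqint f" "(\<lambda>n. l2_of (s (X (n + N)))) \<longlonglongrightarrow> l2_of f" by auto
    then show ?thesis by (simp add: LIMSEQ_offset)
  qed
  show "sqint f" using seq[of "\<lambda>n. 1 / real (Suc n)"] LIMSEQ_Suc[OF lim_1_over_n] by auto
  show "((\<lambda>h. l2_of (s h)) \<longlongrightarrow> l2_of f) (at 0)"
    using seq by (auto simp: tendsto_at_iff_sequentially o_def)
qed

text \<open>The mean value inequality bounds the difference quotients by the same majorant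
  \<open>w\<close> as the derivatives, so dominated convergence upgrades the pointwise derivative to
  one in L2.\<close>

lemma l2_curve_derivative:
  fixes F F' :: "real \<Rightarrow> 'a::euclidean_space \<Rightarrow> complex"
  assumes F: "\<And>h. sqint (F h)" and F': "F' t \<in> borel_measurable borel" and d: "d > 0"
    and deriv: "\<And>h x. \<bar>h - t\<bar> < d \<Longrightarrow> ((\<lambda>h. F h x) has_vector_derivative F' h x) (at h)"
    and bd: "\<And>h x. \<bar>h - t\<bar> < d \<Longrightarrow> cmod (F' h x) \<le> w x" and w: "integrable lborel (\<lambda>x. (w x)\<^sup>2)"
  shows "sqint (F' t)" "((\<lambda>h. l2_of (F h)) has_vector_derivative l2_of (F' t)) (at t)"
proof -
  let ?q = "\<lambda>h x. (1 / h) *\<^sub>R (F (t + h) x - F t x)"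
  have q: "sqint (?q h)" for h by (intro sqint_scaleR sqint_diff F)
  have lim: "AE x in lborel. ((\<lambda>h. ?q h x) \<longlongrightarrow> F' t x) (at 0)"
    using deriv[of t] d by (simp add: has_vector_derivative_quotient_iff)
  have bq: "cmod (?q h x) \<le> w x" if "h \<noteq> 0" "\<bar>h\<bar> < d" for h x
  proof -
    have "norm (F (t + h) x - F t x) \<le> w x * norm ((t + h) - t)"
    proof (rule differentiable_bound[OF convex_ball[of t d], where f' = "\<lambda>s h. h *\<^sub>R F' s x"])
      fix s assume s: "s \<in> ball t d"
      then have s': "\<bar>s - t\<bar> < d" by (simp add: dist_real_def abs_minus_commute)
      show "((\<lambda>h. F h x) has_derivative (\<lambda>h. h *\<^sub>R F' s x)) (at s within ball t d)"
        using deriv[OF s', of x] by (simp add: has_vector_derivative_def has_derivative_at_withinI)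
      show "onorm (\<lambda>h. h *\<^sub>R F' s x) \<le> w x"
        by (intro onorm_le) (use bd[OF s', of x] in \<open>simp add: mult.commute mult_left_mono\<close>)
    qed (use that d in \<open>auto simp: dist_real_def\<close>)
    then have "cmod (F (t + h) x - F t x) / \<bar>h\<bar> \<le> w x" using that(1) by (simp add: field_simps)
    then show ?thesis unfolding norm_scaleR by simp
  qed
  have m: "F' t \<in> borel_measurable borel" by (rule F')
  note D = l2_dominated_convergence_at[OF q m lim d _ w]
  show "sqint (F' t)" by (rule D) (intro AE_I2 bq)
  have "((\<lambda>h. l2_of (?q h)) \<longlongrightarrow> l2_of (F' t)) (at 0)" by (rule D) (intro AE_I2 bq)
  then show "((\<lambda>h. l2_of (F h)) has_vector_derivative l2_of (F' t)) (at t)"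
    unfolding has_vector_derivative_quotient_iff
    using F by (simp add: l2_of_diff l2_of_scaleR)
qed

text \<open>This and \<open>clamp_cmod\<close>, for positive \<open>m\<close> the radial retraction
  of the plane onto the disc of radius \<open>m\<close>, truncate in space and in size. Both are
  continuous, so truncation preserves continuity and pointwise limits.\<close>

definition cutoff :: "real \<Rightarrow> 'a::real_normed_vector \<Rightarrow> real" where
  "cutoff m x = max 0 (min 1 (m + 1 - norm x))"

definition clamp_cmod :: "real \<Rightarrow> complex \<Rightarrow> complex" where
  "clamp_cmod m z = (m / max m (cmod z)) *\<^sub>R z"

lemma cutoff_bounds: "0 \<le> cutoff m x" "cutoff m x \<le> 1" "norm x \<ge> m + 1 \<Longrightarrow> cutoff m x = 0"
    "norm x \<le> m \<Longrightarrow> cutoff m x = 1"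
  and cutoff_continuous: "continuous_on UNIV (cutoff m)"
  by (auto simp: cutoff_def intro!: continuous_intros)

lemma clamp_cmod_continuous: "0 < m \<Longrightarrow> continuous_on UNIV (clamp_cmod m)"
  unfolding clamp_cmod_def by (intro continuous_intros) (auto simp: max_def)

lemma clamp_cmod_bounds:
  assumes "0 < m" shows "cmod (clamp_cmod m z) \<le> m" "cmod (clamp_cmod m z) \<le> cmod z"
    "cmod z \<le> m \<Longrightarrow> clamp_cmod m z = z"
  using assms by (auto simp: clamp_cmod_def max_def field_simps mult_left_mono)

lemma cutoff_square_integrable:
  "integrable lborel (\<lambda>x::'a::euclidean_space. (c * indicat_real (ball 0 R) x)\<^sup>2)"
proof -
  have "(\<lambda>x::'a. (c * indicat_real (ball 0 R) x)\<^sup>2) = (\<lambda>x. c\<^sup>2 *\<^sub>R indicat_real (ball 0 R) x)"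
    by (auto simp: indicator_def power_mult_distrib)
  moreover have "emeasure lborel (ball (0::'a) R) < \<infinity>"
    by (rule emeasure_bounded_finite) simp
  ultimately show ?thesis by (simp add: integrable_indicator_iff)
qed

text \<open>Translates by vectors of length below 1 share one majorant, \<open>M\<close> times the
  indicator of a ball of radius \<open>R + 1\<close>, so continuity gives pointwise and then L2
  convergence.\<close>

lemma continuous_on_cutoff_mult:
  fixes g :: "'a::euclidean_space \<Rightarrow> complex"
  assumes g: "continuous_on UNIV g" and bd: "\<And>x. cmod (g x) \<le> M" and van: "\<And>x. norm x \<ge> R \<Longrightarrow> g x = 0"
  shows "sqint g" "((\<lambda>v. translate v (l2_of g)) \<longlongrightarrow> l2_of g) (at 0)"
proof -
  have M0: "0 \<le> M" using bd[of 0] norm_ge_zero[of "g 0"] by linarith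
  have m: "g \<in> borel_measurable borel" by (rule borel_measurable_continuous_onI[OF g])
  have le: "cmod (g x) \<le> M * indicat_real (ball 0 R) x" for x
    using bd[of x] van[of x] by (auto simp: indicator_def)
  show sg: "sqint g"
    by (rule sqint_bound[OF m cutoff_square_integrable[of M R]]) (intro AE_I2 power_mono le norm_ge_zero)
  have "(\<lambda>n. translate (X n) (l2_of g)) \<longlonglongrightarrow> l2_of g" if X: "X \<longlonglongrightarrow> 0" for X
  proof -
    obtain N where N: "\<And>n. n \<ge> N \<Longrightarrow> norm (X n) < 1" using LIMSEQ_D[OF X, of 1] by auto
    have "(\<lambda>n. l2_of (\<lambda>x. g (x + X (n + N)))) \<longlonglongrightarrow> l2_of g"
    proof (rule l2_dominated_convergence(2)[OF sqint_shift[OF sg] m])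
      show "AE x in lborel. (\<lambda>n. g (x + X (n + N))) \<longlonglongrightarrow> g x"
      proof (rule AE_I2)
        fix x
        have "(\<lambda>n. x + X (n + N)) \<longlonglongrightarrow> x + 0"
          by (intro tendsto_intros LIMSEQ_ignore_initial_segment X)
        then show "(\<lambda>n. g (x + X (n + N))) \<longlonglongrightarrow> g x"
          using g by (auto simp: continuous_on_eq_continuous_at intro: isCont_tendsto_compose)
      qed
      show "integrable lborel (\<lambda>x::'a. (M * indicat_real (ball 0 (R + 1)) x)\<^sup>2)"
        by (rule cutoff_square_integrable)
      show "AE x in lborel. cmod (g (x + X (n + N))) \<le> M * indicat_real (ball 0 (R + 1)) x" for n
      proof (rule AE_I2)
        fix x
        show "cmod (g (x + X (n + N))) \<le> M * indicat_real (ball 0 (R + 1)) x"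
        proof (cases "norm x < R + 1")
          case False
          have "norm x \<le> norm (x + X (n + N)) + norm (X (n + N))"
            using norm_triangle_ineq4[of "x + X (n + N)" "X (n + N)"] by simp
          then have "norm (x + X (n + N)) \<ge> R" using False N[of "n + N"] by simp
          then show ?thesis using van M0 by simp
        qed (simp add: bd)
      qed
    qed
    then show ?thesis by (simp add: translate_l2_of sg LIMSEQ_offset)
  qed
  then show "((\<lambda>v. translate v (l2_of g)) \<longlongrightarrow> l2_of g) (at 0)"
    by (auto simp: tendsto_at_iff_sequentially o_def)
qed

text \<open>The set \<open>S\<close> of vectors with this property is closed, since translations are
  isometries, and it contains the bounded continuous functions of bounded support. A general vector
  is reached by two successive limits: continuous approximants at a fixed truncation level, then the
  level to infinity.\<close>

lemma translate_continuous_at_0: "((\<lambda>v. translate v a) \<longlongrightarrow> a) (at 0)"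
proof -
  define S where "S = {a::'a l2. ((\<lambda>v. translate v a) \<longlongrightarrow> a) (at 0)}"
  have closed: "a \<in> S" if s: "\<And>n. s n \<in> S" "s \<longlonglongrightarrow> a" for s :: "nat \<Rightarrow> 'a l2" and a
    unfolding S_def mem_Collect_eq
  proof (rule tendstoI)
    fix e :: real assume e: "e > 0"
    then obtain n where n: "dist (s n) a < e / 3"
      using tendstoD[OF s(2), of "e/3"] by (auto simp: eventually_sequentially)
    have "\<forall>\<^sub>F v in at 0. dist (translate v (s n)) (s n) < e / 3"
      using s(1)[of n] e unfolding S_def by (auto dest!: tendstoD[where e="e/3"])
    then show "\<forall>\<^sub>F v in at 0. dist (translate v a) a < e"
    proof eventually_elim
      case (elim v)
      have "dist (translate v a) (translate v (s n)) = dist (s n) a"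
        using translate_norm[of v "a - s n"] translate_linear[of v] by (simp add: dist_norm linear_diff norm_minus_commute)
      then show ?case
        using elim n dist_triangle[of "translate v a" a "translate v (s n)"] dist_triangle[of "translate v (s n)" a "s n"]
        by linarith
    qed
  qed
  define f where "f = rep_l2 a"
  have [measurable]: "f \<in> borel_measurable borel" and sf: "sqint f" by (simp_all add: f_def)
  \<comment> \<open>Continuous approximants of a measurable function converge almost everywhere but
    obey no bound; applying \<open>h m\<close> to them supplies a square integrable
    majorant.\<close>
  define h where "h m z x = cutoff (real (Suc m)) x *\<^sub>R clamp_cmod (real (Suc m)) z" for m z and x :: 'a
  have hb: "cmod (h m z x) \<le> real (Suc m)" "cmod (h m z x) \<le> cmod z"
      "norm x \<ge> real m + 2 \<Longrightarrow> h m z x = 0" for m z x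
    using clamp_cmod_bounds[of "real (Suc m)" z] cutoff_bounds[where m = "real (Suc m)" and x = x]
      mult_mono[of "cutoff (real (Suc m)) x" 1 "cmod (clamp_cmod (real (Suc m)) z)" "real (Suc m)"]
      mult_mono[of "cutoff (real (Suc m)) x" 1 "cmod (clamp_cmod (real (Suc m)) z)" "cmod z"]
    by (auto simp: h_def)
  have hcont: "continuous_on UNIV (\<lambda>z. h m z x)" for m x
    unfolding h_def by (intro continuous_intros continuous_on_compose2[OF clamp_cmod_continuous]) auto
  have hcont2: "continuous_on UNIV (\<lambda>x. h m (g x) x)" if "continuous_on UNIV g" for m g
    unfolding h_def
    by (intro continuous_intros continuous_on_compose2[OF clamp_cmod_continuous] cutoff_continuous
        continuous_on_compose2[OF clamp_cmod_continuous _ subset_UNIV] that) auto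
  have hmeas: "(\<lambda>x. h m (f x) x) \<in> borel_measurable borel" for m
  proof -
    have [measurable]: "clamp_cmod (real (Suc m)) \<in> borel_measurable borel"
      "(cutoff (real (Suc m)) :: 'a \<Rightarrow> real) \<in> borel_measurable borel"
      by (intro borel_measurable_continuous_onI clamp_cmod_continuous cutoff_continuous; simp)+
    show ?thesis unfolding h_def by measurable
  qed
  have ind: "cmod (h m z x) \<le> real (Suc m) * indicat_real (ball 0 (real m + 2)) x" for m z x
    using hb(1)[of m z x] hb(3)[of m x z] by (auto simp: indicator_def)
  have 1: "sqint (\<lambda>x. h m (f x) x) \<and> l2_of (\<lambda>x. h m (f x) x) \<in> S" for m
  proof -
    have "f \<in> borel_measurable lebesgue" by (rule measurable_completion) simp
    then have "f measurable_on UNIV" by (rule lebesgue_measurable_imp_measurable_on) simp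
    then obtain N g where N: "negligible N" and g: "\<And>n. continuous_on UNIV (g n)"
        and lim: "\<And>x. x \<notin> N \<Longrightarrow> (\<lambda>n. g n x) \<longlonglongrightarrow> f x"
      unfolding measurable_on_def by auto
    have AEN: "AE x in lborel. x \<notin> N"
      using AE_not_in[OF N[unfolded negligible_iff_null_sets]] by (rule AE_completion_iff[THEN iffD1])
    have G: "sqint (\<lambda>x. h m (g n x) x)"
      "((\<lambda>v. translate v (l2_of (\<lambda>x. h m (g n x) x))) \<longlongrightarrow> l2_of (\<lambda>x. h m (g n x) x)) (at 0)" for n
      using continuous_on_cutoff_mult[of "\<lambda>x. h m (g n x) x" "real (Suc m)" "real m + 2"] hcont2[OF g] hb
      by blast+
    have lim': "AE x in lborel. (\<lambda>n. h m (g n x) x) \<longlonglongrightarrow> h m (f x) x"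
      using AEN
    proof eventually_elim
      case (elim x)
      from lim[OF elim] show ?case
        using hcont[of m x] by (auto simp: continuous_on_eq_continuous_at intro: isCont_tendsto_compose)
    qed
    have "sqint (\<lambda>x. h m (f x) x)" "(\<lambda>n. l2_of (\<lambda>x. h m (g n x) x)) \<longlonglongrightarrow> l2_of (\<lambda>x. h m (f x) x)"
      using l2_dominated_convergence[OF G(1) hmeas lim' AE_I2[OF ind] cutoff_square_integrable] by blast+
    moreover have "l2_of (\<lambda>x. h m (g n x) x) \<in> S" for n
      using G(2)[of n] by (simp add: S_def)
    ultimately show ?thesis
      using closed[of "\<lambda>n. l2_of (\<lambda>x. h m (g n x) x)" "l2_of (\<lambda>x. h m (f x) x)"] by simp
  qed
  have "(\<lambda>m. l2_of (\<lambda>x. h m (f x) x)) \<longlonglongrightarrow> l2_of f"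
  proof (rule l2_dominated_convergence(2)[where w = "\<lambda>x. cmod (f x)"])
    show "AE x in lborel. (\<lambda>m. h m (f x) x) \<longlonglongrightarrow> f x"
    proof (rule AE_I2, rule tendsto_eventually)
      fix x
      obtain K where K: "norm x \<le> real K" "cmod (f x) \<le> real K"
        using real_arch_simple[of "max (norm x) (cmod (f x))"] by auto
      have "h m (f x) x = f x" if "m \<ge> K" for m
        unfolding h_def using K that by (subst cutoff_bounds(4)) (auto simp: clamp_cmod_bounds(3))
      then show "\<forall>\<^sub>F m in sequentially. h m (f x) x = f x" by (auto simp: eventually_sequentially)
    qed
  qed (use 1 sf hb(2) in \<open>auto simp: sqint_integrable\<close>)
  with 1 have "l2_of f \<in> S"
    using closed[of "\<lambda>m. l2_of (\<lambda>x. h m (f x) x)" "l2_of f"] by simp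
  then show ?thesis by (simp add: S_def f_def)
qed

lemma translate_continuous: "continuous_on UNIV (\<lambda>v. translate v a)"
proof -
  have "((\<lambda>h. translate (v + h) a) \<longlongrightarrow> translate v a) (at 0)" for v
  proof -
    have "((\<lambda>h. translate v (translate h a)) \<longlongrightarrow> translate v a) (at 0)"
      by (rule bounded_linear.tendsto[OF translate_bounded_linear translate_continuous_at_0])
    then show ?thesis by (simp add: translate_trans)
  qed
  then show ?thesis by (simp add: continuous_on_eq_continuous_at isCont_iff)
qed

section \<open>The free Schroedinger group\<close>

abbreviation imul :: "'a::euclidean_space l2 \<Rightarrow> 'a l2" where "imul \<equiv> mulop (\<lambda>x. \<i>)"

lemma imul_l2_of: "sqint f \<Longrightarrow> imul (l2_of f) = l2_of (\<lambda>x. \<i> * f x)"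
  by (rule mulop_l2_of[where C=1]) auto

lemma imul_bounded_linear: "bounded_linear imul"
  by (rule mulop_bounded_linear[where C=1]) auto

lemma imul_linear: "linear imul"
  by (rule mulop_linear[where C=1]) auto

lemma imul_skew: "inner (imul a) b = - inner a (imul b)"
proof -
  have "mulop (\<lambda>x. cnj \<i>) (l2_of (rep_l2 b)) = - imul (l2_of (rep_l2 b))"
    by (subst (1 2) mulop_l2_of[where C=1]) (auto simp: l2_of_uminus)
  then show ?thesis using mulop_adjoint[of "\<lambda>x. \<i>" 1 a b] by simp
qed

lemma imul_imul: "imul (imul a) = - a"
proof -
  have "imul (imul (l2_of (rep_l2 a))) = - l2_of (rep_l2 a)"
    by (subst imul_l2_of imul_l2_of l2_of_uminus; (intro sqint_cmult sqint_rep)?)+ simp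
  then show ?thesis by simp
qed

lemma imul_inner: "inner (imul a) (imul b) = inner a b"
  by (simp add: imul_skew imul_imul)

lemma imul_norm [simp]: "norm (imul a) = norm a"
  using imul_inner[of a a] by (simp add: norm_eq)

lemma translate_mulop_const: "translate v (mulop (\<lambda>x. c) a) = mulop (\<lambda>x. c) (translate v a)"
proof -
  note m = mulop_l2_of[where V = "\<lambda>x. c" and C = "cmod c", OF _ order_refl]
  have "translate v (mulop (\<lambda>x. c) (l2_of (rep_l2 a))) = mulop (\<lambda>x. c) (translate v (l2_of (rep_l2 a)))"
    by (simp add: translate_l2_of m sqint_shift del: l2_of_rep)
  then show ?thesis by simp
qed

section \<open>Difference quotients, derivatives in L2 and the Laplacian\<close>

lemma translate_commute: "translate v (translate w a) = translate w (translate v a)"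
  by (simp add: translate_trans add.commute)

definition dlap :: "real \<Rightarrow> 'a::euclidean_space l2 \<Rightarrow> 'a l2" where
  "dlap e a = (\<Sum>b\<in>Basis. (1 / e\<^sup>2) *\<^sub>R (translate (e *\<^sub>R b) a + translate (- (e *\<^sub>R b)) a - 2 *\<^sub>R a))"

lemma dlap_bounded_linear: "bounded_linear (dlap e)"
  unfolding dlap_def
  by (intro bounded_linear_sum bounded_linear_compose[OF bounded_linear_scaleR_right] bounded_linear_sub
      bounded_linear_add translate_bounded_linear bounded_linear_scaleR_right)

lemma dlap_commute:
  assumes T: "linear T" and comm: "\<And>v a. T (translate v a) = translate v (T a)"
  shows "T (dlap e a) = dlap e (T a)"
  unfolding dlap_def
  by (simp add: linear_sum[OF T] linear_scale[OF T] linear_add[OF T] linear_diff[OF T] comm)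

lemma dlap_symmetric: "inner (dlap e a) b = inner a (dlap e b)"
  unfolding dlap_def
  by (simp add: inner_sum_left inner_sum_right inner_add_left inner_add_right inner_diff_left inner_diff_right
      translate_adjoint add.commute)

text \<open>The strong L2 derivative of \<open>a\<close> along \<open>v\<close>, as a relation: the
  generator of the group of translations along \<open>v\<close>, evaluated at
  \<open>a\<close>.\<close>

definition dgen :: "'a::euclidean_space \<Rightarrow> 'a l2 \<Rightarrow> 'a l2 \<Rightarrow> bool" where
  "dgen v a a' \<longleftrightarrow> ((\<lambda>h. translate (h *\<^sub>R v) a) has_vector_derivative a') (at 0)"

lemma dgen_commute:
  assumes T: "bounded_linear T" and comm: "\<And>v a. T (translate v a) = translate v (T a)" and "dgen v a a'"
  shows "dgen v (T a) (T a')"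
  using bounded_linear.has_vector_derivative[OF T assms(3)[unfolded dgen_def]] by (simp add: dgen_def comm)

lemma dgen_at:
  assumes "dgen v a a'"
  shows "((\<lambda>h. translate (h *\<^sub>R v) a) has_vector_derivative translate (t *\<^sub>R v) a') (at t)"
proof -
  have "dgen v (translate (t *\<^sub>R v) a) (translate (t *\<^sub>R v) a')"
    by (rule dgen_commute[OF translate_bounded_linear translate_commute assms])
  then show ?thesis
    by (simp add: dgen_def has_vector_derivative_quotient_iff translate_trans scaleR_add_left add.commute)
qed

text \<open>The remainder \<open>r\<close> is controlled through its own derivative
  \<open>g' s - g' (- s) - (2 * s) *\<^sub>R a2\<close>, in which the first order expansions of
  \<open>g'\<close> at \<open>s\<close> and at \<open>- s\<close> cancel up to
  \<open>2 * \<eta> * |s|\<close>. The mean value inequality then gives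
  \<open>norm (r e) \<le> 2 * \<eta> * e\<^sup>2\<close>, so that only differentiability of
  \<open>g'\<close> at 0 enters.\<close>

lemma second_difference_tendsto:
  assumes 1: "dgen v a a1" and 2: "dgen v a1 a2"
  shows "((\<lambda>e. (1 / e\<^sup>2) *\<^sub>R (translate (e *\<^sub>R v) a + translate (- (e *\<^sub>R v)) a - 2 *\<^sub>R a)) \<longlongrightarrow> a2) (at 0)"
proof (rule LIM_I)
  fix \<epsilon> :: real assume "\<epsilon> > 0"
  \<comment> \<open>Twice \<open>\<eta>\<close> has to stay strictly below
    \<open>\<epsilon>\<close>.\<close>
  define \<eta> where "\<eta> = \<epsilon> / 3"
  have \<eta>: "\<eta> > 0" using \<open>\<epsilon> > 0\<close> by (simp add: \<eta>_def)
  define g' where "g' s = translate (s *\<^sub>R v) a1" for s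
  have "((\<lambda>h. (1 / h) *\<^sub>R (g' h - g' 0)) \<longlongrightarrow> a2) (at 0)"
    using 2 by (simp add: dgen_def g'_def has_vector_derivative_quotient_iff)
  from LIM_D[OF this \<eta>] obtain d where d: "d > 0"
    and dd: "\<And>h. h \<noteq> 0 \<Longrightarrow> \<bar>h\<bar> < d \<Longrightarrow> norm ((1 / h) *\<^sub>R (g' h - g' 0) - a2) < \<eta>" by auto
  have taylor: "norm (g' h - g' 0 - h *\<^sub>R a2) \<le> \<eta> * \<bar>h\<bar>" if "\<bar>h\<bar> < d" for h
  proof (cases "h = 0")
    case False
    have "g' h - g' 0 - h *\<^sub>R a2 = h *\<^sub>R ((1 / h) *\<^sub>R (g' h - g' 0) - a2)"
      using False by (simp add: scaleR_diff_right)
    then have "norm (g' h - g' 0 - h *\<^sub>R a2) = \<bar>h\<bar> * norm ((1 / h) *\<^sub>R (g' h - g' 0) - a2)"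
      by (simp only: norm_scaleR real_norm_def)
    also have "\<dots> \<le> \<bar>h\<bar> * \<eta>" by (intro mult_left_mono less_imp_le dd False that abs_ge_zero)
    finally show ?thesis by (simp only: mult.commute)
  qed simp
  define r where "r e = translate (e *\<^sub>R v) a + translate (- (e *\<^sub>R v)) a - 2 *\<^sub>R a - e\<^sup>2 *\<^sub>R a2" for e
  have r': "(r has_vector_derivative g' s - g' (- s) - (2 * s) *\<^sub>R a2) (at s)" for s
  proof -
    have A: "((\<lambda>h. translate (h *\<^sub>R v) a) has_vector_derivative g' s) (at s)"
      unfolding g'_def by (rule dgen_at[OF 1])
    have "((\<lambda>h. translate (h *\<^sub>R v) a) has_vector_derivative g' (- s)) (at (- s))"
      unfolding g'_def by (rule dgen_at[OF 1])
    moreover have "((\<lambda>t::real. - t) has_vector_derivative - 1) (at s)" by (auto intro!: derivative_eq_intros)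
    ultimately have B: "((\<lambda>h. translate (- (h *\<^sub>R v)) a) has_vector_derivative - g' (- s)) (at s)"
      using vector_diff_chain_at[of "\<lambda>t. - t" "-1" s "\<lambda>h. translate (h *\<^sub>R v) a" "g' (- s)"] by (simp add: o_def)
    have C: "((\<lambda>e. e\<^sup>2 *\<^sub>R a2) has_vector_derivative (2 * s) *\<^sub>R a2) (at s)"
      by (auto intro!: derivative_eq_intros)
    show ?thesis unfolding r_def
      using has_vector_derivative_diff[OF has_vector_derivative_diff[OF has_vector_derivative_add[OF A B]
        has_vector_derivative_const[of "2 *\<^sub>R a"]] C] by simp
  qed
  have rb: "norm (r e) \<le> 2 * \<eta> * e\<^sup>2" if e: "\<bar>e\<bar> < d" for e
  proof -
    have "norm (r e - r 0) \<le> (2 * \<eta> * \<bar>e\<bar>) * norm (e - 0)"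
    proof (rule differentiable_bound[OF convex_real_interval(5)[of "- \<bar>e\<bar>" "\<bar>e\<bar>"],
        where f = r and x = e and y = 0 and f' = "\<lambda>s h. h *\<^sub>R (g' s - g' (- s) - (2 * s) *\<^sub>R a2)"])
      fix s assume "s \<in> {- \<bar>e\<bar>..\<bar>e\<bar>}"
      then have s: "\<bar>s\<bar> \<le> \<bar>e\<bar>" by auto
      show "(r has_derivative (\<lambda>h. h *\<^sub>R (g' s - g' (- s) - (2 * s) *\<^sub>R a2))) (at s within {- \<bar>e\<bar>..\<bar>e\<bar>})"
        by (rule has_derivative_at_withinI[OF r'[of s, unfolded has_vector_derivative_def]])
      have "g' s - g' (- s) - (2 * s) *\<^sub>R a2 = (g' s - g' 0 - s *\<^sub>R a2) - (g' (- s) - g' 0 - (- s) *\<^sub>R a2)"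
        unfolding mult_2 scaleR_add_left by simp
      from arg_cong[OF this, of norm]
      have "norm (g' s - g' (- s) - (2 * s) *\<^sub>R a2) \<le> \<eta> * \<bar>s\<bar> + \<eta> * \<bar>- s\<bar>"
        using norm_triangle_ineq4[of "g' s - g' 0 - s *\<^sub>R a2" "g' (- s) - g' 0 - (- s) *\<^sub>R a2"]
          taylor[of s] taylor[of "- s"] le_less_trans[OF s e] by simp
      also have "\<dots> \<le> 2 * \<eta> * \<bar>e\<bar>" using s \<eta> by (simp add: mult_left_mono)
      finally show "onorm (\<lambda>h. h *\<^sub>R (g' s - g' (- s) - (2 * s) *\<^sub>R a2)) \<le> 2 * \<eta> * \<bar>e\<bar>"
        by (intro onorm_le) (simp add: mult.commute mult_left_mono)
    qed auto
    moreover have "r 0 = 0" by (simp add: r_def scaleR_2)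
    ultimately show ?thesis by (simp add: power2_eq_square mult.assoc)
  qed
  show "\<exists>s>0. \<forall>e. e \<noteq> 0 \<and> norm (e - 0) < s \<longrightarrow>
      norm ((1 / e\<^sup>2) *\<^sub>R (translate (e *\<^sub>R v) a + translate (- (e *\<^sub>R v)) a - 2 *\<^sub>R a) - a2) < \<epsilon>"
  proof (intro exI[of _ d] conjI allI impI d)
    fix e :: real assume e: "e \<noteq> 0 \<and> norm (e - 0) < d"
    have "(1 / e\<^sup>2) *\<^sub>R X - a2 = (1 / e\<^sup>2) *\<^sub>R (X - e\<^sup>2 *\<^sub>R a2)" for X :: "'a l2"
      using e by (simp add: scaleR_diff_right)
    then have "(1 / e\<^sup>2) *\<^sub>R (translate (e *\<^sub>R v) a + translate (- (e *\<^sub>R v)) a - 2 *\<^sub>R a) - a2 = (1 / e\<^sup>2) *\<^sub>R r e"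
      unfolding r_def by blast
    then have "norm ((1 / e\<^sup>2) *\<^sub>R (translate (e *\<^sub>R v) a + translate (- (e *\<^sub>R v)) a - 2 *\<^sub>R a) - a2) = norm (r e) / e\<^sup>2"
      by (simp only: norm_scaleR) simp
    also have "\<dots> \<le> 2 * \<eta>" using rb[of e] e by (simp add: field_simps)
    also have "\<dots> < \<epsilon>" using \<open>\<epsilon> > 0\<close> by (simp add: \<eta>_def)
    finally show "norm ((1 / e\<^sup>2) *\<^sub>R (translate (e *\<^sub>R v) a + translate (- (e *\<^sub>R v)) a - 2 *\<^sub>R a) - a2) < \<epsilon>" .
  qed
qed

text \<open>A relation for the Laplacian: what is asked for are the pure second derivatives along
  the basis directions, each as an iterated strong derivative.\<close>

definition lapgen :: "'a::euclidean_space l2 \<Rightarrow> 'a l2 \<Rightarrow> bool" where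
  "lapgen a L \<longleftrightarrow> (\<exists>a1 a2. (\<forall>b\<in>Basis. dgen b a (a1 b) \<and> dgen b (a1 b) (a2 b)) \<and> L = (\<Sum>b\<in>Basis. a2 b))"

lemma dlap_tendsto:
  assumes "lapgen a L" shows "((\<lambda>e. dlap e a) \<longlongrightarrow> L) (at 0)"
  using assms unfolding lapgen_def dlap_def
  by (auto intro!: tendsto_sum second_difference_tendsto)

text \<open>Averages of translates are smooth, which makes the domain of the Laplacian dense.\<close>

definition avg :: "'a::euclidean_space \<Rightarrow> real \<Rightarrow> 'a l2 \<Rightarrow> 'a l2" where
  "avg v h a = (1 / h) *\<^sub>R sint (\<lambda>s. translate (s *\<^sub>R v) a) h"

lemma translate_curve_continuous: "continuous_on UNIV (\<lambda>s. translate (s *\<^sub>R v) a)"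
  by (intro continuous_on_compose2[OF translate_continuous] continuous_intros) auto

lemma sint_bounded_linear:
  assumes T: "bounded_linear T" and f: "continuous_on UNIV f"
  shows "T (sint f h) = sint (\<lambda>s. T (f s)) h"
proof -
  have "f integrable_on {a..b}" for a b
    by (rule integrable_continuous_real) (rule continuous_on_subset[OF f], simp)
  then have "T (integral {a..b} f) = integral {a..b} (\<lambda>s. T (f s))" for a b
    using integral_linear[OF _ T, of f "{a..b}"] by (simp add: o_def)
  then show ?thesis using T by (simp add: sint_def linear_diff bounded_linear.linear)
qed

lemma sint_shift:
  assumes f: "continuous_on UNIV f"
  shows "sint (\<lambda>r. f (r + s)) h = sint f (s + h) - sint f s"
proof -
  have fs: "continuous_on UNIV (\<lambda>r. f (r + s))" by (intro continuous_on_compose2[OF f] continuous_intros) auto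
  define z where "z h = sint (\<lambda>r. f (r + s)) h - sint f (s + h)" for h
  have "(z has_vector_derivative 0) (at h within UNIV)" for h
  proof -
    have "((\<lambda>h. sint f (s + h)) has_vector_derivative f (s + h)) (at h)"
      using sint_has_vector_derivative[OF f, of "s + h"]
      by (simp add: has_vector_derivative_quotient_iff add.assoc)
    from has_vector_derivative_diff[OF sint_has_vector_derivative[OF fs, of h] this]
    show ?thesis unfolding z_def by (simp add: add.commute)
  qed
  then obtain c where "\<And>h. z h = c" using has_vector_derivative_zero_constant[OF convex_UNIV, of z] by auto
  then have "z h = z 0" by simp
  then show ?thesis by (simp add: z_def sint_def algebra_simps)
qed

lemma avg_commute:
  assumes T: "bounded_linear T" and comm: "\<And>v a. T (translate v a) = translate v (T a)"
  shows "T (avg v h a) = avg v h (T a)"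
  unfolding avg_def using T
  by (simp add: linear_scale bounded_linear.linear sint_bounded_linear[OF T translate_curve_continuous] comm)

lemma avg_bounded_linear: "bounded_linear (avg v h)"
proof (rule bounded_linear_intro)
  show "avg v h (a + b) = avg v h a + avg v h b" for a b
    by (simp add: avg_def linear_add[OF translate_linear] sint_add translate_curve_continuous scaleR_add_right)
  show "avg v h (r *\<^sub>R a) = r *\<^sub>R avg v h a" for r a
    by (simp add: avg_def linear_scale[OF translate_linear]
        sint_bounded_linear[OF bounded_linear_scaleR_right translate_curve_continuous, of r v a h, symmetric])
  show "norm (avg v h a) \<le> norm a * 1" for a
  proof -
    have "norm (sint (\<lambda>s. translate (s *\<^sub>R v) a) h) \<le> norm a * \<bar>h\<bar> ^ Suc 0 / Suc 0"
      by (rule norm_sint_le_power) (auto intro: translate_curve_continuous)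
    then show ?thesis by (cases "h = 0") (simp_all add: avg_def field_simps)
  qed
qed

lemma translate_avg: "translate w (avg v h a) = avg v h (translate w a)"
  by (rule avg_commute[OF translate_bounded_linear translate_commute])

text \<open>Translating an average shifts its window of integration, so the derivative is the
  difference of the integrand at the two ends of the window, divided by \<open>h\<close>.\<close>

lemma dgen_avg: "dgen v (avg v h a) ((1 / h) *\<^sub>R (translate (h *\<^sub>R v) a - a))"
proof -
  let ?f = "\<lambda>s. translate (s *\<^sub>R v) a"
  have eq: "translate (s *\<^sub>R v) (avg v h a) = (1 / h) *\<^sub>R (sint ?f (s + h) - sint ?f s)" for s
  proof -
    have "translate (s *\<^sub>R v) (avg v h a) = (1 / h) *\<^sub>R sint (\<lambda>r. ?f (r + s)) h"
      by (subst translate_avg) (simp add: avg_def translate_trans scaleR_add_left)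
    then show ?thesis by (simp add: sint_shift[OF translate_curve_continuous])
  qed
  have "((\<lambda>s. sint ?f (s + h)) has_vector_derivative ?f h) (at 0)"
    using sint_has_vector_derivative[OF translate_curve_continuous, of v a h]
    by (simp add: has_vector_derivative_quotient_iff add.commute)
  from has_vector_derivative_diff[OF this sint_has_vector_derivative[OF translate_curve_continuous, of v a 0]]
  have "((\<lambda>s. sint ?f (s + h) - sint ?f s) has_vector_derivative ?f h - a) (at 0)" by simp
  from bounded_linear.has_vector_derivative[OF bounded_linear_scaleR_right this, of "1 / h"]
  show ?thesis unfolding dgen_def eq .
qed

lemma avg_tendsto: "((\<lambda>h. avg v h a) \<longlongrightarrow> a) (at 0)"
  using sint_has_vector_derivative[OF translate_curve_continuous, of v a 0]
  by (simp add: has_vector_derivative_quotient_iff avg_def sint_def[of _ 0])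

text \<open>Averaging twice along a direction yields two derivatives along it. Averages commute with
  translations and hence with derivatives, so regularity gained in earlier directions survives and
  the directions can be treated one after another.\<close>

lemma lapgen_dense:
  fixes a :: "'a::euclidean_space l2"
  assumes "e > 0" shows "\<exists>y L. norm (y - a) < e \<and> lapgen y L"
proof -
  have "\<exists>y. norm (y - a) < e \<and> (\<forall>b\<in>S. \<exists>a1 a2. dgen b y a1 \<and> dgen b a1 a2)"
    if "finite S" "e > 0" for S :: "'a set" and e
    using that
  proof (induction S arbitrary: e rule: finite_induct)
    case empty
    then show ?case by (intro exI[of _ a]) simp
  next
    case (insert b S)
    from insert.IH[of "e / 3"] insert.prems obtain y where y: "norm (y - a) < e / 3"
      "\<And>c. c \<in> S \<Longrightarrow> \<exists>a1 a2. dgen c y a1 \<and> dgen c a1 a2" by auto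
    have close: "\<exists>h. norm (avg b h z - z) < e / 3" for z
    proof -
      from LIM_D[OF avg_tendsto[of b z], of "e / 3"] insert.prems obtain d where "d > 0"
        "\<And>h. h \<noteq> 0 \<Longrightarrow> \<bar>h\<bar> < d \<Longrightarrow> norm (avg b h z - z) < e / 3" by auto
      then show ?thesis by (intro exI[of _ "d / 2"]) auto
    qed
    obtain h where h: "norm (avg b h y - y) < e / 3" using close by blast
    obtain k where k: "norm (avg b k (avg b h y) - avg b h y) < e / 3" using close by blast
    define T where "T x = avg b k (avg b h x)" for x
    have T: "bounded_linear T"
      unfolding T_def by (rule bounded_linear_compose[OF avg_bounded_linear avg_bounded_linear])
    have Tc: "T (translate v x) = translate v (T x)" for v x by (simp add: T_def translate_avg)
    have "norm (T y - a) < e"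
    proof -
      have "T y - a = (T y - avg b h y) + ((avg b h y - y) + (y - a))" by simp
      from arg_cong[OF this, of norm] have "norm (T y - a) \<le> norm (T y - avg b h y) + (norm (avg b h y - y) + norm (y - a))"
        using norm_triangle_ineq[of "T y - avg b h y" "(avg b h y - y) + (y - a)"]
          norm_triangle_ineq[of "avg b h y - y" "y - a"] by linarith
      then show ?thesis using y(1) h k by (simp add: T_def)
    qed
    moreover have "\<exists>a1 a2. dgen c (T y) a1 \<and> dgen c a1 a2" if "c \<in> insert b S" for c
    proof (cases "c = b")
      case True
      \<comment> \<open>The derivative of the outer average is a difference quotient of the inner
        average. Forming this quotient commutes with translations, so it can be differentiated once
        more.\<close>
      define D where "D x = (1 / k) *\<^sub>R (translate (k *\<^sub>R b) x - x)" for x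
      have "bounded_linear D"
        unfolding D_def
        by (intro bounded_linear_compose[OF bounded_linear_scaleR_right] bounded_linear_sub
            translate_bounded_linear bounded_linear_ident)
      moreover have "D (translate v x) = translate v (D x)" for v x
        unfolding D_def by (simp add: linear_scale[OF translate_linear] linear_diff[OF translate_linear] translate_commute)
      ultimately have "dgen b (D (avg b h y)) (D ((1 / h) *\<^sub>R (translate (h *\<^sub>R b) y - y)))"
        by (rule dgen_commute[OF _ _ dgen_avg])
      moreover have "dgen b (T y) (D (avg b h y))" unfolding T_def D_def by (rule dgen_avg)
      ultimately show ?thesis using True by blast
    next
      case False
      then show ?thesis using y(2)[of c] that dgen_commute[OF T Tc] by blast
    qed
    ultimately show ?case by blast
  qed
  from this[OF finite_Basis assms] obtain y where y: "norm (y - a) < e"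
    "\<And>b. b \<in> Basis \<Longrightarrow> \<exists>a1 a2. dgen b y a1 \<and> dgen b a1 a2" by blast
  then obtain a1 a2 where "\<And>b. b \<in> Basis \<Longrightarrow> dgen b y (a1 b) \<and> dgen b (a1 b) (a2 b)" by metis
  then have "lapgen y (\<Sum>b\<in>Basis. a2 b)" unfolding lapgen_def by blast
  with y show ?thesis by blast
qed

text \<open>Each \<open>dlap e\<close> is symmetric and commutes with multiplication by \<i>, so
  their composition is skew; any two of them commute, being built from translations. Convergence on
  a dense set is that of second difference quotients.\<close>

theorem schroedinger_group_exists:
  obtains U :: "real \<Rightarrow> 'a::euclidean_space l2 \<Rightarrow> 'a l2"
  where "isometric_group U" "\<And>a L. lapgen a L \<Longrightarrow> isometric_group.generates U a (imul L)"
proof -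
  define B :: "nat \<Rightarrow> 'a l2 \<Rightarrow> 'a l2" where "B k a = imul (dlap (1 / real (Suc k)) a)" for k a
  have imd: "imul (dlap e a) = dlap e (imul a)" for e and a :: "'a l2"
    by (rule dlap_commute[OF imul_linear]) (simp add: translate_mulop_const)
  have skew: "skew_operator (B k)" for k
  proof (rule skew_operator.intro)
    show "bounded_linear (B k)"
      unfolding B_def by (rule bounded_linear_compose[OF imul_bounded_linear dlap_bounded_linear])
    show "inner (B k x) y = - inner x (B k y)" for x y
      by (simp add: B_def imul_skew dlap_symmetric imd)
  qed
  have dd: "dlap e (dlap e' a) = dlap e' (dlap e a)" for e e' and a :: "'a l2"
  proof (rule dlap_commute)
    show "linear (dlap e :: 'a l2 \<Rightarrow> _)" using dlap_bounded_linear by (rule bounded_linear.linear)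
    show "dlap e (translate v a) = translate v (dlap e a)" for v and a :: "'a l2"
      by (rule dlap_commute[OF translate_linear translate_commute, symmetric])
  qed
  have comm: "B k (B l x) = B l (B k x)" for k l x
    by (simp add: B_def imd[symmetric]) (simp add: imd dd)
  have lim: "(\<lambda>k. B k a) \<longlonglongrightarrow> imul L" if "lapgen a L" for a L
  proof -
    have "(\<lambda>k. dlap (1 / real (Suc k)) a) \<longlonglongrightarrow> L"
      using dlap_tendsto[OF that] LIMSEQ_Suc[OF lim_1_over_n[where 'a = real]]
      by (auto simp: tendsto_at_iff_sequentially o_def)
    then show ?thesis unfolding B_def by (rule bounded_linear.tendsto[OF imul_bounded_linear])
  qed
  have dense: "\<exists>y. norm (y - x) < e \<and> convergent (\<lambda>k. B k y)" if "e > 0" for x e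
    using lapgen_dense[OF that, of x] lim by (auto simp: convergent_def)
  from flow_limit_exists[of B, OF skew comm dense]
  obtain U :: "real \<Rightarrow> 'a l2 \<Rightarrow> 'a l2" where U: "\<And>t. linear (U t)" "\<And>t x. norm (U t x) = norm x" "\<And>x. U 0 x = x"
    "\<And>t x. U t (U (- t) x) = x" "\<And>x. continuous_on UNIV (\<lambda>t. U t x)"
    and gen: "\<And>x y t. (\<lambda>k. B k x) \<longlonglongrightarrow> y \<Longrightarrow> ((\<lambda>t. U t x) has_vector_derivative U t y) (at t)"
    by blast
  have "isometric_group U" by (rule isometric_group.intro; fact U)
  moreover have "isometric_group.generates U a (imul L)" if "lapgen a L" for a L
    unfolding isometric_group.generates_def[OF \<open>isometric_group U\<close>] using gen[OF lim[OF that]] by blast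
  ultimately show ?thesis using that by blast
qed

section \<open>Weak solutions of the perturbed equation\<close>

lemma iter_pd_append: "iter_pd (ds @ es) f = iter_pd ds (iter_pd es f)"
  by (induction ds) auto

lemma smooth_iter_pd: "smooth f \<Longrightarrow> smooth (iter_pd es f)"
  unfolding smooth_def by (metis iter_pd_append)

lemma smooth_differentiable: "smooth f \<Longrightarrow> f differentiable (at x)"
  unfolding smooth_def by (metis iter_pd.simps(1))

lemma smooth_continuous: "smooth f \<Longrightarrow> continuous_on UNIV f"
  by (intro continuous_at_imp_continuous_on ballI differentiable_imp_continuous_within smooth_differentiable)

lemma smooth_line_derivative:
  assumes "smooth f"
  shows "((\<lambda>h. f (p + h *\<^sub>R d)) has_vector_derivative iter_pd [d] f (p + t *\<^sub>R d)) (at t)"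
proof -
  have f: "(f has_derivative frechet_derivative f (at (p + t *\<^sub>R d))) (at (p + t *\<^sub>R d))"
    using smooth_differentiable[OF assms] by (simp add: frechet_derivative_works)
  have l: "((\<lambda>h. p + h *\<^sub>R d) has_derivative (\<lambda>h. h *\<^sub>R d)) (at t)"
    by (auto intro!: derivative_eq_intros)
  have "linear (frechet_derivative f (at (p + t *\<^sub>R d)))"
    by (rule linear_frechet_derivative[OF smooth_differentiable[OF assms]])
  then show ?thesis
    using diff_chain_at[OF l f] by (simp add: has_vector_derivative_def o_def linear_scale)
qed

definition smooth_compact :: "('a::real_normed_vector \<Rightarrow> 'b::real_normed_vector) \<Rightarrow> bool" where
  "smooth_compact f \<longleftrightarrow> smooth f \<and> compact (closure {p. f p \<noteq> 0})"

lemma iter_pd_single_support: "{p. iter_pd [d] f p \<noteq> 0} \<subseteq> closure {p. f p \<noteq> 0}"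
proof
  fix p assume p: "p \<in> {p. iter_pd [d] f p \<noteq> 0}"
  show "p \<in> closure {p. f p \<noteq> 0}"
  proof (rule ccontr)
    assume np: "p \<notin> closure {p. f p \<noteq> 0}"
    have "(f has_derivative (\<lambda>h. 0)) (at p)"
    proof (rule has_derivative_transform_within_open[where f = "\<lambda>x. 0" and s = "- closure {p. f p \<noteq> 0}"])
      show "0 = f x" if "x \<in> - closure {p. f p \<noteq> 0}" for x using that closure_subset[of "{p. f p \<noteq> 0}"] by auto
    qed (use np in auto)
    then have "frechet_derivative f (at p) = (\<lambda>h. 0)" by (rule frechet_derivative_at[symmetric])
    with p show False by simp
  qed
qed

lemma smooth_compact_iter_pd_single: "smooth_compact f \<Longrightarrow> smooth_compact (iter_pd [d] f)"
  using iter_pd_single_support[of d f] smooth_iter_pd[of f "[d]"] closure_minimal[of "{p. iter_pd [d] f p \<noteq> 0}" "closure {p. f p \<noteq> 0}"]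
  unfolding smooth_compact_def by (metis closed_closure compact_Int_closed inf.absorb_iff2)

lemma smooth_compact_bounds:
  fixes \<phi> :: "real \<times> 'a::euclidean_space \<Rightarrow> complex"
  assumes "smooth_compact \<phi>"
  obtains M R where "\<And>p. cmod (\<phi> p) \<le> M" "\<And>t x. norm x \<ge> R \<Longrightarrow> \<phi> (t, x) = 0" "0 \<le> M"
proof -
  let ?K = "closure {p. \<phi> p \<noteq> 0}"
  have K: "compact ?K" and c: "continuous_on UNIV \<phi>"
    using assms smooth_continuous by (auto simp: smooth_compact_def)
  have "bounded (\<phi> ` ?K)"
    by (intro compact_imp_bounded compact_continuous_image continuous_on_subset[OF c] K) auto
  then obtain M where M: "\<And>p. p \<in> ?K \<Longrightarrow> cmod (\<phi> p) \<le> M" "0 < M" unfolding bounded_pos by blast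
  obtain R where R: "\<And>p. p \<in> ?K \<Longrightarrow> norm p < R"
    using compact_imp_bounded[OF K] unfolding bounded_pos by (meson gt_ex order_le_less_trans)
  have sub: "p \<in> ?K" if "\<phi> p \<noteq> 0" for p using that closure_subset[of "{p. \<phi> p \<noteq> 0}"] by auto
  show ?thesis
  proof
    show "cmod (\<phi> p) \<le> M" for p using M sub[of p] by (cases "\<phi> p = 0") auto
    show "\<phi> (t, x) = 0" if "norm x \<ge> R" for t x
    proof (rule ccontr)
      assume "\<phi> (t, x) \<noteq> 0"
      from R[OF sub[OF this]] have "norm (t, x) < R" .
      moreover have "norm x \<le> norm (t, x)" using norm_snd_le[of x t] by simp
      ultimately show False using that by simp
    qed
  qed (use M in auto)
qed

text \<open>The weak formulation pairs \<open>u\<close> with the test function without conjugation,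
  whereas the inner product conjugates its second argument; the conjugate compensates for
  this.\<close>

definition slice :: "(real \<times> 'a::euclidean_space \<Rightarrow> complex) \<Rightarrow> real \<Rightarrow> 'a l2" where
  "slice \<phi> t = l2_of (\<lambda>x. cnj (\<phi> (t, x)))"

lemma continuous_slice:
  assumes "smooth \<phi>" shows "continuous_on UNIV (\<lambda>x. cnj (\<phi> (t, x)))"
  by (intro continuous_intros continuous_on_compose2[OF smooth_continuous[OF assms]]) auto

lemma sqint_slice:
  fixes \<phi> :: "real \<times> 'a::euclidean_space \<Rightarrow> complex"
  assumes "smooth_compact \<phi>" shows "sqint (\<lambda>x. cnj (\<phi> (t, x)))"
proof -
  obtain M R where "\<And>p. cmod (\<phi> p) \<le> M" "\<And>t x. norm x \<ge> R \<Longrightarrow> \<phi> (t, x) = 0"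
    using smooth_compact_bounds[OF assms] by metis
  then show ?thesis
    using assms by (intro continuous_on_cutoff_mult(1)[of _ M R] continuous_slice) (auto simp: smooth_compact_def)
qed

lemma slice_deriv:
  assumes \<phi>: "smooth_compact \<phi>"
  shows "(slice \<phi> has_vector_derivative slice (iter_pd [(1, 0)] \<phi>) t) (at t)"
proof -
  let ?D = "iter_pd [(1, 0)] \<phi>"
  have D: "smooth_compact ?D" by (rule smooth_compact_iter_pd_single[OF \<phi>])
  obtain M R where M: "\<And>p. cmod (?D p) \<le> M" "\<And>t x. norm x \<ge> R \<Longrightarrow> ?D (t, x) = 0" "0 \<le> M"
    using smooth_compact_bounds[OF D] by metis
  have d: "((\<lambda>h. cnj (\<phi> (h, x))) has_vector_derivative cnj (?D (h, x))) (at h)" for h x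
    using bounded_linear.has_vector_derivative[OF bounded_linear_cnj
      smooth_line_derivative[of \<phi> "(0, x)" "(1, 0)" h]] \<phi> by (simp add: smooth_compact_def del: iter_pd.simps)
  have le: "cmod (cnj (?D (h, x))) \<le> M * indicat_real (ball 0 R) x" for h x
    using M(1)[of "(h, x)"] M(2)[of x h] by (auto simp: indicator_def simp del: iter_pd.simps)
  show ?thesis
    unfolding slice_def
    by (rule l2_curve_derivative(2)[where F' = "\<lambda>h x. cnj (?D (h, x))" and d = 1,
        OF sqint_slice[OF \<phi>] sqint_measurable[OF sqint_slice[OF D]] _ d le cutoff_square_integrable]) simp
qed

lemma slice_dgen:
  assumes \<phi>: "smooth_compact \<phi>"
  shows "dgen v (slice \<phi> t) (slice (iter_pd [(0, v)] \<phi>) t)"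
proof -
  let ?D = "iter_pd [(0, v)] \<phi>"
  have D: "smooth_compact ?D" by (rule smooth_compact_iter_pd_single[OF \<phi>])
  obtain M R where M: "\<And>p. cmod (?D p) \<le> M" "\<And>t x. norm x \<ge> R \<Longrightarrow> ?D (t, x) = 0" "0 \<le> M"
    using smooth_compact_bounds[OF D] by metis
  have d: "((\<lambda>h. cnj (\<phi> (t, x + h *\<^sub>R v))) has_vector_derivative cnj (?D (t, x + h *\<^sub>R v))) (at h)" for h x
    using bounded_linear.has_vector_derivative[OF bounded_linear_cnj
      smooth_line_derivative[of \<phi> "(t, x)" "(0, v)" h]] \<phi> by (simp add: smooth_compact_def del: iter_pd.simps)
  \<comment> \<open>For \<open>|h| < 1\<close> the shift moves the support by at most
    \<open>norm v\<close>, hence the enlarged ball.\<close>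
  have le: "cmod (cnj (?D (t, x + h *\<^sub>R v))) \<le> M * indicat_real (ball 0 (R + norm v)) x" if "\<bar>h - 0\<bar> < 1" for h x
  proof (cases "norm x < R + norm v")
    case False
    have "norm x \<le> norm (x + h *\<^sub>R v) + norm (h *\<^sub>R v)"
      using norm_triangle_ineq4[of "x + h *\<^sub>R v" "h *\<^sub>R v"] by simp
    moreover have "norm (h *\<^sub>R v) \<le> 1 * norm v"
      unfolding norm_scaleR by (rule mult_right_mono) (use that in auto)
    ultimately have "norm (x + h *\<^sub>R v) \<ge> R" using False by simp
    then show ?thesis using M(2,3) by (simp del: iter_pd.simps)
  qed (use M(1) in \<open>simp del: iter_pd.simps\<close>)
  have "((\<lambda>h. l2_of (\<lambda>x. cnj (\<phi> (t, x + h *\<^sub>R v)))) has_vector_derivative l2_of (\<lambda>x. cnj (?D (t, x + 0 *\<^sub>R v)))) (at 0)"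
    by (rule l2_curve_derivative(2)[where F = "\<lambda>h x. cnj (\<phi> (t, x + h *\<^sub>R v))" and F' = "\<lambda>h x. cnj (?D (t, x + h *\<^sub>R v))" and d = 1,
        OF sqint_shift[OF sqint_slice[OF \<phi>]] sqint_measurable[OF sqint_shift[OF sqint_slice[OF D]]] _ d le cutoff_square_integrable]) simp_all
  then show ?thesis
    by (simp add: dgen_def slice_def translate_l2_of sqint_slice[OF \<phi>] del: iter_pd.simps)
qed

lemma sum_Basis_axis: "(\<Sum>b\<in>(Basis :: (real^'n) set). f b) = (\<Sum>i\<in>UNIV. f (axis i 1))"
proof -
  have B: "(Basis :: (real^'n) set) = range (\<lambda>i. axis i 1)" by (auto simp: Basis_vec_def)
  have I: "inj (\<lambda>i::'n. axis i (1::real))" by (auto simp: inj_on_def axis_eq_axis)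
  show ?thesis unfolding B using sum.reindex[OF I, of f] by (simp add: o_def)
qed

lemma slice_laplace:
  fixes \<phi> :: "real \<times> (real^'n) \<Rightarrow> complex"
  assumes \<phi>: "smooth_compact \<phi>"
  shows "slice (laplace_x \<phi>) t = (\<Sum>i\<in>UNIV. slice (iter_pd [(0, axis i 1)] (iter_pd [(0, axis i 1)] \<phi>)) t)"
    and "sqint (\<lambda>x. cnj (laplace_x \<phi> (t, x)))"
proof -
  let ?D = "\<lambda>i. iter_pd [(0, axis i 1)] (iter_pd [(0, axis i 1)] \<phi>)"
  have eq: "laplace_x \<phi> p = (\<Sum>i\<in>UNIV. ?D i p)" for p by (simp add: laplace_x_def)
  have D: "sqint (\<lambda>x. cnj (?D i (t, x)))" for i
    by (intro sqint_slice smooth_compact_iter_pd_single \<phi>)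
  show "slice (laplace_x \<phi>) t = (\<Sum>i\<in>UNIV. slice (?D i) t)"
    unfolding slice_def eq by (subst l2_of_sum) (use D in \<open>auto simp del: iter_pd.simps\<close>)
  show "sqint (\<lambda>x. cnj (laplace_x \<phi> (t, x)))"
    unfolding eq cnj_sum by (rule sqint_sum) (rule D)
qed

lemma slice_lapgen:
  fixes \<phi> :: "real \<times> (real^'n) \<Rightarrow> complex"
  assumes \<phi>: "smooth_compact \<phi>"
  shows "lapgen (slice \<phi> t) (slice (laplace_x \<phi>) t)"
  unfolding lapgen_def slice_laplace(1)[OF \<phi>] sum_Basis_axis[symmetric, where f = "\<lambda>b. slice (iter_pd [(0, b)] (iter_pd [(0, b)] \<phi>)) t"]
  by (intro exI[of _ "\<lambda>b. slice (iter_pd [(0, b)] \<phi>) t"] exI[of _ "\<lambda>b. slice (iter_pd [(0, b)] (iter_pd [(0, b)] \<phi>)) t"]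
      conjI ballI refl slice_dgen smooth_compact_iter_pd_single \<phi>)

lemma lapgen_imul:
  assumes "lapgen a L" shows "lapgen (imul a) (imul L)"
proof -
  obtain a1 a2 where a: "\<And>b. b \<in> Basis \<Longrightarrow> dgen b a (a1 b) \<and> dgen b (a1 b) (a2 b)" "L = (\<Sum>b\<in>Basis. a2 b)"
    using assms unfolding lapgen_def by blast
  have "imul (translate v x) = translate v (imul x)" for v and x :: "'a l2" by (simp add: translate_mulop_const)
  from dgen_commute[OF imul_bounded_linear this] a(1)
  have "\<forall>b\<in>Basis. dgen b (imul a) (imul (a1 b)) \<and> dgen b (imul (a1 b)) (imul (a2 b))" by blast
  moreover have "imul L = (\<Sum>b\<in>Basis. imul (a2 b))" by (simp add: a(2) linear_sum[OF imul_linear])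
  ultimately show ?thesis unfolding lapgen_def
    by (intro exI[of _ "\<lambda>b. imul (a1 b)"] exI[of _ "\<lambda>b. imul (a2 b)"] conjI)
qed

lemma slice_continuous: "smooth_compact \<phi> \<Longrightarrow> continuous_on UNIV (slice \<phi>)"
  by (rule has_vector_derivative_imp_continuous_on[OF slice_deriv])

lemma slice_laplace_continuous:
  fixes \<phi> :: "real \<times> (real^'n) \<Rightarrow> complex"
  assumes "smooth_compact \<phi>" shows "continuous_on UNIV (slice (laplace_x \<phi>))"
proof -
  have "continuous_on UNIV (\<lambda>t. \<Sum>i\<in>UNIV. slice (iter_pd [(0, axis i 1)] (iter_pd [(0, axis i 1)] \<phi>)) t)"
    by (intro continuous_on_sum slice_continuous smooth_compact_iter_pd_single assms)
  then show ?thesis by (simp only: slice_laplace(1)[OF assms, symmetric])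
qed

text \<open>In the second component the inner product conjugates the factor \<i> to
  \<open>- \<i>\<close>, and the real part of \<open>- \<i> * z\<close> is the imaginary part of
  \<open>z\<close>.\<close>

lemma l2_bilinear_pairing:
  assumes g: "sqint (\<lambda>x. cnj (\<psi> x))"
  shows "(\<integral>x. rep_l2 a x * \<psi> x \<partial>lborel) =
    Complex (inner a (l2_of (\<lambda>x. cnj (\<psi> x)))) (inner a (imul (l2_of (\<lambda>x. cnj (\<psi> x)))))"
proof (rule complex_eqI)
  have "inner (l2_of (rep_l2 a)) (l2_of (\<lambda>x. cnj (\<psi> x))) = Re (\<integral>x. rep_l2 a x * \<psi> x \<partial>lborel)"
    by (subst inner_l2_of) (simp_all add: g del: l2_of_rep)
  then show "Re (\<integral>x. rep_l2 a x * \<psi> x \<partial>lborel) =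
    Re (Complex (inner a (l2_of (\<lambda>x. cnj (\<psi> x)))) (inner a (imul (l2_of (\<lambda>x. cnj (\<psi> x))))))" by simp
  have "inner (l2_of (rep_l2 a)) (imul (l2_of (\<lambda>x. cnj (\<psi> x)))) = Re (\<integral>x. - \<i> * (rep_l2 a x * \<psi> x) \<partial>lborel)"
    by (subst imul_l2_of[OF g], subst inner_l2_of) (simp_all add: g mult_ac del: l2_of_rep)
  also have "(\<integral>x. - \<i> * (rep_l2 a x * \<psi> x) \<partial>lborel) = - \<i> * (\<integral>x. rep_l2 a x * \<psi> x \<partial>lborel)"
    by (rule integral_mult_right_zero)
  finally show "Im (\<integral>x. rep_l2 a x * \<psi> x \<partial>lborel) =
    Im (Complex (inner a (l2_of (\<lambda>x. cnj (\<psi> x)))) (inner a (imul (l2_of (\<lambda>x. cnj (\<psi> x))))))" by simp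
qed

lemma L2_rep: "L2 (rep_l2 (a :: (real^'n) l2))"
  unfolding L2_def
  by (intro conjI measurable_completion) (auto simp: integrable_completion sqint_integrable)

lemma L2norm_rep_diff: "L2norm (\<lambda>x. rep_l2 a x - rep_l2 b x) = norm (a - (b :: (real^'n) l2))"
proof -
  have "norm (a - b) = norm (l2_of (\<lambda>x. rep_l2 a x - rep_l2 b x))" by (simp add: minus_l2_def)
  moreover have "(norm (l2_of (\<lambda>x. rep_l2 a x - rep_l2 b x)))\<^sup>2 = (\<integral>x. (cmod (rep_l2 a x - rep_l2 b x))\<^sup>2 \<partial>lebesgue)"
    by (subst norm_l2_of_square) (auto simp: integral_completion)
  ultimately show ?thesis unfolding L2norm_def by (metis norm_ge_zero real_sqrt_unique)
qed

lemma has_vector_derivative_Complex: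
  assumes "(a has_vector_derivative a') (at t)" "(b has_vector_derivative b') (at t)"
  shows "((\<lambda>t. Complex (a t) (b t)) has_vector_derivative Complex a' b') (at t)"
  unfolding Complex_eq
  by (intro has_vector_derivative_add has_vector_derivative_mult_right
      bounded_linear.has_vector_derivative[OF bounded_linear_of_real] assms)

text \<open>The integrand of the weak formulation is the time derivative of \<i> times the bilinear
  pairing of \<open>u t\<close> with \<open>\<phi>\<close>: the Laplacian falls on the test function
  through the generator of \<open>U\<close>, the potential through its adjoint. \<open>V0\<close> is
  a bounded Borel version of \<open>V\<close>, so that multiplication by it is an operator on
  L2.\<close>

lemma schrod_sol_perturbed:
  fixes V V0 :: "real^'n \<Rightarrow> complex" and T :: real
  assumes V: "V \<in> borel_measurable lebesgue" and G: "isometric_group U" and gen: "\<And>a L. lapgen a L \<Longrightarrow> isometric_group.generates U a (imul L)"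
    and V0 [measurable]: "V0 \<in> borel_measurable borel" and C: "\<And>x. cmod (V0 x) \<le> C" and VV: "AE x in lebesgue. V x = V0 x"
    and v: "\<And>t. (v has_vector_derivative U (- t) (- imul (mulop V0 (U t (v t))))) (at t)" and T: "T > 0"
  shows "schrod_sol V T (rep_l2 (v 0)) (\<lambda>t. rep_l2 (U t (v t)))"
proof -
  interpret isometric_group U by (rule G)
  define u where "u t = U t (v t)" for t
  have vc: "continuous_on UNIV v"
    by (rule has_vector_derivative_imp_continuous_on[OF v])
  have uc: "continuous_on UNIV u" unfolding u_def by (rule U_apply_continuous[OF vc])
  have u0: "u 0 = v 0" by (simp add: u_def)
  note ml = mulop_bounded_linear[OF V0 C]
  have weak: "(LBINT t=0..T. (\<integral>x. rep_l2 (u t) x * (\<i> * dt \<phi> (t, x) - laplace_x \<phi> (t, x) + V x * \<phi> (t, x)) \<partial>lebesgue)) = 0"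
    if \<phi>: "test_fun T \<phi>" for \<phi> :: "real \<times> (real^'n) \<Rightarrow> complex"
  proof -
    have sc: "smooth_compact \<phi>" and supp: "closure {p. \<phi> p \<noteq> 0} \<subseteq> {0<..<T} \<times> UNIV"
      using \<phi> by (auto simp: test_fun_def smooth_compact_def)
    have dt: "dt \<phi> = iter_pd [(1, 0)] \<phi>" by (auto simp: dt_def)
    have dsc: "smooth_compact (dt \<phi>)" unfolding dt by (rule smooth_compact_iter_pd_single[OF sc])
    define \<Phi> \<Phi>' L where "\<Phi> = slice \<phi>" and "\<Phi>' = slice (dt \<phi>)" and "L = slice (laplace_x \<phi>)"
    have \<Phi>c: "continuous_on UNIV \<Phi>" and \<Phi>'c: "continuous_on UNIV \<Phi>'" and Lc: "continuous_on UNIV L"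
      unfolding \<Phi>_def \<Phi>'_def L_def by (intro slice_continuous slice_laplace_continuous sc dsc)+
    have \<Phi>d: "(\<Phi> has_vector_derivative \<Phi>' t) (at t)" for t
      unfolding \<Phi>_def \<Phi>'_def dt by (rule slice_deriv[OF sc])
    have \<Phi>g: "generates (\<Phi> t) (imul (L t))" "generates (imul (\<Phi> t)) (imul (imul (L t)))" for t
      unfolding \<Phi>_def L_def by (intro gen lapgen_imul slice_lapgen sc)+
    \<comment> \<open>The derivative that \<open>perturbed_pairing\<close> predicts for \<i> times
      the pairing with the test function; the first component comes from testing with
      \<open>imul (\<Phi> t)\<close>, the second from \<open>\<Phi> t\<close>.\<close>
    define K where "K t = Complex (- (inner (- imul (mulop V0 (u t))) (imul (\<Phi> t)) + inner (u t) (imul (\<Phi>' t) - imul (imul (L t)))))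
      (inner (- imul (mulop V0 (u t))) (\<Phi> t) + inner (u t) (\<Phi>' t - imul (L t)))" for t
    have inner_eq: "(\<integral>x. rep_l2 (u t) x * (\<i> * dt \<phi> (t, x) - laplace_x \<phi> (t, x) + V x * \<phi> (t, x)) \<partial>lebesgue) = K t" for t
    proof -
      let ?\<psi> = "\<lambda>x. \<i> * dt \<phi> (t, x) - laplace_x \<phi> (t, x) + V0 x * \<phi> (t, x)"
      have s1: "sqint (\<lambda>x. - \<i> * cnj (dt \<phi> (t, x)))" by (intro sqint_cmult sqint_slice dsc)
      have s2: "sqint (\<lambda>x. cnj (laplace_x \<phi> (t, x)))" by (rule slice_laplace(2)[OF sc])
      have s3: "sqint (\<lambda>x. cnj (V0 x) * cnj (\<phi> (t, x)))"
        by (rule sqint_mult[OF sqint_slice[OF sc], of _ C]) (auto simp: C)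
      have cnj\<psi>: "(\<lambda>x. cnj (?\<psi> x)) = (\<lambda>x. - \<i> * cnj (dt \<phi> (t, x)) - cnj (laplace_x \<phi> (t, x)) + cnj (V0 x) * cnj (\<phi> (t, x)))"
        by (simp add: fun_eq_iff)
      have s: "sqint (\<lambda>x. cnj (?\<psi> x))" unfolding cnj\<psi> by (intro sqint_add sqint_diff s1 s2 s3)
      have m: "?\<psi> \<in> borel_measurable borel"
        using borel_measurable_cnj[THEN measurable_compose[OF sqint_measurable[OF s]]] by simp
      have i1: "l2_of (\<lambda>x. - \<i> * cnj (dt \<phi> (t, x))) = - imul (\<Phi>' t)"
        unfolding \<Phi>'_def slice_def by (simp add: imul_l2_of l2_of_uminus sqint_slice[OF dsc])
      have Gt: "l2_of (\<lambda>x. cnj (?\<psi> x)) = - imul (\<Phi>' t) - L t + mulop (\<lambda>x. cnj (V0 x)) (\<Phi> t)"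
        unfolding cnj\<psi> l2_of_add[OF sqint_diff[OF s1 s2] s3, symmetric] l2_of_diff[OF s1 s2, symmetric] i1
        unfolding L_def \<Phi>_def slice_def
        by (subst mulop_l2_of[of _ C]) (auto simp: C sqint_slice[OF sc])
      have "(\<integral>x. rep_l2 (u t) x * (\<i> * dt \<phi> (t, x) - laplace_x \<phi> (t, x) + V x * \<phi> (t, x)) \<partial>lebesgue)
          = (\<integral>x. rep_l2 (u t) x * ?\<psi> x \<partial>lebesgue)"
      proof (rule integral_cong_AE)
        have c: "(\<lambda>x. f (t, x)) \<in> borel_measurable lebesgue"
          if "sqint (\<lambda>x. cnj (f (t, x)))" for f :: "real \<times> (real^'n) \<Rightarrow> complex"
        proof (rule measurable_completion)
          have "(\<lambda>x. cnj (cnj (f (t, x)))) \<in> borel_measurable borel"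
            by (rule measurable_compose[OF sqint_measurable[OF that] borel_measurable_cnj])
          then show "(\<lambda>x. f (t, x)) \<in> borel_measurable lborel" by simp
        qed
        have [measurable]: "(\<lambda>x. dt \<phi> (t, x)) \<in> borel_measurable lebesgue"
          "(\<lambda>x. laplace_x \<phi> (t, x)) \<in> borel_measurable lebesgue" "(\<lambda>x. \<phi> (t, x)) \<in> borel_measurable lebesgue"
          by (intro c sqint_slice sc dsc slice_laplace(2))+
        have [measurable]: "rep_l2 (u t) \<in> borel_measurable lebesgue" "V0 \<in> borel_measurable lebesgue"
          by (intro measurable_completion; simp)+
        show "(\<lambda>x. rep_l2 (u t) x * (\<i> * dt \<phi> (t, x) - laplace_x \<phi> (t, x) + V x * \<phi> (t, x))) \<in> borel_measurable lebesgue"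
          "(\<lambda>x. rep_l2 (u t) x * ?\<psi> x) \<in> borel_measurable lebesgue"
          using V by measurable
        show "AE x in lebesgue. rep_l2 (u t) x * (\<i> * dt \<phi> (t, x) - laplace_x \<phi> (t, x) + V x * \<phi> (t, x)) = rep_l2 (u t) x * ?\<psi> x"
          using VV by eventually_elim simp
      qed
      also have "\<dots> = (\<integral>x. rep_l2 (u t) x * ?\<psi> x \<partial>lborel)"
        by (rule integral_completion) (use m in measurable)
      also have "\<dots> = Complex (inner (u t) (- imul (\<Phi>' t) - L t + mulop (\<lambda>x. cnj (V0 x)) (\<Phi> t)))
          (inner (u t) (imul (- imul (\<Phi>' t) - L t + mulop (\<lambda>x. cnj (V0 x)) (\<Phi> t))))"
        by (subst l2_bilinear_pairing[OF s]) (simp only: Gt)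
      also have "\<dots> = K t"
      proof -
        have A: "inner a (mulop (\<lambda>x. cnj (V0 x)) b) = inner (mulop V0 a) b" for a b
          by (rule mulop_adjoint[OF V0 C, symmetric])
        have B: "inner a (imul (mulop (\<lambda>x. cnj (V0 x)) b)) = - inner (imul (mulop V0 a)) b" for a b
        proof -
          have com: "mulop V0 (imul a) = imul (mulop V0 a)"
          proof -
            have "mulop V0 (imul (l2_of (rep_l2 a))) = imul (mulop V0 (l2_of (rep_l2 a)))"
              by (simp add: imul_l2_of mulop_l2_of[OF V0 C] sqint_mulop[OF V0 C] mult.left_commute del: l2_of_rep)
            then show ?thesis by simp
          qed
          have "inner a (imul (mulop (\<lambda>x. cnj (V0 x)) b)) = - inner (imul a) (mulop (\<lambda>x. cnj (V0 x)) b)"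
            by (simp add: imul_skew)
          then show ?thesis by (simp add: A com)
        qed
        show ?thesis
          unfolding K_def complex.inject
          by (simp add: linear_add[OF imul_linear] linear_diff[OF imul_linear] linear_neg[OF imul_linear]
              inner_add_right inner_diff_right imul_imul imul_inner A B)
      qed
      finally show ?thesis .
    qed
    \<comment> \<open>This is \<i> times the bilinear pairing of \<open>u t\<close> with
      \<open>\<phi>\<close>, as multiplication by \<i> sends \<open>Complex p q\<close> to
      \<open>Complex (- q) p\<close>.\<close>
    define F where "F t = Complex (- inner (u t) (imul (\<Phi> t))) (inner (u t) (\<Phi> t))" for t
    have pair: "((\<lambda>t. inner (u t) (w t)) has_vector_derivative
        inner (- imul (mulop V0 (u t))) (w t) + inner (u t) (w' - g)) (at t)"
      if "generates (w t) g" "(w has_vector_derivative w') (at t)" for w w' g t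
      unfolding u_def by (rule perturbed_pairing[where P = "\<lambda>a. - imul (mulop V0 a)", OF v that])
    have Fd: "(F has_vector_derivative K t) (at t)" for t
    proof -
      have i\<Phi>: "((\<lambda>t. imul (\<Phi> t)) has_vector_derivative imul (\<Phi>' t)) (at t)"
        by (rule bounded_linear.has_vector_derivative[OF imul_bounded_linear \<Phi>d])
      show ?thesis
        unfolding F_def K_def
        by (intro has_vector_derivative_Complex has_vector_derivative_minus
            pair[of "\<lambda>t. imul (\<Phi> t)" t, OF \<Phi>g(2) i\<Phi>] pair[of \<Phi> t, OF \<Phi>g(1) \<Phi>d])
    qed
    have Kc: "continuous_on UNIV K"
      unfolding K_def Complex_eq
      by (intro continuous_intros bounded_linear.continuous_on[OF imul_bounded_linear]
          bounded_linear.continuous_on[OF ml] uc \<Phi>c \<Phi>'c Lc)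
    \<comment> \<open>The support lies in the open interval, so both end points are covered and the
      boundary terms of \<open>F\<close> vanish.\<close>
    have \<Phi>0: "\<Phi> t = 0" if "t \<notin> {0<..<T}" for t
    proof -
      have "\<phi> (t, x) = 0" for x
        using supp closure_subset[of "{p. \<phi> p \<noteq> 0}"] that by (cases "\<phi> (t, x) = 0") auto
      then show ?thesis by (simp add: \<Phi>_def slice_def zero_l2_def)
    qed
    have "(LBINT t=ereal 0..ereal T. K t) = F T - F 0"
      using T
      by (intro interval_integral_FTC_finite continuous_on_subset[OF Kc] has_vector_derivative_at_within[OF Fd]) auto
    also have "\<dots> = 0"
      by (simp add: F_def \<Phi>0 linear_0[OF imul_linear])
    finally show ?thesis by (simp add: inner_eq zero_ereal_def)
  qed
  have cont: "((\<lambda>s. L2norm (\<lambda>x. rep_l2 (u s) x - rep_l2 (u t) x)) \<longlongrightarrow> 0) (at t within {0..T})" for t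
  proof -
    have "((\<lambda>s. u s) \<longlongrightarrow> u t) (at t within {0..T})"
      using uc by (meson UNIV_I continuous_on_def continuous_on_subset subset_UNIV tendsto_within_subset)
    then show ?thesis by (simp add: L2norm_rep_diff tendsto_norm_zero LIM_zero)
  qed
  show ?thesis
    unfolding schrod_sol_def u_def[symmetric] using weak cont by (auto simp: L2_rep u0)
qed

section \<open>Gaussian wave packets\<close>

lemma power_mult_exp_le:
  assumes "0 \<le> (z::real)" shows "z ^ n \<le> fact n * exp z"
proof -
  have "(\<Sum>k\<in>{n}. z ^ k / fact k) \<le> (\<Sum>k. z ^ k / fact k)"
    by (rule sum_le_suminf) (use assms summable_exp[of z] in \<open>auto simp: field_simps\<close>)
  also have "\<dots> = exp z" by (simp add: exp_def divide_inverse mult.commute)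
  finally show ?thesis by (simp add: field_simps)
qed

text \<open>On the shell between the radii \<open>k\<close> and \<open>k + 1\<close> the integrand
  is at most \<open>exp (- (c * k))\<close>, and the shell lies in a ball of volume polynomial in
  \<open>k\<close>. Half of the exponential absorbs the polynomial, the other half gives a geometric
  series.\<close>

lemma integrable_exp_norm:
  assumes c: "c > 0" shows "integrable lborel (\<lambda>x::'a::euclidean_space. exp (- (c * norm x)))"
proof -
  define n where "n = DIM('a)"
  define v where "v = unit_ball_vol (real n)"
  have v: "0 \<le> v" by (simp add: v_def)
  have "(\<integral>\<^sup>+x. ennreal (exp (- (c * norm (x::'a)))) \<partial>lborel)
      \<le> (\<integral>\<^sup>+x. (\<Sum>k. ennreal (exp (- (c * real k))) * indicator (ball (0::'a) (real k + 1)) x) \<partial>lborel)"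
  proof (rule nn_integral_mono)
    fix x :: 'a
    define k where "k = nat \<lfloor>norm x\<rfloor>"
    have k: "real k \<le> norm x" "norm x < real k + 1"
      unfolding k_def by (auto simp: of_nat_nat)
    define g :: "nat \<Rightarrow> ennreal" where "g = (\<lambda>k. ennreal (exp (- (c * real k))) * indicator (ball 0 (real k + 1)) x)"
    have "ennreal (exp (- (c * norm x))) \<le> g k"
      using k c by (auto simp: g_def intro!: ennreal_leI)
    also have "g k \<le> suminf g"
      using sum_le_suminf[OF summableI, of "{k}" g] by simp
    finally show "ennreal (exp (- (c * norm x))) \<le> (\<Sum>k. ennreal (exp (- (c * real k))) * indicator (ball 0 (real k + 1)) x)"
      unfolding g_def .
  qed
  also have "\<dots> = (\<Sum>k. \<integral>\<^sup>+x. ennreal (exp (- (c * real k))) * indicator (ball (0::'a) (real k + 1)) x \<partial>lborel)"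
    by (rule nn_integral_suminf) (intro borel_measurable_times_ennreal borel_measurable_const borel_measurable_indicator, simp)
  also have "\<dots> = (\<Sum>k. ennreal (exp (- (c * real k)) * (v * (real k + 1) ^ n)))"
  proof (rule suminf_cong)
    fix k
    have "emeasure lborel (ball (0::'a) (real k + 1)) = ennreal (v * (real k + 1) ^ n)"
      unfolding v_def n_def by (rule emeasure_ball) simp
    then show "(\<integral>\<^sup>+x. ennreal (exp (- (c * real k))) * indicator (ball (0::'a) (real k + 1)) x \<partial>lborel)
        = ennreal (exp (- (c * real k)) * (v * (real k + 1) ^ n))"
      by (subst nn_integral_cmult_indicator) (auto simp: ennreal_mult' v)
  qed
  also have "\<dots> < \<infinity>"
  proof -
    have le: "exp (- (c * real k)) * (v * (real k + 1) ^ n) \<le> (v * ((2 / c) ^ n * (fact n * exp (c / 2)))) * exp (- (c / 2)) ^ k" for k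
    proof -
      have "((c / 2) * (real k + 1)) ^ n \<le> fact n * exp ((c / 2) * (real k + 1))"
        by (rule power_mult_exp_le) (use c in simp)
      then have "(2 / c) ^ n * ((c / 2) * (real k + 1)) ^ n \<le> (2 / c) ^ n * (fact n * exp ((c / 2) * (real k + 1)))"
        by (rule mult_left_mono) (use c in simp)
      moreover have "(2 / c) ^ n * ((c / 2) * (real k + 1)) ^ n = (real k + 1) ^ n"
      proof -
        have "(2 / c) * ((c / 2) * (real k + 1)) = real k + 1" using c by (simp add: field_simps)
        then show ?thesis by (simp only: power_mult_distrib[symmetric])
      qed
      ultimately have "(real k + 1) ^ n \<le> (2 / c) ^ n * (fact n * exp ((c / 2) * (real k + 1)))" by simp
      then have "(exp (- (c * real k)) * v) * (real k + 1) ^ n \<le>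
          (exp (- (c * real k)) * v) * ((2 / c) ^ n * (fact n * exp ((c / 2) * (real k + 1))))"
        by (rule mult_left_mono) (use v in simp)
      also have "\<dots> = v * ((2 / c) ^ n * (fact n * (exp (- (c * real k)) * exp ((c / 2) * (real k + 1)))))"
        by (simp only: mult_ac)
      also have "exp (- (c * real k)) * exp ((c / 2) * (real k + 1)) = exp (c / 2) * exp (- (c / 2)) ^ k"
        unfolding exp_of_nat_mult[symmetric] mult_exp_exp
        by (rule arg_cong[where f = exp]) (simp add: field_simps)
      finally show ?thesis by (simp only: mult_ac)
    qed
    have "summable (\<lambda>k. (v * ((2 / c) ^ n * (fact n * exp (c / 2)))) * exp (- (c / 2)) ^ k)"
      by (intro summable_mult summable_geometric) (use c in simp)
    then have "summable (\<lambda>k. exp (- (c * real k)) * (v * (real k + 1) ^ n))"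
      by (rule summable_comparison_test'[where N = 0]) (use le v in \<open>simp add: abs_mult\<close>)
    then have "(\<Sum>k. ennreal (exp (- (c * real k)) * (v * (real k + 1) ^ n))) = ennreal (\<Sum>k. exp (- (c * real k)) * (v * (real k + 1) ^ n))"
      by (intro suminf_ennreal2) (auto simp: v)
    then show ?thesis by simp
  qed
  finally show ?thesis by (intro integrableI_bounded) auto
qed

lemma exp_norm_square_integrable:
  "integrable lborel (\<lambda>x::'a::euclidean_space. (K * exp (- norm x))\<^sup>2)"
proof -
  have "(\<lambda>x::'a. (K * exp (- norm x))\<^sup>2) = (\<lambda>x. K\<^sup>2 * exp (- (2 * norm x)))"
    by (simp add: power_mult_distrib exp_double[symmetric])
  then show ?thesis using integrable_exp_norm[of 2, where 'a='a] by simp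
qed

lemma sqint_exp_bound:
  assumes "f \<in> borel_measurable borel" "\<And>x. cmod (f x) \<le> K * exp (- norm x)"
  shows "sqint f"
  by (rule sqint_bound[OF assms(1) exp_norm_square_integrable[of K]]) (intro AE_I2 power_mono assms norm_ge_zero)

lemma dgen_exp_bound:
  fixes f g :: "'a::euclidean_space \<Rightarrow> complex"
  assumes f: "f \<in> borel_measurable borel" "\<And>x. cmod (f x) \<le> K * exp (- norm x)"
    and g: "g \<in> borel_measurable borel" "\<And>x. cmod (g x) \<le> K' * exp (- norm x)"
    and d: "\<And>x h. ((\<lambda>h. f (x + h *\<^sub>R v)) has_vector_derivative g (x + h *\<^sub>R v)) (at h)"
  shows "dgen v (l2_of f) (l2_of g)"
proof -
  have sf: "sqint f" and sg: "sqint g" using f g by (blast intro: sqint_exp_bound)+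
  have K': "0 \<le> K'" using order_trans[OF norm_ge_zero g(2)[of 0]] by simp
  have bd: "cmod (g (x + h *\<^sub>R v)) \<le> (K' * exp (norm v)) * exp (- norm x)" if "\<bar>h - 0\<bar> < 1" for h x
  proof -
    have "norm x \<le> norm (x + h *\<^sub>R v) + norm (h *\<^sub>R v)"
      using norm_triangle_ineq4[of "x + h *\<^sub>R v" "h *\<^sub>R v"] by simp
    moreover have "norm (h *\<^sub>R v) \<le> 1 * norm v"
      unfolding norm_scaleR by (rule mult_right_mono) (use that in auto)
    ultimately have "exp (- norm (x + h *\<^sub>R v)) \<le> exp (norm v + - norm x)" by simp
    then have "K' * exp (- norm (x + h *\<^sub>R v)) \<le> K' * exp (norm v + - norm x)" using K' by (rule mult_left_mono)
    from order_trans[OF g(2) this] show ?thesis by (simp only: exp_add mult.assoc)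
  qed
  have "((\<lambda>h. l2_of (\<lambda>x. f (x + h *\<^sub>R v))) has_vector_derivative l2_of (\<lambda>x. g (x + 0 *\<^sub>R v))) (at 0)"
    by (rule l2_curve_derivative(2)[where F = "\<lambda>h x. f (x + h *\<^sub>R v)" and F' = "\<lambda>h x. g (x + h *\<^sub>R v)" and d = 1,
        OF sqint_shift[OF sf] sqint_measurable[OF sqint_shift[OF sg]] _ d bd exp_norm_square_integrable]) simp_all
  then show ?thesis by (simp add: dgen_def translate_l2_of sf)
qed

lemma has_vector_derivative_exp:
  fixes q :: "real \<Rightarrow> complex"
  assumes "(q has_vector_derivative q') (at t)"
  shows "((\<lambda>t. exp (q t)) has_vector_derivative q' * exp (q t)) (at t)"
  using field_vector_diff_chain_at[OF assms DERIV_exp] by (simp add: o_def)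

text \<open>By \<open>1 + r \<le> exp r\<close> the left side is at most
  \<open>exp (2 * r - \<kappa> * r\<^sup>2)\<close>, and \<open>9 / (4 * \<kappa>)\<close> is the
  maximum of \<open>3 * r - \<kappa> * r\<^sup>2\<close>. The factor \<open>(1 + r)\<^sup>2\<close>
  is there to absorb the polynomials in the first and second derivatives of a Gaussian.\<close>

lemma gaussian_le_exp:
  fixes r \<kappa> :: real
  assumes "0 \<le> r" "0 < \<kappa>"
  shows "(1 + r)\<^sup>2 * exp (- (\<kappa> * r\<^sup>2)) \<le> exp (9 / (4 * \<kappa>)) * exp (- r)"
proof -
  have "(1 + r)\<^sup>2 \<le> (exp r)\<^sup>2" using assms by (intro power_mono) auto
  then have "(1 + r)\<^sup>2 * exp (- (\<kappa> * r\<^sup>2)) \<le> exp (2 * r) * exp (- (\<kappa> * r\<^sup>2))"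
    by (simp add: exp_double)
  also have "\<dots> = exp (2 * r - \<kappa> * r\<^sup>2)" by (simp add: exp_add[symmetric])
  also have "2 * r - \<kappa> * r\<^sup>2 \<le> 9 / (4 * \<kappa>) + - r"
  proof -
    have "0 \<le> (2 * \<kappa> * r - 3)\<^sup>2 / (4 * \<kappa>)" using assms by simp
    also have "\<dots> = \<kappa> * r\<^sup>2 - 3 * r + 9 / (4 * \<kappa>)"
      using assms by (simp add: power2_eq_square field_simps)
    finally show ?thesis by simp
  qed
  finally show ?thesis by (simp only: exp_add exp_le_cancel_iff)
qed

section \<open>The explicit wave packet\<close>

locale packet =
  fixes \<epsilon> lam :: real and a \<theta> :: "'a::euclidean_space"
  assumes \<epsilon>: "\<epsilon> > 0" and \<theta>: "norm \<theta> = 1"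
begin

text \<open>The complex width of a Gaussian under the free evolution. Its real part stays positive,
  so the principal logarithm is smooth along it.\<close>

definition c :: "real \<Rightarrow> complex" where "c t = Complex \<epsilon> (2 * t)"

definition y :: "real \<Rightarrow> 'a \<Rightarrow> 'a" where "y t x = x - a - (2 * lam * t) *\<^sub>R \<theta>"

text \<open>The free solution started at \<open>a\<close> with momentum
  \<open>lam *\<^sub>R \<theta>\<close>: a spreading Gaussian in the moving frame \<open>y\<close>,
  times a plane wave. The normalising power \<open>- DIM('a) / 2\<close> of \<open>c t\<close> is
  written with \<open>Ln\<close> inside the exponential, so that every derivative is
  \<open>W\<close> times a derivative of the exponent.\<close>

definition W :: "real \<Rightarrow> 'a \<Rightarrow> complex" where
  "W t x = exp (- (of_nat DIM('a) / 2) * Ln (c t) + \<i> * of_real (lam * (\<theta> \<bullet> (x - a)))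
     - \<i> * of_real (lam\<^sup>2 * t) - of_real (y t x \<bullet> y t x) * (1 / (2 * c t)))"

text \<open>The logarithmic derivative of \<open>W\<close> along \<open>b\<close>; accordingly
  \<open>S b\<close> is the second derivative along \<open>b\<close> divided by
  \<open>W\<close>.\<close>

definition G :: "'a \<Rightarrow> real \<Rightarrow> 'a \<Rightarrow> complex" where
  "G b t x = \<i> * of_real (lam * (\<theta> \<bullet> b)) - of_real (y t x \<bullet> b) / c t"

definition S :: "'a \<Rightarrow> real \<Rightarrow> 'a \<Rightarrow> complex" where
  "S b t x = (G b t x)\<^sup>2 - of_real (b \<bullet> b) / c t"

lemma Re_c: "Re (c t) = \<epsilon>" and Im_c: "Im (c t) = 2 * t" and c_nz [simp]: "c t \<noteq> 0"
  and c_nonpos: "c t \<notin> \<real>\<^sub>\<le>\<^sub>0"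
  using \<epsilon> by (auto simp: c_def complex_eq_iff complex_nonpos_Reals_iff)

lemma cmod_c_square: "(cmod (c t))\<^sup>2 = \<epsilon>\<^sup>2 + 4 * t\<^sup>2"
  by (simp add: cmod_power2 Re_c Im_c power_mult_distrib)

lemma cmod_c_ge: "\<epsilon> \<le> cmod (c t)"
  using complex_Re_le_cmod[of "c t"] by (simp add: Re_c)

lemma cmod_c_le: "cmod (c t) \<le> \<epsilon> + 2 * \<bar>t\<bar>"
  using cmod_le[of "c t"] \<epsilon> by (simp add: Re_c Im_c)

lemma cmod_W: "cmod (W t x) = exp (- (real DIM('a) / 2 * ln (cmod (c t))) - \<epsilon> * (norm (y t x))\<^sup>2 / (2 * (cmod (c t))\<^sup>2))"
proof -
  have "Re (of_real r * (1 / (2 * c t))) = \<epsilon> * r / (2 * (cmod (c t))\<^sup>2)" for r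
  proof -
    have "Re (of_real r * (1 / (2 * c t))) = r * ((2 * \<epsilon>) / ((2 * \<epsilon>)\<^sup>2 + (4 * t)\<^sup>2))"
      by (simp add: Re_divide Re_c Im_c del: Re_divide_numeral)
    also have "(2 * \<epsilon>)\<^sup>2 + (4 * t)\<^sup>2 = 4 * (cmod (c t))\<^sup>2" by (simp add: cmod_c_square power_mult_distrib)
    finally show ?thesis by simp
  qed
  then show ?thesis
    unfolding W_def norm_exp_eq_Re by (simp add: power2_norm_eq_inner Re_Ln)
qed

lemma cmod_W_square: "(cmod (W t x))\<^sup>2 = exp (- (real DIM('a) * ln (cmod (c t))) - \<epsilon> * (norm (y t x))\<^sup>2 / (cmod (c t))\<^sup>2)"
proof -
  have "(cmod (W t x))\<^sup>2 = exp (2 * (- (real DIM('a) / 2 * ln (cmod (c t))) - \<epsilon> * (norm (y t x))\<^sup>2 / (2 * (cmod (c t))\<^sup>2)))"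
    unfolding cmod_W exp_double ..
  then show ?thesis by (simp add: algebra_simps)
qed

text \<open>For \<open>|t| \<le> T\<close> the modulus of \<open>c t\<close> lies between
  \<open>\<epsilon>\<close> and \<open>\<epsilon> + 2 * T\<close>. The lower bound gives the first
  factor, the upper one the Gaussian rate
  \<open>\<epsilon> / (2 * (\<epsilon> + 2 * T)\<^sup>2)\<close>, at which
  \<open>gaussian_le_exp\<close> gives the second. Neither depends on \<open>lam\<close>, which is
  what makes the limit of high momentum possible.\<close>

definition width_bound :: "real \<Rightarrow> real" where
  "width_bound T = exp (- (real DIM('a) / 2 * ln \<epsilon>)) * exp (9 / (4 * (\<epsilon> / (2 * (\<epsilon> + 2 * T)\<^sup>2))))"

lemma W_bound:
  assumes t: "\<bar>t\<bar> \<le> T"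
  shows "(1 + norm (y t x))\<^sup>2 * cmod (W t x) \<le> width_bound T * exp (- norm (y t x))"
proof -
  define \<kappa> where "\<kappa> = \<epsilon> / (2 * (\<epsilon> + 2 * T)\<^sup>2)"
  have T: "0 \<le> T" using t by linarith
  have \<kappa>: "0 < \<kappa>" using \<epsilon> T unfolding \<kappa>_def by (intro divide_pos_pos mult_pos_pos zero_less_power) auto
  have cp: "0 < cmod (c t)" by simp
  have "ln \<epsilon> \<le> ln (cmod (c t))" using \<epsilon> cmod_c_ge[of t] by simp
  then have 1: "exp (- (real DIM('a) / 2 * ln (cmod (c t)))) \<le> exp (- (real DIM('a) / 2 * ln \<epsilon>))"
    by (simp add: mult_left_mono)
  have "(cmod (c t))\<^sup>2 \<le> (\<epsilon> + 2 * T)\<^sup>2" using cmod_c_le[of t] t by (intro power_mono) auto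
  then have "\<kappa> \<le> \<epsilon> / (2 * (cmod (c t))\<^sup>2)"
    unfolding \<kappa>_def using \<epsilon> cp by (intro divide_left_mono mult_pos_pos zero_less_power) (use T in auto)
  then have "\<kappa> * (norm (y t x))\<^sup>2 \<le> \<epsilon> / (2 * (cmod (c t))\<^sup>2) * (norm (y t x))\<^sup>2" by (rule mult_right_mono) simp
  then have 2: "exp (- (\<epsilon> * (norm (y t x))\<^sup>2 / (2 * (cmod (c t))\<^sup>2))) \<le> exp (- (\<kappa> * (norm (y t x))\<^sup>2))" by simp
  have "cmod (W t x) = exp (- (real DIM('a) / 2 * ln (cmod (c t)))) * exp (- (\<epsilon> * (norm (y t x))\<^sup>2 / (2 * (cmod (c t))\<^sup>2)))"
    unfolding cmod_W exp_add[symmetric] by simp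
  also have "\<dots> \<le> exp (- (real DIM('a) / 2 * ln \<epsilon>)) * exp (- (\<kappa> * (norm (y t x))\<^sup>2))"
    by (intro mult_mono 1 2) auto
  finally have "(1 + norm (y t x))\<^sup>2 * cmod (W t x) \<le>
      (1 + norm (y t x))\<^sup>2 * (exp (- (real DIM('a) / 2 * ln \<epsilon>)) * exp (- (\<kappa> * (norm (y t x))\<^sup>2)))"
    by (rule mult_left_mono) simp
  also have "\<dots> = exp (- (real DIM('a) / 2 * ln \<epsilon>)) * ((1 + norm (y t x))\<^sup>2 * exp (- (\<kappa> * (norm (y t x))\<^sup>2)))"
    by (simp only: mult_ac)
  also have "\<dots> \<le> exp (- (real DIM('a) / 2 * ln \<epsilon>)) * (exp (9 / (4 * \<kappa>)) * exp (- norm (y t x)))"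
    by (intro mult_left_mono gaussian_le_exp \<kappa>) auto
  finally show ?thesis by (simp only: width_bound_def \<kappa>_def mult.assoc)
qed

lemma width_bound_pos: "0 < width_bound T" by (simp add: width_bound_def)

text \<open>The starting point \<open>a\<close> is moved into the constant, so that the exponential
  is centred at \<open>2 * lam * t\<close> along \<open>\<theta>\<close> with a constant free of
  \<open>lam\<close>. The asymptotics rest on this bound.\<close>

lemma W_bound_moving:
  assumes t: "\<bar>t\<bar> \<le> T"
  shows "cmod (W t x) \<le> width_bound T * exp (norm a) * exp (- norm (x - (2 * lam * t) *\<^sub>R \<theta>))"
proof -
  have "1 * cmod (W t x) \<le> (1 + norm (y t x))\<^sup>2 * cmod (W t x)"
    by (intro mult_right_mono one_le_power) auto
  also have "\<dots> \<le> width_bound T * exp (- norm (y t x))" by (rule W_bound[OF t])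
  also have "\<dots> \<le> width_bound T * exp (norm a + - norm (x - (2 * lam * t) *\<^sub>R \<theta>))"
  proof -
    have "norm (x - (2 * lam * t) *\<^sub>R \<theta>) \<le> norm (y t x) + norm a"
      using norm_triangle_ineq[of "y t x" a] by (simp add: y_def algebra_simps)
    then show ?thesis using width_bound_pos[of T] by (intro mult_left_mono) auto
  qed
  finally show ?thesis by (simp only: exp_add mult.assoc mult_1)
qed

text \<open>Centred at the origin at the price of a constant that grows with \<open>lam\<close>. It
  serves at fixed \<open>lam\<close>, where differentiation in L2 needs majorants that do not
  move.\<close>

lemma W_bound_fixed:
  assumes t: "\<bar>t\<bar> \<le> T"
  shows "(1 + norm (y t x))\<^sup>2 * cmod (W t x) \<le> width_bound T * exp (norm a + 2 * \<bar>lam\<bar> * T) * exp (- norm x)"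
proof -
  have "norm x \<le> norm (y t x) + norm (a + (2 * lam * t) *\<^sub>R \<theta>)"
    using norm_triangle_ineq[of "y t x" "a + (2 * lam * t) *\<^sub>R \<theta>"] by (simp add: y_def algebra_simps)
  also have "norm (a + (2 * lam * t) *\<^sub>R \<theta>) \<le> norm a + \<bar>2 * lam * t\<bar>"
    using norm_triangle_ineq[of a "(2 * lam * t) *\<^sub>R \<theta>"] \<theta> by simp
  also have "\<bar>2 * lam * t\<bar> \<le> 2 * \<bar>lam\<bar> * T" using t by (simp add: abs_mult mult_left_mono)
  finally have "exp (- norm (y t x)) \<le> exp (norm a + 2 * \<bar>lam\<bar> * T + - norm x)" by simp
  then have "width_bound T * exp (- norm (y t x)) \<le> width_bound T * exp (norm a + 2 * \<bar>lam\<bar> * T + - norm x)"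
    using width_bound_pos[of T] by (intro mult_left_mono) auto
  then show ?thesis using W_bound[OF t, of x] by (simp only: exp_add[of _ "- norm x"] mult.assoc)
qed

lemma y_line: "y t (x + h *\<^sub>R b) = y t x + h *\<^sub>R b"
  by (simp add: y_def algebra_simps)

lemma W_space_derivative:
  "((\<lambda>h. W t (x + h *\<^sub>R b)) has_vector_derivative G b t (x + h *\<^sub>R b) * W t (x + h *\<^sub>R b)) (at h)"
proof -
  have 1: "((\<lambda>h. lam * (\<theta> \<bullet> (x + h *\<^sub>R b - a))) has_vector_derivative lam * (\<theta> \<bullet> b)) (at h)"
    unfolding has_real_derivative_iff_has_vector_derivative[symmetric] inner_diff_right inner_add_right inner_scaleR_right
    by (auto intro!: derivative_eq_intros)
  have 2: "((\<lambda>h. y t (x + h *\<^sub>R b) \<bullet> y t (x + h *\<^sub>R b)) has_vector_derivative 2 * (y t (x + h *\<^sub>R b) \<bullet> b)) (at h)"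
    unfolding has_real_derivative_iff_has_vector_derivative[symmetric] y_line inner_add_left inner_add_right
      inner_scaleR_left inner_scaleR_right
    by (auto intro!: derivative_eq_intros simp: inner_commute algebra_simps)
  note R = bounded_linear.has_vector_derivative[OF bounded_linear_of_real]
  have "((\<lambda>h. - (of_nat DIM('a) / 2) * Ln (c t) + \<i> * of_real (lam * (\<theta> \<bullet> (x + h *\<^sub>R b - a)))
     - \<i> * of_real (lam\<^sup>2 * t) - of_real (y t (x + h *\<^sub>R b) \<bullet> y t (x + h *\<^sub>R b)) * (1 / (2 * c t)))
     has_vector_derivative 0 + \<i> * of_real (lam * (\<theta> \<bullet> b)) - 0 - of_real (2 * (y t (x + h *\<^sub>R b) \<bullet> b)) * (1 / (2 * c t))) (at h)"
    by (intro has_vector_derivative_add has_vector_derivative_diff has_vector_derivative_const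
        has_vector_derivative_mult_right has_vector_derivative_mult_left R 1 2)
  from has_vector_derivative_exp[OF this] show ?thesis
    unfolding W_def G_def by simp
qed

lemma G_space_derivative:
  "((\<lambda>h. G b t (x + h *\<^sub>R b)) has_vector_derivative - of_real (b \<bullet> b) / c t) (at h)"
proof -
  have 1: "((\<lambda>h. y t (x + h *\<^sub>R b) \<bullet> b) has_vector_derivative b \<bullet> b) (at h)"
    unfolding has_real_derivative_iff_has_vector_derivative[symmetric] y_line inner_add_left inner_scaleR_left
    by (auto intro!: derivative_eq_intros)
  note R = bounded_linear.has_vector_derivative[OF bounded_linear_of_real]
  have "((\<lambda>h. \<i> * of_real (lam * (\<theta> \<bullet> b)) - of_real (y t (x + h *\<^sub>R b) \<bullet> b) * (1 / c t))
    has_vector_derivative 0 - of_real (b \<bullet> b) * (1 / c t)) (at h)"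
    by (intro has_vector_derivative_diff has_vector_derivative_const has_vector_derivative_mult_left R 1)
  then show ?thesis by (simp add: G_def)
qed

lemma GW_space_derivative:
  "((\<lambda>h. G b t (x + h *\<^sub>R b) * W t (x + h *\<^sub>R b)) has_vector_derivative S b t (x + h *\<^sub>R b) * W t (x + h *\<^sub>R b)) (at h)"
  using has_vector_derivative_mult[OF G_space_derivative[of b t x h] W_space_derivative[of t x b h]]
  by (simp add: S_def power2_eq_square algebra_simps)

lemma c_derivative: "(c has_vector_derivative 2 * \<i>) (at t)"
proof -
  have "((\<lambda>t. Complex \<epsilon> (2 * t)) has_vector_derivative Complex 0 2) (at t)"
    by (intro has_vector_derivative_Complex) (auto intro!: derivative_eq_intros simp flip: has_real_derivative_iff_has_vector_derivative)
  moreover have "Complex 0 2 = 2 * \<i>" by (simp add: complex_eq_iff)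
  ultimately show ?thesis by (simp add: c_def[abs_def])
qed

text \<open>Summed over the orthonormal basis, the products of components in \<open>S\<close> become
  \<open>\<theta> \<bullet> \<theta> = 1\<close>, \<open>\<theta> \<bullet> y t x\<close> and
  \<open>y t x \<bullet> y t x\<close>. The result is the Laplacian of \<open>W\<close> divided by
  \<open>W\<close>, in the form that the time derivative has to match.\<close>

lemma sum_S: "(\<Sum>b\<in>Basis. S b t x) =
  - of_real (lam\<^sup>2) - 2 * \<i> * of_real (lam * (\<theta> \<bullet> y t x)) / c t + of_real (y t x \<bullet> y t x) / (c t)\<^sup>2 - of_nat DIM('a) / c t"
proof -
  have "S b t x = - of_real (lam\<^sup>2) * of_real ((\<theta> \<bullet> b) * (\<theta> \<bullet> b)) - (2 * \<i> * of_real lam / c t) * of_real ((\<theta> \<bullet> b) * (y t x \<bullet> b))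
      + (1 / (c t)\<^sup>2) * of_real ((y t x \<bullet> b) * (y t x \<bullet> b)) - 1 / c t" if "b \<in> Basis" for b
    using that by (simp add: S_def G_def power2_eq_square algebra_simps add_divide_distrib diff_divide_distrib)
  then have "(\<Sum>b\<in>Basis. S b t x) = (\<Sum>b\<in>Basis. - of_real (lam\<^sup>2) * of_real ((\<theta> \<bullet> b) * (\<theta> \<bullet> b)) - (2 * \<i> * of_real lam / c t) * of_real ((\<theta> \<bullet> b) * (y t x \<bullet> b))
      + (1 / (c t)\<^sup>2) * of_real ((y t x \<bullet> b) * (y t x \<bullet> b)) - 1 / c t)" by (rule sum.cong[OF refl])
  also have "\<dots> = - of_real (lam\<^sup>2) * of_real (\<theta> \<bullet> \<theta>) - (2 * \<i> * of_real lam / c t) * of_real (\<theta> \<bullet> y t x)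
      + (1 / (c t)\<^sup>2) * of_real (y t x \<bullet> y t x) - of_nat DIM('a) * (1 / c t)"
    unfolding sum.distrib sum_subtractf sum_distrib_left[symmetric] of_real_sum[symmetric]
    by (simp only: euclidean_inner[symmetric] sum_constant)
  finally show ?thesis using \<theta> by (simp add: norm_eq_1)
qed

lemma W_time_derivative:
  "((\<lambda>t. W t x) has_vector_derivative \<i> * (\<Sum>b\<in>Basis. S b t x) * W t x) (at t)"
proof -
  note R = bounded_linear.has_vector_derivative[OF bounded_linear_of_real]
  have yy: "y t x \<bullet> y t x = (x - a) \<bullet> (x - a) - 4 * lam * t * ((x - a) \<bullet> \<theta>) + 4 * lam\<^sup>2 * t\<^sup>2" for t
  proof -
    have "y t x \<bullet> y t x = (x - a) \<bullet> (x - a) - 2 * ((2 * lam * t) * ((x - a) \<bullet> \<theta>)) + (2 * lam * t)\<^sup>2 * (\<theta> \<bullet> \<theta>)"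
      unfolding y_def by (simp add: inner_diff_left inner_diff_right inner_commute power2_eq_square algebra_simps)
    then show ?thesis using \<theta> by (simp add: norm_eq_1 power_mult_distrib)
  qed
  have 1: "((\<lambda>t. y t x \<bullet> y t x) has_vector_derivative - 4 * lam * (\<theta> \<bullet> y t x)) (at t)"
  proof -
    have e: "\<theta> \<bullet> y t x = (x - a) \<bullet> \<theta> - 2 * lam * t"
      using \<theta> by (simp add: y_def inner_diff_right norm_eq_1 inner_commute)
    then show ?thesis
      unfolding yy e has_real_derivative_iff_has_vector_derivative[symmetric]
      by (auto intro!: derivative_eq_intros simp: power2_eq_square algebra_simps)
  qed
  have 2: "((\<lambda>t. lam\<^sup>2 * t) has_vector_derivative lam\<^sup>2) (at t)"
    unfolding has_real_derivative_iff_has_vector_derivative[symmetric] by (auto intro!: derivative_eq_intros)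
  have 3: "((\<lambda>t. Ln (c t)) has_vector_derivative 2 * \<i> * inverse (c t)) (at t)"
    using field_vector_diff_chain_at[OF c_derivative has_field_derivative_Ln[OF c_nonpos]] by (simp add: o_def)
  have 4: "((\<lambda>t. 1 / (2 * c t)) has_vector_derivative 2 * \<i> * (- (1 / (2 * (c t)\<^sup>2)))) (at t)"
  proof -
    have "((\<lambda>z. 1 / (2 * z)) has_field_derivative - (1 / (2 * (c t)\<^sup>2))) (at (c t))"
      by (auto intro!: derivative_eq_intros simp: power2_eq_square field_simps)
    from field_vector_diff_chain_at[OF c_derivative this] show ?thesis by (simp add: o_def)
  qed
  have "((\<lambda>t. - (of_nat DIM('a) / 2) * Ln (c t) + \<i> * of_real (lam * (\<theta> \<bullet> (x - a)))
     - \<i> * of_real (lam\<^sup>2 * t) - of_real (y t x \<bullet> y t x) * (1 / (2 * c t)))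
     has_vector_derivative - (of_nat DIM('a) / 2) * (2 * \<i> * inverse (c t)) + 0 - \<i> * of_real (lam\<^sup>2) -
       (of_real (y t x \<bullet> y t x) * (2 * \<i> * (- (1 / (2 * (c t)\<^sup>2)))) + of_real (- 4 * lam * (\<theta> \<bullet> y t x)) * (1 / (2 * c t)))) (at t)"
    by (intro has_vector_derivative_add has_vector_derivative_diff has_vector_derivative_const
        has_vector_derivative_mult_right has_vector_derivative_mult R 1 2 3 4)
  from has_vector_derivative_exp[OF this]
  have "((\<lambda>t. W t x) has_vector_derivative (- (of_nat DIM('a) / 2) * (2 * \<i> * inverse (c t)) + 0 - \<i> * of_real (lam\<^sup>2) -
       (of_real (y t x \<bullet> y t x) * (2 * \<i> * (- (1 / (2 * (c t)\<^sup>2)))) + of_real (- 4 * lam * (\<theta> \<bullet> y t x)) * (1 / (2 * c t)))) * W t x) (at t)"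
    by (simp only: W_def)
  moreover have "- (of_nat DIM('a) / 2) * (2 * \<i> * inverse (c t)) + 0 - \<i> * of_real (lam\<^sup>2) -
       (of_real (y t x \<bullet> y t x) * (2 * \<i> * (- (1 / (2 * (c t)\<^sup>2)))) + of_real (- 4 * lam * (\<theta> \<bullet> y t x)) * (1 / (2 * c t)))
       = \<i> * (\<Sum>b\<in>Basis. S b t x)"
    unfolding sum_S by (simp add: field_simps power2_eq_square)
  ultimately show ?thesis by simp
qed

text \<open>The phase of \<open>W\<close> contributes at most \<open>|lam|\<close> to the
  logarithmic derivative, the Gaussian at most \<open>norm (y t x) / \<epsilon>\<close>, as
  \<open>\<epsilon> \<le> cmod (c t)\<close>.\<close>

definition A1 :: real where "A1 = \<bar>lam\<bar> + 1 / \<epsilon>"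

lemma A1_nonneg: "0 \<le> A1" using \<epsilon> by (simp add: A1_def)

lemma G_bound:
  assumes "b \<in> Basis" shows "cmod (G b t x) \<le> A1 * (1 + norm (y t x))"
proof -
  have "cmod (G b t x) \<le> cmod (\<i> * of_real (lam * (\<theta> \<bullet> b))) + cmod (of_real (y t x \<bullet> b) / c t)"
    unfolding G_def by (rule norm_triangle_ineq4)
  also have "cmod (\<i> * of_real (lam * (\<theta> \<bullet> b))) \<le> \<bar>lam\<bar> * 1"
    using Basis_le_norm[OF assms, of \<theta>] \<theta> by (simp add: norm_mult abs_mult mult_left_le)
  also have "cmod (of_real (y t x \<bullet> b) / c t) \<le> norm (y t x) / \<epsilon>"
    using Basis_le_norm[OF assms, of "y t x"] \<epsilon> cmod_c_ge[of t] unfolding norm_divide norm_of_real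
    by (intro frac_le) auto
  finally have "cmod (G b t x) \<le> \<bar>lam\<bar> + norm (y t x) / \<epsilon>" by simp
  moreover have "0 \<le> \<bar>lam\<bar> * norm (y t x) + 1 / \<epsilon>" using \<epsilon> by simp
  moreover have "A1 * (1 + norm (y t x)) = \<bar>lam\<bar> + norm (y t x) / \<epsilon> + (\<bar>lam\<bar> * norm (y t x) + 1 / \<epsilon>)"
    by (simp add: A1_def algebra_simps)
  ultimately show ?thesis by linarith
qed

lemma S_bound:
  assumes "b \<in> Basis" shows "cmod (S b t x) \<le> (A1\<^sup>2 + 1 / \<epsilon>) * (1 + norm (y t x))\<^sup>2"
proof -
  have "cmod (S b t x) \<le> (cmod (G b t x))\<^sup>2 + cmod (1 / c t)"
    unfolding S_def using assms norm_triangle_ineq4[of "(G b t x)\<^sup>2" "1 / c t"] by (simp add: norm_power)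
  also have "(cmod (G b t x))\<^sup>2 \<le> (A1 * (1 + norm (y t x)))\<^sup>2" by (intro power_mono G_bound assms) simp
  also have "cmod (1 / c t) \<le> 1 / \<epsilon>"
    using \<epsilon> cmod_c_ge[of t] by (simp add: norm_divide frac_le)
  also have "1 / \<epsilon> \<le> 1 / \<epsilon> * (1 + norm (y t x))\<^sup>2"
    using \<epsilon> mult_left_mono[of 1 "(1 + norm (y t x))\<^sup>2" "1 / \<epsilon>"] one_le_power[of "1 + norm (y t x)" 2] by simp
  finally show ?thesis by (simp add: power_mult_distrib distrib_right)
qed

lemma borel_y [measurable]: "y t \<in> borel_measurable borel"
  unfolding y_def by measurable

lemma borel_W [measurable]: "W t \<in> borel_measurable borel"
  unfolding W_def by measurable

lemma borel_G [measurable]: "G b t \<in> borel_measurable borel"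
  unfolding G_def by measurable

lemma borel_S [measurable]: "S b t \<in> borel_measurable borel"
  unfolding S_def by measurable

definition fixed_bound :: "real \<Rightarrow> real" where
  "fixed_bound T = width_bound T * exp (norm a + 2 * \<bar>lam\<bar> * T)"

lemma PW_bound:
  assumes "\<bar>t\<bar> \<le> T" "cmod P \<le> A * (1 + norm (y t x))\<^sup>2" "0 \<le> A"
  shows "cmod (P * W t x) \<le> A * fixed_bound T * exp (- norm x)"
proof -
  have "cmod (P * W t x) \<le> A * (1 + norm (y t x))\<^sup>2 * cmod (W t x)"
    unfolding norm_mult by (rule mult_right_mono[OF assms(2)]) simp
  also have "\<dots> = A * ((1 + norm (y t x))\<^sup>2 * cmod (W t x))" by (rule mult.assoc)
  also have "\<dots> \<le> A * (fixed_bound T * exp (- norm x))"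
    unfolding fixed_bound_def by (rule mult_left_mono[OF W_bound_fixed[OF assms(1)] assms(3)])
  finally show ?thesis by (simp only: mult.assoc)
qed

lemma W_exp_bound: "cmod (W t x) \<le> 1 * fixed_bound \<bar>t\<bar> * exp (- norm x)"
  using PW_bound[of t "\<bar>t\<bar>" 1 1 x] one_le_power[of "1 + norm (y t x)" 2] by simp

lemma GW_exp_bound: "b \<in> Basis \<Longrightarrow> cmod (G b t x * W t x) \<le> A1 * fixed_bound \<bar>t\<bar> * exp (- norm x)"
proof (rule PW_bound)
  assume "b \<in> Basis"
  from G_bound[OF this, of t x] have "cmod (G b t x) \<le> A1 * (1 + norm (y t x))" .
  also have "\<dots> \<le> A1 * (1 + norm (y t x))\<^sup>2"
    using A1_nonneg by (intro mult_left_mono) (auto simp: power2_eq_square algebra_simps)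
  finally show "cmod (G b t x) \<le> A1 * (1 + norm (y t x))\<^sup>2" .
qed (auto simp: A1_nonneg)

lemma SW_exp_bound: "b \<in> Basis \<Longrightarrow> cmod (S b t x * W t x) \<le> (A1\<^sup>2 + 1 / \<epsilon>) * fixed_bound \<bar>t\<bar> * exp (- norm x)"
  by (rule PW_bound[OF order_refl S_bound]) (use \<epsilon> in auto)

definition w :: "real \<Rightarrow> 'a l2" where "w t = l2_of (W t)"

lemma sqint_W: "sqint (W t)"
  by (rule sqint_exp_bound[OF borel_W W_exp_bound])

lemma sqint_SW: "b \<in> Basis \<Longrightarrow> sqint (\<lambda>x. S b t x * W t x)"
  by (rule sqint_exp_bound[OF _ SW_exp_bound]) measurable

lemma w_lapgen: "lapgen (w t) (\<Sum>b\<in>Basis. l2_of (\<lambda>x. S b t x * W t x))"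
  unfolding lapgen_def
proof (rule exI[of _ "\<lambda>b. l2_of (\<lambda>x. G b t x * W t x)"], rule exI[of _ "\<lambda>b. l2_of (\<lambda>x. S b t x * W t x)"], intro conjI ballI refl)
  fix b :: 'a assume b: "b \<in> Basis"
  show "dgen b (w t) (l2_of (\<lambda>x. G b t x * W t x))"
    unfolding w_def
    by (rule dgen_exp_bound[OF borel_W W_exp_bound _ GW_exp_bound[OF b] W_space_derivative]) measurable
  show "dgen b (l2_of (\<lambda>x. G b t x * W t x)) (l2_of (\<lambda>x. S b t x * W t x))"
    by (rule dgen_exp_bound[OF _ GW_exp_bound[OF b] _ SW_exp_bound[OF b] GW_space_derivative]) measurable
qed

lemma w_derivative:
  "(w has_vector_derivative imul (\<Sum>b\<in>Basis. l2_of (\<lambda>x. S b t x * W t x))) (at t)"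
proof -
  define B where "B = real DIM('a) * ((A1\<^sup>2 + 1 / \<epsilon>) * fixed_bound (\<bar>t\<bar> + 1))"
  have sum: "(\<Sum>b\<in>Basis. l2_of (\<lambda>x. S b t x * W t x)) = l2_of (\<lambda>x. (\<Sum>b\<in>Basis. S b t x) * W t x)" for t
    unfolding sum_distrib_right by (rule l2_of_sum) (auto intro: sqint_SW)
  have sq: "sqint (\<lambda>x. (\<Sum>b\<in>Basis. S b t x) * W t x)" for t
    unfolding sum_distrib_right by (rule sqint_sum) (rule sqint_SW)
  have bd: "cmod (\<i> * (\<Sum>b\<in>Basis. S b s x) * W s x) \<le> B * exp (- norm x)" if "\<bar>s - t\<bar> < 1" for s x
  proof -
    have "\<bar>s\<bar> \<le> \<bar>t\<bar> + 1" using that by linarith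
    then have "cmod (S b s x * W s x) \<le> (A1\<^sup>2 + 1 / \<epsilon>) * fixed_bound (\<bar>t\<bar> + 1) * exp (- norm x)" if "b \<in> Basis" for b
      by (rule PW_bound[OF _ S_bound[OF that]]) (use \<epsilon> in auto)
    then have "(\<Sum>b\<in>Basis. cmod (S b s x * W s x)) \<le> real DIM('a) * ((A1\<^sup>2 + 1 / \<epsilon>) * fixed_bound (\<bar>t\<bar> + 1) * exp (- norm x))"
      by (rule sum_bounded_above)
    moreover have "cmod (\<i> * (\<Sum>b\<in>Basis. S b s x) * W s x) \<le> (\<Sum>b\<in>Basis. cmod (S b s x * W s x))"
    proof -
      have "cmod (\<i> * (\<Sum>b\<in>Basis. S b s x) * W s x) = cmod (\<Sum>b\<in>Basis. S b s x * W s x)"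
        by (simp only: norm_mult norm_ii mult_1 sum_distrib_right[symmetric])
      then show ?thesis by (simp only: norm_sum)
    qed
    ultimately show ?thesis by (simp add: B_def mult.assoc)
  qed
  have "((\<lambda>t. l2_of (W t)) has_vector_derivative l2_of (\<lambda>x. \<i> * (\<Sum>b\<in>Basis. S b t x) * W t x)) (at t)"
    by (rule l2_curve_derivative(2)[where F' = "\<lambda>t x. \<i> * (\<Sum>b\<in>Basis. S b t x) * W t x" and d = 1,
        OF sqint_W _ _ W_time_derivative bd exp_norm_square_integrable]) simp_all
  then show ?thesis unfolding sum imul_l2_of[OF sq] w_def[abs_def] by (simp only: mult.assoc)
qed

text \<open>Of \<open>U\<close> only the group properties and the action of its generator are known;
  uniqueness for the free equation identifies the orbit of \<open>w 0\<close> with the explicit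
  packet.\<close>

lemma w_evolution:
  assumes "isometric_group U" and gen: "\<And>a L. lapgen a L \<Longrightarrow> isometric_group.generates U a (imul L)"
  shows "w t = U t (w 0)" "imul (w t) = U t (imul (w 0))"
proof -
  interpret isometric_group U by fact
  show "w t = U t (w 0)"
    by (rule solution_unique[OF gen[OF w_lapgen] w_derivative])
  show "imul (w t) = U t (imul (w 0))"
    by (rule solution_unique[where w = "\<lambda>t. imul (w t)", OF gen[OF lapgen_imul[OF w_lapgen]]
          bounded_linear.has_vector_derivative[OF imul_bounded_linear w_derivative]])
qed

end

section \<open>Radial envelopes of the potentials\<close>

lemma borel_version:
  fixes V :: "'a::euclidean_space \<Rightarrow> complex"
  assumes V: "V \<in> borel_measurable lebesgue"
  obtains V' where "V' \<in> borel_measurable borel" "AE x in lborel. V x = V' x"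
proof -
  have "(\<lambda>x. Re (V x)) \<in> borel_measurable lebesgue" "(\<lambda>x. Im (V x)) \<in> borel_measurable lebesgue"
    using V by measurable
  then obtain R I where R: "R \<in> borel_measurable lborel" "AE x in lborel. Re (V x) = R x"
    and I: "I \<in> borel_measurable lborel" "AE x in lborel. Im (V x) = I x"
    using completion_ex_borel_measurable_real by metis
  have [measurable]: "R \<in> borel_measurable borel" "I \<in> borel_measurable borel" using R(1) I(1) by auto
  show ?thesis
  proof
    show "(\<lambda>x. of_real (R x) + \<i> * of_real (I x)) \<in> borel_measurable borel" by measurable
    show "AE x in lborel. V x = of_real (R x) + \<i> * of_real (I x)"
      using R(2) I(2) by eventually_elim (metis complex_eq)
  qed
qed

text \<open>The infimum is attained: every bound \<open>1 / Suc m\<close> above it fails on a null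
  set only, and countably many null sets have a null union.\<close>

lemma Linf_norm_on_bounds:
  assumes "Linf V"
  shows "0 \<le> Linf_norm_on V D" "AE x in lebesgue. x \<in> D \<longrightarrow> cmod (V x) \<le> Linf_norm_on V D"
proof -
  let ?A = "{C. C \<ge> 0 \<and> (AE x in lebesgue. x \<in> D \<longrightarrow> cmod (V x) \<le> C)}"
  obtain C where C: "AE x in lebesgue. cmod (V x) \<le> C" using assms by (auto simp: Linf_def)
  have "AE x in lebesgue. x \<in> D \<longrightarrow> cmod (V x) \<le> max C 0"
    using C by eventually_elim auto
  then have ne: "?A \<noteq> {}" by (auto intro!: exI[of _ "max C 0"])
  show "0 \<le> Linf_norm_on V D" unfolding Linf_norm_on_def by (rule cInf_greatest[OF ne]) auto
  have "AE x in lebesgue. x \<in> D \<longrightarrow> cmod (V x) \<le> Linf_norm_on V D + 1 / real (Suc m)" for m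
  proof -
    have "Inf ?A < Linf_norm_on V D + 1 / real (Suc m)" unfolding Linf_norm_on_def by simp
    from cInf_lessD[OF ne this] obtain C' where C': "C' \<in> ?A" "C' < Linf_norm_on V D + 1 / real (Suc m)" by blast
    from C'(1) have "AE x in lebesgue. x \<in> D \<longrightarrow> cmod (V x) \<le> C'" by simp
    then show ?thesis by eventually_elim (meson C'(2) less_imp_le order_trans)
  qed
  then have "AE x in lebesgue. \<forall>m. x \<in> D \<longrightarrow> cmod (V x) \<le> Linf_norm_on V D + 1 / real (Suc m)"
    by (intro AE_all_countable[THEN iffD2] allI)
  then show "AE x in lebesgue. x \<in> D \<longrightarrow> cmod (V x) \<le> Linf_norm_on V D"
  proof eventually_elim
    case (elim x)
    show ?case
    proof
      assume "x \<in> D"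
      with elim have le: "\<And>m. cmod (V x) \<le> Linf_norm_on V D + 1 / real (Suc m)" by blast
      have "(\<lambda>m. Linf_norm_on V D + 1 / real (Suc m)) \<longlonglongrightarrow> Linf_norm_on V D + 0"
        by (intro tendsto_intros LIMSEQ_Suc[OF lim_1_over_n])
      then show "cmod (V x) \<le> Linf_norm_on V D"
        by (intro LIMSEQ_le_const) (use le in auto)
    qed
  qed
qed

lemma annulus_cover: "\<exists>k. x \<in> annulus k \<and> norm x \<le> 2 ^ k"
proof (cases "norm x \<le> 1")
  case True
  then show ?thesis by (intro exI[of _ 0]) (simp add: annulus_def)
next
  case False
  obtain N where "norm x < 2 ^ N" using real_arch_pow[of 2 "norm x"] by auto
  then have ex: "norm x \<le> 2 ^ N" by simp
  define k where "k = (LEAST k. norm x \<le> 2 ^ k)"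
  have k: "norm x \<le> 2 ^ k" unfolding k_def by (rule LeastI[where P = "\<lambda>k. norm x \<le> 2 ^ k", OF ex])
  have k0: "k \<noteq> 0" using k False by (cases "k = 0") auto
  then have "\<not> norm x \<le> 2 ^ (k - 1)" unfolding k_def by (intro not_less_Least) auto
  then show ?thesis using k k0 by (intro exI[of _ k]) (simp add: annulus_def)
qed

text \<open>A decreasing radial majorant can be evaluated along a path: a point at distance at least
  \<open>r\<close> from the origin carries the bound \<open>\<omega> r\<close>. Integrability is
  asked on the half line, as a decreasing nonnegative function does not decay towards negative
  arguments.\<close>

definition envelope :: "(real \<Rightarrow> real) \<Rightarrow> bool" where
  "envelope \<omega> \<longleftrightarrow> (\<forall>r s. r \<le> s \<longrightarrow> \<omega> s \<le> \<omega> r) \<and> (\<forall>r. 0 \<le> \<omega> r) \<and> \<omega> \<in> borel_measurable borel \<and>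
     integrable lborel (\<lambda>r. indicat_real {0..} r * \<omega> r)"

text \<open>\<open>\<omega> r\<close> adds the suprema \<open>S k\<close> over all annuli with
  \<open>r \<le> 2 ^ k\<close>, those that reach the radius \<open>r\<close> or go beyond it. Its
  integral over the half line is the sum of \<open>2 ^ k * S k\<close>, so the assumed summability
  is exactly integrability.\<close>

lemma envelope_exists:
  fixes V :: "real^'n \<Rightarrow> complex"
  assumes V: "Linf V" and sum: "summable (\<lambda>k. 2^k * Linf_norm_on V (annulus k))"
  obtains \<omega> where "envelope \<omega>" "AE x in lebesgue. cmod (V x) \<le> \<omega> (norm x)"
proof -
  define S where "S k = Linf_norm_on V (annulus k)" for k
  have S0: "0 \<le> S k" for k unfolding S_def by (rule Linf_norm_on_bounds[OF V])
  have "norm (S k) \<le> 2 ^ k * S k" for k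
    using mult_right_mono[of 1 "2 ^ k" "S k"] S0[of k] by simp
  then have sumS: "summable S"
    using summable_comparison_test'[OF sum[folded S_def], of 0 S] by simp
  define f where "f k r = (if r \<le> 2 ^ k then S k else 0)" for k and r :: real
  have f: "0 \<le> f k r" "f k r \<le> S k" for k r using S0[of k] by (auto simp: f_def)
  have sumf: "summable (\<lambda>k. f k r)" for r
    by (rule summable_comparison_test'[OF sumS, of 0]) (use f in auto)
  define \<omega> where "\<omega> r = (\<Sum>k. f k r)" for r
  have mono: "\<omega> s \<le> \<omega> r" if "r \<le> s" for r s
    unfolding \<omega>_def by (rule suminf_le[OF _ sumf sumf]) (use that S0 in \<open>auto simp: f_def\<close>)
  have nonneg: "0 \<le> \<omega> r" for r unfolding \<omega>_def by (rule suminf_nonneg[OF sumf f(1)])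
  have fm [measurable]: "f k \<in> borel_measurable borel" for k unfolding f_def by measurable
  have meas [measurable]: "\<omega> \<in> borel_measurable borel"
  proof -
    have "mono (\<lambda>r. - \<omega> r)" using mono by (auto simp: mono_def)
    then have "(\<lambda>r. - \<omega> r) \<in> borel_measurable borel" by (rule borel_measurable_mono)
    then have "(\<lambda>r. - (- \<omega> r)) \<in> borel_measurable borel" by (rule borel_measurable_uminus)
    then show ?thesis by simp
  qed
  have int: "integrable lborel (\<lambda>r. indicat_real {0..} r * \<omega> r)"
  proof (rule integrableI_bounded)
    show "(\<lambda>r. indicat_real {0..} r * \<omega> r) \<in> borel_measurable lborel" by measurable
    have "(\<integral>\<^sup>+r. ennreal (norm (indicat_real {0..} r * \<omega> r)) \<partial>lborel)
        = (\<integral>\<^sup>+r. (\<Sum>k. ennreal (S k) * indicator {0..2 ^ k :: real} r) \<partial>lborel)"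
    proof (rule nn_integral_cong)
      fix r :: real
      have "ennreal (norm (indicat_real {0..} r * \<omega> r)) = ennreal (\<Sum>k. indicat_real {0..} r * f k r)"
        using nonneg[of r] by (simp add: \<omega>_def suminf_mult[OF sumf])
      also have "\<dots> = (\<Sum>k. ennreal (indicat_real {0..} r * f k r))"
        by (rule suminf_ennreal2[symmetric]) (use f sumf in \<open>auto intro: summable_mult\<close>)
      also have "\<dots> = (\<Sum>k. ennreal (S k) * indicator {0..2 ^ k :: real} r)"
        by (rule suminf_cong) (auto simp: f_def indicator_def)
      finally show "ennreal (norm (indicat_real {0..} r * \<omega> r)) = (\<Sum>k. ennreal (S k) * indicator {0..2 ^ k :: real} r)" .
    qed
    also have "\<dots> = (\<Sum>k. \<integral>\<^sup>+r. ennreal (S k) * indicator {0..2 ^ k :: real} r \<partial>lborel)"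
      by (rule nn_integral_suminf) (intro borel_measurable_times_ennreal borel_measurable_const borel_measurable_indicator, simp)
    also have "\<dots> = (\<Sum>k. ennreal (2 ^ k * S k))"
    proof (rule suminf_cong)
      fix k
      show "(\<integral>\<^sup>+r. ennreal (S k) * indicator {0..2 ^ k :: real} r \<partial>lborel) = ennreal (2 ^ k * S k)"
        by (subst nn_integral_cmult_indicator) (simp_all add: ennreal_mult'[OF S0, symmetric] mult.commute)
    qed
    also have "\<dots> = ennreal (\<Sum>k. 2 ^ k * S k)"
      by (rule suminf_ennreal2) (use S0 sum in \<open>auto simp: S_def\<close>)
    finally show "(\<integral>\<^sup>+r. ennreal (norm (indicat_real {0..} r * \<omega> r)) \<partial>lborel) < \<infinity>" by simp
  qed
  have "AE x in lebesgue. \<forall>k. x \<in> annulus k \<longrightarrow> cmod (V x) \<le> S k"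
    unfolding S_def by (subst AE_all_countable) (intro allI Linf_norm_on_bounds[OF V])
  then have "AE x in lebesgue. cmod (V x) \<le> \<omega> (norm x)"
  proof eventually_elim
    case (elim x)
    obtain k where k: "x \<in> annulus k" "norm x \<le> 2 ^ k" using annulus_cover by blast
    have "S k = f k (norm x)" using k by (simp add: f_def)
    also have "\<dots> = (\<Sum>j\<in>{k}. f j (norm x))" by simp
    also have "\<dots> \<le> \<omega> (norm x)" unfolding \<omega>_def by (rule sum_le_suminf[OF sumf]) (use f in auto)
    finally show ?case using elim k by force
  qed
  moreover have "envelope \<omega>" using mono nonneg meas int by (simp add: envelope_def)
  ultimately show ?thesis using that by blast
qed

lemma envelope_add: "envelope \<omega>1 \<Longrightarrow> envelope \<omega>2 \<Longrightarrow> envelope (\<lambda>r. \<omega>1 r + \<omega>2 r)"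
  by (auto simp: envelope_def distrib_left intro: add_mono)

locale radial_envelope =
  fixes \<omega> :: "real \<Rightarrow> real"
  assumes env: "envelope \<omega>"
begin

lemma \<omega>_anti: "r \<le> s \<Longrightarrow> \<omega> s \<le> \<omega> r" and \<omega>_nonneg: "0 \<le> \<omega> r"
  and \<omega>_borel [measurable]: "\<omega> \<in> borel_measurable borel"
  and \<omega>_integrable: "integrable lborel (\<lambda>r. indicat_real {0..} r * \<omega> r)"
  using env by (auto simp: envelope_def)

text \<open>Either the point is within \<open>\<sigma> / 2\<close> of the moving centre \<open>\<sigma> \<theta>\<close>, hence at distance
  at least \<open>\<sigma> / 2\<close> from the origin, or the exponential is already small.\<close>

lemma envelope_exp_le:
  fixes x \<theta> :: "'a::real_normed_vector"
  assumes \<theta>: "norm \<theta> = 1" and \<sigma>: "0 \<le> \<sigma>" and z: "0 \<le> z" "z \<le> \<omega> (norm x)"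
  shows "z * exp (- (2 * norm (x - \<sigma> *\<^sub>R \<theta>))) \<le> (\<omega> (\<sigma> / 2) + \<omega> 0 * exp (- (\<sigma> / 2))) * exp (- norm (x - \<sigma> *\<^sub>R \<theta>))"
    and "z\<^sup>2 * exp (- (2 * norm (x - \<sigma> *\<^sub>R \<theta>))) \<le> ((\<omega> (\<sigma> / 2))\<^sup>2 + (\<omega> 0 * exp (- (\<sigma> / 4)))\<^sup>2) * exp (- norm (x - \<sigma> *\<^sub>R \<theta>))"
proof -
  define d where "d = norm (x - \<sigma> *\<^sub>R \<theta>)"
  have d: "0 \<le> d" by (simp add: d_def)
  \<comment> \<open>One half of \<open>exp (- (2 * d))\<close> is kept for integration in
    \<open>x\<close>. Near the moving centre the bound \<open>A\<close> applies; away from it the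
    other half is at most \<open>exp (- (\<sigma> / 2))\<close>. The fact is used for
    \<open>z\<close> and again for its square.\<close>
  have key: "z' * exp (- (2 * d)) \<le> (A + B * exp (- (\<sigma> / 2))) * exp (- d)"
    if z': "0 \<le> z'" and A: "norm x \<ge> \<sigma> / 2 \<Longrightarrow> z' \<le> A" "0 \<le> A" and B: "z' \<le> B" for z' A B
  proof (cases "d \<le> \<sigma> / 2")
    case True
    have "norm (\<sigma> *\<^sub>R \<theta>) \<le> norm x + d"
      using norm_triangle_ineq[of x "\<sigma> *\<^sub>R \<theta> - x"] by (simp add: d_def norm_minus_commute)
    then have "norm x \<ge> \<sigma> / 2" using True \<sigma> \<theta> by simp
    then have "z' * exp (- (2 * d)) \<le> A * exp (- d)"
      using A d z' by (intro mult_mono) auto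
    also have "\<dots> \<le> (A + B * exp (- (\<sigma> / 2))) * exp (- d)"
      using z' B by (intro mult_right_mono) auto
    finally show ?thesis .
  next
    case False
    have "z' * exp (- (2 * d)) = (z' * exp (- d)) * exp (- d)" by (simp add: exp_add[symmetric] mult.assoc)
    also have "\<dots> \<le> (B * exp (- (\<sigma> / 2))) * exp (- d)"
      using False z' B by (intro mult_right_mono mult_mono) auto
    also have "\<dots> \<le> (A + B * exp (- (\<sigma> / 2))) * exp (- d)"
      using A by (intro mult_right_mono) auto
    finally show ?thesis .
  qed
  have z0: "z \<le> \<omega> 0" using z(2) \<omega>_anti[of 0 "norm x"] by simp
  have zA: "z \<le> \<omega> (\<sigma> / 2)" if "norm x \<ge> \<sigma> / 2" using z(2) \<omega>_anti[OF that] by simp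
  show "z * exp (- (2 * norm (x - \<sigma> *\<^sub>R \<theta>))) \<le> (\<omega> (\<sigma> / 2) + \<omega> 0 * exp (- (\<sigma> / 2))) * exp (- norm (x - \<sigma> *\<^sub>R \<theta>))"
    unfolding d_def[symmetric] by (rule key) (use z zA z0 \<omega>_nonneg in auto)
  have "(exp (- (\<sigma> / 4)))\<^sup>2 = exp (- (\<sigma> / 2))" by (simp add: exp_double[symmetric])
  moreover have "z\<^sup>2 * exp (- (2 * d)) \<le> ((\<omega> (\<sigma> / 2))\<^sup>2 + (\<omega> 0)\<^sup>2 * exp (- (\<sigma> / 2))) * exp (- d)"
    by (rule key) (use z zA z0 \<omega>_nonneg in \<open>auto intro!: power_mono\<close>)
  ultimately show "z\<^sup>2 * exp (- (2 * norm (x - \<sigma> *\<^sub>R \<theta>))) \<le> ((\<omega> (\<sigma> / 2))\<^sup>2 + (\<omega> 0 * exp (- (\<sigma> / 4)))\<^sup>2) * exp (- norm (x - \<sigma> *\<^sub>R \<theta>))"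
    by (simp add: d_def power_mult_distrib)
qed

section \<open>Integrals along the moving centre\<close>

definition expmass :: "'a::euclidean_space itself \<Rightarrow> real" where
  "expmass _ = (\<integral>x. exp (- norm x) \<partial>(lborel :: 'a measure))"

lemma exp_norm_shift:
  fixes v :: "'a::euclidean_space"
  shows "integrable lborel (\<lambda>x. exp (- norm (x - v)))" "(\<integral>x. exp (- norm (x - v)) \<partial>lborel) = expmass TYPE('a)"
proof -
  have i: "integrable lborel (\<lambda>x::'a. exp (- norm x))" using integrable_exp_norm[of 1, where 'a='a] by simp
  show "integrable lborel (\<lambda>x. exp (- norm (x - v)))" using integrable_lborel_shift[OF i, of "- v"] by simp
  show "(\<integral>x. exp (- norm (x - v)) \<partial>lborel) = expmass TYPE('a)"
    using integral_lborel_shift[of "\<lambda>x::'a. exp (- norm x)" "- v"] by (simp add: expmass_def)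
qed

lemma expmass_nonneg: "0 \<le> expmass TYPE('a::euclidean_space)"
  unfolding expmass_def by (rule Bochner_Integration.integral_nonneg) simp

text \<open>Bounds the L2 norm of a potential times a function of unit amplitude concentrated at
  \<open>\<sigma> *\<^sub>R \<theta>\<close>. The rate \<open>\<sigma> / 4\<close> arises because
  the squared estimate decays like \<open>exp (- (\<sigma> / 2))\<close>.\<close>

definition hit :: "'a::euclidean_space itself \<Rightarrow> real \<Rightarrow> real" where
  "hit _ \<sigma> = sqrt (expmass TYPE('a)) * (\<omega> (\<sigma> / 2) + \<omega> 0 * exp (- (\<sigma> / 4)))"

lemma hit_nonneg: "0 \<le> hit TYPE('a::euclidean_space) \<sigma>"
  using expmass_nonneg[where 'a = 'a] \<omega>_nonneg by (simp add: hit_def)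

lemma mulop_moving_bound:
  fixes V f :: "'a::euclidean_space \<Rightarrow> complex" and \<theta> :: 'a
  assumes V: "V \<in> borel_measurable borel" and VB: "\<And>x. cmod (V x) \<le> \<omega> (norm x)" and f: "sqint f"
    and fB: "\<And>x. cmod (f x) \<le> K * exp (- norm (x - \<sigma> *\<^sub>R \<theta>))" and K: "0 \<le> K"
    and \<theta>: "norm \<theta> = 1" and \<sigma>: "0 \<le> \<sigma>"
  shows "norm (mulop V (l2_of f)) \<le> K * hit TYPE('a) \<sigma>"
proof -
  have VC: "cmod (V x) \<le> \<omega> 0" for x using VB[of x] \<omega>_anti[of 0 "norm x"] by simp
  note m = mulop_l2_of[OF V VC f] sqint_mulop[OF V VC f]
  define A B where "A = \<omega> (\<sigma> / 2)" and "B = \<omega> 0 * exp (- (\<sigma> / 4))"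
  have AB: "0 \<le> A" "0 \<le> B" by (auto simp: A_def B_def \<omega>_nonneg)
  have "(norm (mulop V (l2_of f)))\<^sup>2 = (\<integral>x. (cmod (V x * f x))\<^sup>2 \<partial>lborel)"
    by (simp add: m norm_l2_of_square)
  also have "\<dots> \<le> (\<integral>x. K\<^sup>2 * (A\<^sup>2 + B\<^sup>2) * exp (- norm (x - \<sigma> *\<^sub>R \<theta>)) \<partial>lborel)"
  proof (rule integral_mono)
    show "integrable lborel (\<lambda>x. (cmod (V x * f x))\<^sup>2)" by (rule sqint_integrable[OF m(2)])
    show "integrable lborel (\<lambda>x. K\<^sup>2 * (A\<^sup>2 + B\<^sup>2) * exp (- norm (x - \<sigma> *\<^sub>R \<theta>)))"
      by (intro integrable_mult_right exp_norm_shift)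
    fix x
    have "(cmod (V x * f x))\<^sup>2 \<le> (cmod (V x) * (K * exp (- norm (x - \<sigma> *\<^sub>R \<theta>))))\<^sup>2"
      unfolding norm_mult by (intro power_mono mult_left_mono fB) auto
    also have "\<dots> = K\<^sup>2 * ((cmod (V x))\<^sup>2 * exp (- (2 * norm (x - \<sigma> *\<^sub>R \<theta>))))"
      by (simp add: power_mult_distrib exp_double[symmetric])
    also have "\<dots> \<le> K\<^sup>2 * ((A\<^sup>2 + B\<^sup>2) * exp (- norm (x - \<sigma> *\<^sub>R \<theta>)))"
      unfolding A_def B_def by (intro mult_left_mono envelope_exp_le \<theta> \<sigma> VB) auto
    finally show "(cmod (V x * f x))\<^sup>2 \<le> K\<^sup>2 * (A\<^sup>2 + B\<^sup>2) * exp (- norm (x - \<sigma> *\<^sub>R \<theta>))" by (simp only: mult.assoc)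
  qed
  also have "\<dots> = K\<^sup>2 * (A\<^sup>2 + B\<^sup>2) * expmass TYPE('a)" by (simp add: exp_norm_shift)
  also have "\<dots> \<le> K\<^sup>2 * (A + B)\<^sup>2 * expmass TYPE('a)"
    using AB expmass_nonneg by (intro mult_right_mono mult_left_mono) (auto simp: power2_sum)
  also have "\<dots> = (K * hit TYPE('a) \<sigma>)\<^sup>2"
    using expmass_nonneg[where 'a='a] by (simp add: hit_def A_def B_def power_mult_distrib)
  finally show ?thesis by (rule power2_le_imp_le) (simp add: K hit_nonneg)
qed

text \<open>Up to constants it majorises both the action of the potentials on a packet and the Born
  integrand, in the rescaled variable \<open>\<sigma> = 2 * lam * t\<close>.\<close>

definition dominator :: "real \<Rightarrow> real" where
  "dominator \<sigma> = indicat_real {0..} \<sigma> * (\<omega> (\<sigma> / 2) + \<omega> 0 * exp (- (\<sigma> / 4)))"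

lemma dominator_integrable: "integrable lborel dominator"
proof -
  have "integrable lborel (\<lambda>\<sigma>. indicat_real {0..} (0 + (1/2) * \<sigma>) * \<omega> (0 + (1/2) * \<sigma>))"
    by (rule lborel_integrable_real_affine[OF \<omega>_integrable]) simp
  then have 1: "integrable lborel (\<lambda>\<sigma>. indicat_real {0..} \<sigma> * \<omega> (\<sigma> / 2))"
    by (rule Bochner_Integration.integrable_cong[THEN iffD1, rotated -1]) (auto simp: indicator_def)
  have 2: "integrable lborel (\<lambda>\<sigma>. indicat_real {0..} \<sigma> * (\<omega> 0 * exp (- (\<sigma> / 4))))"
  proof (rule Bochner_Integration.integrable_bound)
    show "integrable lborel (\<lambda>\<sigma>::real. \<omega> 0 * exp (- ((1/4) * norm \<sigma>)))"
      by (intro integrable_mult_right integrable_exp_norm) simp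
  qed (auto simp: indicator_def \<omega>_nonneg abs_mult)
  show ?thesis unfolding dominator_def[abs_def] using Bochner_Integration.integrable_add[OF 1 2] by (simp add: distrib_left)
qed

lemma dominator_nonneg: "0 \<le> dominator \<sigma>"
  using \<omega>_nonneg by (simp add: dominator_def)

definition total :: real where "total = (\<integral>\<sigma>. dominator \<sigma> \<partial>lborel)"

lemma total_nonneg: "0 \<le> total"
  unfolding total_def by (rule Bochner_Integration.integral_nonneg) (rule dominator_nonneg)

text \<open>The substitution \<open>\<sigma> = 2 * lam * t\<close> produces the factor
  \<open>1 / (2 * lam)\<close>; what remains is an integral over the whole half line, free of
  \<open>T\<close> and \<open>lam\<close>.\<close>

lemma time_integral_bound:
  assumes g: "continuous_on {0..T} g" and le: "\<And>t. 0 \<le> t \<Longrightarrow> t \<le> T \<Longrightarrow> g t \<le> K * hit TYPE('a::euclidean_space) (2 * lam * t)"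
    and lam: "0 < lam" and K: "0 \<le> K"
  shows "integral {0..T} g \<le> K * sqrt (expmass TYPE('a)) * total / (2 * lam)"
proof -
  have si: "set_integrable lborel {0..T} g" by (rule borel_integrable_atLeastAtMost'[OF g])
  have "integral {0..T} g = (\<integral>t. indicat_real {0..T} t * g t \<partial>lborel)"
    using set_borel_integral_eq_integral(2)[OF si] by (simp add: set_lebesgue_integral_def)
  also have "\<dots> \<le> (\<integral>t. K * sqrt (expmass TYPE('a)) * dominator (0 + (2 * lam) * t) \<partial>lborel)"
  proof (rule integral_mono)
    show "integrable lborel (\<lambda>t. indicat_real {0..T} t * g t)" using si by (simp add: set_integrable_def)
    show "integrable lborel (\<lambda>t. K * sqrt (expmass TYPE('a)) * dominator (0 + (2 * lam) * t))"
      using lam by (intro integrable_mult_right lborel_integrable_real_affine[OF dominator_integrable]) simp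
    fix t
    show "indicat_real {0..T} t * g t \<le> K * sqrt (expmass TYPE('a)) * dominator (0 + (2 * lam) * t)"
    proof (cases "t \<in> {0..T}")
      case True
      then have "0 \<le> 2 * lam * t" using lam by simp
      then have eq: "K * hit TYPE('a) (2 * lam * t) = K * sqrt (expmass TYPE('a)) * dominator (0 + (2 * lam) * t)"
        by (simp add: hit_def dominator_def)
      have "indicat_real {0..T} t * g t = g t" using True by simp
      also have "\<dots> \<le> K * hit TYPE('a) (2 * lam * t)" using le[of t] True by simp
      finally show ?thesis by (simp only: eq)
    next
      case False
      then show ?thesis using K expmass_nonneg[where 'a = 'a] dominator_nonneg by simp
    qed
  qed
  also have "\<dots> = K * sqrt (expmass TYPE('a)) * (\<integral>t. dominator (0 + (2 * lam) * t) \<partial>lborel)" by simp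
  also have "(\<integral>t. dominator (0 + (2 * lam) * t) \<partial>lborel) = total / (2 * lam)"
    using lborel_integral_real_affine[of "2 * lam" dominator 0] lam by (simp add: total_def field_simps)
  finally show ?thesis by simp
qed

end

section \<open>Functions with vanishing Gaussian averages\<close>

lemma integrable_gaussian:
  assumes \<kappa>: "0 < \<kappa>"
  shows "integrable lborel (\<lambda>x::'a::euclidean_space. exp (- (\<kappa> * (norm x)\<^sup>2)))"
proof (rule Bochner_Integration.integrable_bound)
  show "integrable lborel (\<lambda>x::'a. exp (9 / (4 * \<kappa>)) * exp (- (1 * norm x)))"
    by (intro integrable_mult_right integrable_exp_norm) simp
  show "AE x::'a in lborel. norm (exp (- (\<kappa> * (norm x)\<^sup>2))) \<le> norm (exp (9 / (4 * \<kappa>)) * exp (- (1 * norm x)))"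
  proof (rule AE_I2)
    fix x :: 'a
    have "1 * exp (- (\<kappa> * (norm x)\<^sup>2)) \<le> (1 + norm x)\<^sup>2 * exp (- (\<kappa> * (norm x)\<^sup>2))" by (intro mult_right_mono one_le_power) auto
    also have "\<dots> \<le> exp (9 / (4 * \<kappa>)) * exp (- norm x)" using gaussian_le_exp[of "norm x" \<kappa>] \<kappa> by simp
    finally show "norm (exp (- (\<kappa> * (norm x)\<^sup>2))) \<le> norm (exp (9 / (4 * \<kappa>)) * exp (- (1 * norm x)))" by simp
  qed
qed measurable

lemma integral_lborel_scale:
  fixes f :: "'a::euclidean_space \<Rightarrow> real"
  assumes [measurable]: "f \<in> borel_measurable borel" and c: "c \<noteq> 0"
  shows "(\<integral>x. f x \<partial>lborel) = \<bar>c\<bar> ^ DIM('a) * (\<integral>x. f (c *\<^sub>R x) \<partial>lborel)"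
proof -
  have "(\<integral>x. f x \<partial>lborel) = (\<integral>x. f x \<partial>density (distr lborel borel (\<lambda>x. 0 + c *\<^sub>R x)) (\<lambda>_. \<bar>c\<bar> ^ DIM('a)))"
    by (subst lborel_affine[OF c, of 0]) simp
  also have "\<dots> = (\<integral>x. \<bar>c\<bar> ^ DIM('a) * f x \<partial>distr lborel borel (\<lambda>x. c *\<^sub>R x))"
    by (subst integral_density) auto
  also have "\<dots> = (\<integral>x. \<bar>c\<bar> ^ DIM('a) * f (c *\<^sub>R x) \<partial>lborel)"
    by (subst integral_distr) auto
  finally show ?thesis by simp
qed

text \<open>The autocorrelation of \<open>V\<close> is continuous and all its Gaussian averages at the origin vanish,
  so it vanishes at the origin, where it equals the squared norm of \<open>V\<close>.\<close>

lemma gaussian_averages_determine: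
  fixes V :: "'a::euclidean_space \<Rightarrow> complex"
  assumes V [measurable]: "V \<in> borel_measurable borel" and C: "\<And>x. cmod (V x) \<le> C" and L1: "integrable lborel V"
    and zero: "\<And>a \<epsilon>. \<epsilon> > 0 \<Longrightarrow> (\<integral>x. V x * of_real (exp (- ((norm (x - a))\<^sup>2 / \<epsilon>))) \<partial>lborel) = 0"
  shows "AE x in lborel. V x = 0"
proof -
  have C0: "0 \<le> C" using order_trans[OF norm_ge_zero C] .
  have sV: "sqint V"
  proof (rule sqint_bound[OF V])
    show "integrable lborel (\<lambda>x. C * norm (V x))" using L1 by simp
    show "AE x in lborel. (cmod (V x))\<^sup>2 \<le> C * norm (V x)"
      using C by (auto simp: power2_eq_square mult_right_mono)
  qed
  define \<nu> where "\<nu> = l2_of V"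
  define q where "q y = inner (translate y \<nu>) \<nu>" for y
  have qc: "continuous_on UNIV q" unfolding q_def by (intro continuous_intros translate_continuous)
  have qm [measurable]: "q \<in> borel_measurable borel" by (rule borel_measurable_continuous_onI[OF qc])
  have qb: "\<bar>q y\<bar> \<le> (norm \<nu>)\<^sup>2" for y
    using Cauchy_Schwarz_ineq2[of "translate y \<nu>" \<nu>] by (simp add: q_def power2_eq_square)
  have qe: "q y = Re (\<integral>x. V (x + y) * cnj (V x) \<partial>lborel)" for y
    unfolding q_def \<nu>_def by (simp add: translate_l2_of sV inner_l2_of sqint_shift)
  have avg0: "(\<integral>y. q y * exp (- ((norm y)\<^sup>2 / \<epsilon>)) \<partial>lborel) = 0" if \<epsilon>: "\<epsilon> > 0" for \<epsilon>
  proof -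
    define g where "g y = exp (- ((norm y)\<^sup>2 / \<epsilon>))" for y :: 'a
    have [measurable]: "g \<in> borel_measurable borel" unfolding g_def by measurable
    have gi: "integrable lborel g"
      using integrable_gaussian[of "1 / \<epsilon>", where 'a = 'a] \<epsilon> by (simp add: g_def[abs_def])
    define f where "f x y = V (x + y) * cnj (V x) * of_real (g y)" for x y
    have fb: "norm (f x y) \<le> C * norm (V x) * g y" for x y
      unfolding f_def norm_mult using C[of "x + y"] by (auto simp: g_def intro!: mult_right_mono)
    have fm [measurable]: "(\<lambda>(x, y). f x y) \<in> borel_measurable (lborel \<Otimes>\<^sub>M lborel)"
      unfolding f_def by measurable
    have fy: "integrable lborel (\<lambda>y. f x y)" for x
    proof (rule Bochner_Integration.integrable_bound)
      show "integrable lborel (\<lambda>y. C * norm (V x) * g y)" using gi by simp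
      show "AE y in lborel. norm (f x y) \<le> norm (C * norm (V x) * g y)"
        by (rule AE_I2) (rule order_trans[OF fb], simp)
    qed (simp add: f_def)
    have prod: "integrable (lborel \<Otimes>\<^sub>M lborel) (\<lambda>(x, y). f x y)"
    proof (rule lborel_pair.Fubini_integrable[OF fm])
      show "AE x in lborel. integrable lborel (\<lambda>y. (case (x, y) of (x, y) \<Rightarrow> f x y))" using fy by simp
      show "integrable lborel (\<lambda>x. \<integral>y. norm (case (x, y) of (x, y) \<Rightarrow> f x y) \<partial>lborel)"
      proof (rule Bochner_Integration.integrable_bound)
        show "integrable lborel (\<lambda>x. C * norm (V x) * (\<integral>y. g y \<partial>lborel))" using L1 by simp
        show "AE x in lborel. norm (\<integral>y. norm (case (x, y) of (x, y) \<Rightarrow> f x y) \<partial>lborel) \<le> norm (C * norm (V x) * (\<integral>y. g y \<partial>lborel))"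
        proof (rule AE_I2)
          fix x
          have "(\<integral>y. norm (f x y) \<partial>lborel) \<le> (\<integral>y. C * norm (V x) * g y \<partial>lborel)"
            by (rule integral_mono) (use fy gi fb in auto)
          then have "(\<integral>y. norm (f x y) \<partial>lborel) \<le> C * norm (V x) * (\<integral>y. g y \<partial>lborel)" by simp
          moreover have "0 \<le> (\<integral>y. norm (f x y) \<partial>lborel)" by (rule Bochner_Integration.integral_nonneg) simp
          ultimately show "norm (\<integral>y. norm (case (x, y) of (x, y) \<Rightarrow> f x y) \<partial>lborel) \<le> norm (C * norm (V x) * (\<integral>y. g y \<partial>lborel))"
            by simp
        qed
        show "(\<lambda>x. \<integral>y. norm (case (x, y) of (x, y) \<Rightarrow> f x y) \<partial>lborel) \<in> borel_measurable lborel"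
          by measurable
      qed
    qed
    have "(\<integral>y. (\<integral>x. f x y \<partial>lborel) \<partial>lborel) = (\<integral>x. (\<integral>y. f x y \<partial>lborel) \<partial>lborel)"
      by (rule lborel_pair.Fubini_integral[OF prod])
    \<comment> \<open>For fixed \<open>x\<close> the integral over \<open>y\<close> is, up to the
      factor \<open>cnj (V x)\<close>, the Gaussian average of \<open>V\<close> centred at
      \<open>x\<close>.\<close>
    also have "(\<lambda>x. \<integral>y. f x y \<partial>lborel) = (\<lambda>x. 0)"
    proof
      fix x
      have "(\<integral>y. f x y \<partial>lborel) = (\<integral>y. cnj (V x) * (V (y + x) * of_real (exp (- ((norm ((y + x) - x))\<^sup>2 / \<epsilon>)))) \<partial>lborel)"
        by (rule Bochner_Integration.integral_cong) (auto simp: f_def g_def add.commute)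
      also have "\<dots> = cnj (V x) * (\<integral>y. V (y + x) * of_real (exp (- ((norm ((y + x) - x))\<^sup>2 / \<epsilon>))) \<partial>lborel)"
        by (rule integral_mult_right_zero)
      also have "(\<integral>y. V (y + x) * of_real (exp (- ((norm ((y + x) - x))\<^sup>2 / \<epsilon>))) \<partial>lborel) = 0"
        using integral_lborel_shift[of "\<lambda>z. V z * of_real (exp (- ((norm (z - x))\<^sup>2 / \<epsilon>)))" x] zero[OF \<epsilon>, of x] by simp
      finally show "(\<integral>y. f x y \<partial>lborel) = 0" by simp
    qed
    finally have "(\<integral>y. (\<integral>x. f x y \<partial>lborel) \<partial>lborel) = 0" by simp
    moreover have "integrable lborel (\<lambda>y. \<integral>x. f x y \<partial>lborel)"
      using lborel_pair.integrable_snd[OF prod] .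
    ultimately have "(\<integral>y. Re (\<integral>x. f x y \<partial>lborel) \<partial>lborel) = 0" by (simp add: integral_Re)
    moreover have "Re (\<integral>x. f x y \<partial>lborel) = q y * g y" for y
    proof -
      have "(\<integral>x. f x y \<partial>lborel) = (\<integral>x. V (x + y) * cnj (V x) \<partial>lborel) * of_real (g y)"
        unfolding f_def by (rule integral_mult_left_zero)
      then show ?thesis by (simp add: qe)
    qed
    ultimately show ?thesis by (simp add: g_def)
  qed
  \<comment> \<open>Scaling by \<open>1 / Suc m\<close>, with \<open>\<epsilon>\<close> the square
    of this factor, keeps the Gaussian fixed and contracts the argument of \<open>q\<close> to the
    origin.\<close>
  have "(\<integral>z. q ((1 / real (Suc m)) *\<^sub>R z) * exp (- (norm z)\<^sup>2) \<partial>lborel) = 0" for m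
  proof -
    let ?c = "1 / real (Suc m)"
    have "(\<integral>y. q y * exp (- ((norm y)\<^sup>2 / ?c\<^sup>2)) \<partial>lborel)
        = \<bar>?c\<bar> ^ DIM('a) * (\<integral>z. q (?c *\<^sub>R z) * exp (- ((norm (?c *\<^sub>R z))\<^sup>2 / ?c\<^sup>2)) \<partial>lborel)"
      by (rule integral_lborel_scale) auto
    moreover have "(norm (?c *\<^sub>R z))\<^sup>2 / ?c\<^sup>2 = (norm z)\<^sup>2" for z :: 'a
      by (simp add: power_mult_distrib power_divide)
    ultimately show ?thesis using avg0[of "?c\<^sup>2"] by simp
  qed
  moreover have "(\<lambda>m. \<integral>z. q ((1 / real (Suc m)) *\<^sub>R z) * exp (- (norm z)\<^sup>2) \<partial>lborel)
      \<longlonglongrightarrow> (\<integral>z. q 0 * exp (- (norm z)\<^sup>2) \<partial>(lborel :: 'a measure))"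
  proof (rule integral_dominated_convergence[where w = "\<lambda>z. (norm \<nu>)\<^sup>2 * exp (- (norm z)\<^sup>2)"])
    show "integrable lborel (\<lambda>z::'a. (norm \<nu>)\<^sup>2 * exp (- (norm z)\<^sup>2))"
      using integrable_gaussian[of 1, where 'a = 'a] by (intro integrable_mult_right) simp
    show "AE z in lborel. (\<lambda>m. q ((1 / real (Suc m)) *\<^sub>R z) * exp (- (norm z)\<^sup>2)) \<longlonglongrightarrow> q 0 * exp (- (norm z)\<^sup>2)"
    proof (rule AE_I2)
      fix z :: 'a
      have "(\<lambda>m. (1 / real (Suc m)) *\<^sub>R z) \<longlonglongrightarrow> 0 *\<^sub>R z" by (intro tendsto_intros LIMSEQ_Suc[OF lim_1_over_n])
      then have "(\<lambda>m. q ((1 / real (Suc m)) *\<^sub>R z)) \<longlonglongrightarrow> q 0"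
        using qc by (auto simp: continuous_on_eq_continuous_at intro: isCont_tendsto_compose)
      then show "(\<lambda>m. q ((1 / real (Suc m)) *\<^sub>R z) * exp (- (norm z)\<^sup>2)) \<longlonglongrightarrow> q 0 * exp (- (norm z)\<^sup>2)"
        by (intro tendsto_intros)
    qed
    show "AE z in lborel. norm (q ((1 / real (Suc m)) *\<^sub>R z) * exp (- (norm z)\<^sup>2)) \<le> (norm \<nu>)\<^sup>2 * exp (- (norm z)\<^sup>2)" for m
      using qb by (auto simp: abs_mult mult_right_mono)
  qed auto
  ultimately have "(\<integral>z. q 0 * exp (- (norm z)\<^sup>2) \<partial>(lborel :: 'a measure)) = 0" by (simp add: LIMSEQ_const_iff)
  then have "q 0 * (\<integral>z. exp (- (norm z)\<^sup>2) \<partial>(lborel :: 'a measure)) = 0" by simp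
  moreover have "(\<integral>z. exp (- (norm z)\<^sup>2) \<partial>(lborel :: 'a measure)) \<noteq> 0"
  proof
    assume "(\<integral>z. exp (- (norm z)\<^sup>2) \<partial>(lborel :: 'a measure)) = 0"
    then have "AE z::'a in lborel. exp (- (norm z)\<^sup>2) = 0"
      using integral_nonneg_eq_0_iff_AE[OF integrable_gaussian[of 1, where 'a='a]] by simp
    then have "AE z::'a in lborel. False" by simp
    then have "(UNIV :: 'a set) \<in> null_sets lborel" by (subst (asm) AE_iff_null) auto
    then show False by (simp add: null_sets_def emeasure_lborel_UNIV)
  qed
  ultimately have "inner \<nu> \<nu> = 0" by (simp add: q_def)
  then have "l2_of V = l2_of (\<lambda>x. 0)" by (simp add: \<nu>_def zero_l2_def)
  then show ?thesis using l2_of_eqD[OF _ sV sqint_0] by simp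
qed

section \<open>High energy asymptotics\<close>

text \<open>Equality of the final-state maps enters through \<open>same\<close>, stated for
  interaction picture solutions with equal initial vectors. The momentum \<open>lam\<close> and the
  starting point \<open>a\<close> are left free: the first tends to infinity, the second ranges over
  the whole space.\<close>

locale scattering = radial_envelope \<omega> for \<omega> :: "real \<Rightarrow> real" +
  fixes V1 V2 :: "'a::euclidean_space \<Rightarrow> complex" and T \<epsilon> :: real and \<theta> :: 'a
    and U :: "real \<Rightarrow> 'a l2 \<Rightarrow> 'a l2"
  assumes V1 [measurable]: "V1 \<in> borel_measurable borel" and V1B: "\<And>x. cmod (V1 x) \<le> \<omega> (norm x)"
    and V2 [measurable]: "V2 \<in> borel_measurable borel" and V2B: "\<And>x. cmod (V2 x) \<le> \<omega> (norm x)"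
    and T: "0 < T" and packet: "packet \<epsilon> \<theta>"
    and group: "isometric_group U" and gen: "\<And>a L. lapgen a L \<Longrightarrow> isometric_group.generates U a (imul L)"
    and same: "\<And>v1 v2. v1 0 = v2 0 \<Longrightarrow>
      (\<And>t. (v1 has_vector_derivative U (- t) (- imul (mulop V1 (U t (v1 t))))) (at t)) \<Longrightarrow>
      (\<And>t. (v2 has_vector_derivative U (- t) (- imul (mulop V2 (U t (v2 t))))) (at t)) \<Longrightarrow> U T (v1 T) = U T (v2 T)"
begin

interpretation isometric_group U by (rule group)

abbreviation "Wp lam a \<equiv> packet.W \<epsilon> lam a \<theta>"
abbreviation "wp lam a \<equiv> packet.w \<epsilon> lam a \<theta>"

definition amp :: "'a \<Rightarrow> real" where
  "amp a = packet.width_bound TYPE('a) \<epsilon> T * exp (norm a)"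

lemma \<theta>: "norm \<theta> = 1" and \<epsilon>: "0 < \<epsilon>"
  using packet by (auto simp: packet_def)

lemma amp_pos: "0 < amp a"
  using packet.width_bound_pos[OF packet, where T = T] by (simp add: amp_def)

lemma Wp_le: "0 \<le> t \<Longrightarrow> t \<le> T \<Longrightarrow> cmod (Wp lam a t x) \<le> amp a * exp (- norm (x - (2 * lam * t) *\<^sub>R \<theta>))"
  using packet.W_bound_moving[OF packet, of t T lam a x] by (simp add: amp_def)

lemma V_le: "cmod (V1 x) \<le> \<omega> 0" "cmod (V2 x) \<le> \<omega> 0"
  using V1B[of x] V2B[of x] \<omega>_anti[of 0 "norm x"] by auto

lemma wp_continuous: "continuous_on UNIV (wp lam a)"
  by (rule has_vector_derivative_imp_continuous_on[OF packet.w_derivative[OF packet]])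

text \<open>Bounds the time integral of the norm of a potential acting on the packet, the total
  effect of one crossing.\<close>

definition transit :: "real \<Rightarrow> 'a \<Rightarrow> real" where
  "transit lam a = amp a * sqrt (expmass TYPE('a)) * total / (2 * lam)"

lemma transit_nonneg: "0 < lam \<Longrightarrow> 0 \<le> transit lam a"
  using amp_pos[of a] expmass_nonneg[where 'a='a] total_nonneg by (simp add: transit_def)

lemma mulop_packet_le:
  assumes V: "V \<in> borel_measurable borel" "\<And>x. cmod (V x) \<le> \<omega> (norm x)" and t: "0 \<le> t" "t \<le> T" and lam: "0 < lam"
    and \<kappa>: "cmod \<kappa> = 1"
  shows "norm (mulop V (l2_of (\<lambda>x. \<kappa> * Wp lam a t x))) \<le> amp a * hit TYPE('a) (2 * lam * t)"
proof (rule mulop_moving_bound[OF V _ _ _ \<theta>])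
  show "sqint (\<lambda>x. \<kappa> * Wp lam a t x)" by (intro sqint_cmult packet.sqint_W[OF packet])
  show "cmod (\<kappa> * Wp lam a t x) \<le> amp a * exp (- norm (x - (2 * lam * t) *\<^sub>R \<theta>))" for x
    using Wp_le[OF t] \<kappa> by (simp add: norm_mult)
qed (use amp_pos[of a] t lam in auto)

text \<open>The unimodular factor \<open>\<kappa>\<close> lets one estimate cover the packet
  together with its multiples by \<i>.\<close>

lemma mulop_transit:
  assumes V: "V \<in> borel_measurable borel" "\<And>x. cmod (V x) \<le> \<omega> (norm x)" and lam: "0 < lam" and \<kappa>: "cmod \<kappa> = 1"
    and q: "continuous_on UNIV q" "\<And>t. q t = l2_of (\<lambda>x. \<kappa> * Wp lam a t x)" and s: "s \<le> T"
  shows "integral {0..s} (\<lambda>t. norm (mulop V (q t))) \<le> transit lam a"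
proof -
  have VC: "cmod (V x) \<le> \<omega> 0" for x using V(2)[of x] \<omega>_anti[of 0 "norm x"] by simp
  show ?thesis
    unfolding transit_def
  proof (rule time_integral_bound[OF _ _ lam])
    show "continuous_on {0..s} (\<lambda>t. norm (mulop V (q t)))"
      by (intro continuous_intros continuous_on_subset[OF bounded_linear.continuous_on[OF mulop_bounded_linear[OF V(1) VC] q(1)]]) simp
    show "norm (mulop V (q t)) \<le> amp a * hit TYPE('a) (2 * lam * t)" if "0 \<le> t" "t \<le> s" for t
      unfolding q(2) by (rule mulop_packet_le) (use V that s lam \<kappa> in auto)
  qed (use amp_pos[of a] in auto)
qed

lemma wp_eq: "wp lam a t = l2_of (\<lambda>x. 1 * Wp lam a t x)"
  using packet.w_def[OF packet, of lam a t] by simp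

text \<open>The potential along the free packet integrates to at most \<open>transit lam a\<close>.
  The Gronwall factor is computed from the sup norm \<open>\<omega> 0\<close> over the full time
  interval; it is harmless because it does not involve \<open>lam\<close>.\<close>

lemma solution_close:
  assumes V: "V \<in> borel_measurable borel" "\<And>x. cmod (V x) \<le> \<omega> (norm x)" and lam: "0 < lam"
  obtains v where "v 0 = wp lam a 0" "\<And>t. (v has_vector_derivative U (- t) (- imul (mulop V (U t (v t))))) (at t)"
    "\<And>t. 0 \<le> t \<Longrightarrow> t \<le> T \<Longrightarrow> norm (U t (v t) - wp lam a t) \<le> exp (\<omega> 0 * T) * transit lam a"
proof -
  have VC: "cmod (V x) \<le> \<omega> 0" for x using V(2)[of x] \<omega>_anti[of 0 "norm x"] by simp
  have lin: "linear (\<lambda>x. - imul (mulop V x))"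
    by (intro linear_compose_neg linear_compose[OF mulop_linear[OF V(1) VC] imul_linear, unfolded o_def])
  have nrm: "norm (- imul (mulop V x)) \<le> \<omega> 0 * norm x" for x
    using norm_mulop_le[OF V(1) VC, of x] by simp
  obtain v where v: "v 0 = wp lam a 0" "\<And>t. (v has_vector_derivative U (- t) (- imul (mulop V (U t (v t))))) (at t)"
    and vb: "\<And>t. 0 \<le> t \<Longrightarrow> norm (v t - wp lam a 0) \<le> exp (\<omega> 0 * t) * integral {0..t} (\<lambda>s. norm (- imul (mulop V (U s (wp lam a 0)))))"
    using perturbed_evolution[OF lin nrm \<omega>_nonneg] by blast
  have ev: "U s (wp lam a 0) = wp lam a s" for s
    using packet.w_evolution(1)[OF packet group gen] by metis
  have "norm (U t (v t) - wp lam a t) \<le> exp (\<omega> 0 * T) * transit lam a" if t: "0 \<le> t" "t \<le> T" for t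
  proof -
    have "U t (v t) - wp lam a t = U t (v t - wp lam a 0)"
      using U_linear[of t] by (simp add: ev[symmetric, of t] linear_diff)
    then have "norm (U t (v t) - wp lam a t) = norm (v t - wp lam a 0)" by simp
    also have "\<dots> \<le> exp (\<omega> 0 * t) * integral {0..t} (\<lambda>s. norm (mulop V (wp lam a s)))"
      using vb[OF t(1)] by (simp add: ev)
    also have "\<dots> \<le> exp (\<omega> 0 * T) * transit lam a"
    proof (rule mult_mono)
      show "exp (\<omega> 0 * t) \<le> exp (\<omega> 0 * T)" using t \<omega>_nonneg by (simp add: mult_left_mono)
      show "integral {0..t} (\<lambda>s. norm (mulop V (wp lam a s))) \<le> transit lam a"
        by (rule mulop_transit[OF V lam _ wp_continuous wp_eq t(2)]) simp
      show "0 \<le> integral {0..t} (\<lambda>s. norm (mulop V (wp lam a s)))"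
        by (rule Henstock_Kurzweil_Integration.integral_nonneg)
          (auto intro!: integrable_continuous_real continuous_intros continuous_on_subset[OF bounded_linear.continuous_on[OF mulop_bounded_linear[OF V(1) VC] wp_continuous]])
    qed simp
    finally show ?thesis .
  qed
  with v show ?thesis using that by blast
qed

text \<open>First order perturbation theory: the interaction of the two solutions with a packet differs
  from that of the free packet by a product of two transit times.\<close>

lemma born_estimate:
  assumes lam: "0 < lam" and \<kappa>: "cmod \<kappa> = 1" and q: "\<And>t. q t = l2_of (\<lambda>x. \<kappa> * Wp lam a t x)"
    and qg: "\<And>t. generates (q t) (q' t)" and qd: "\<And>t. (q has_vector_derivative q' t) (at t)"
  shows "\<bar>integral {0..T} (\<lambda>t. inner (imul (mulop (\<lambda>x. V1 x - V2 x) (wp lam a t))) (q t))\<bar>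
    \<le> 2 * exp (\<omega> 0 * T) * (transit lam a)\<^sup>2"
proof -
  define \<rho> where "\<rho> = exp (\<omega> 0 * T) * transit lam a"
  have qc: "continuous_on UNIV q"
    by (rule has_vector_derivative_imp_continuous_on[OF qd])
  have key: "\<exists>u. continuous_on UNIV u \<and>
      ((\<lambda>t. inner (- imul (mulop V (u t))) (q t)) has_integral inner (u T) (q T) - inner (u 0) (q 0)) {0..T} \<and>
      (\<forall>t\<in>{0..T}. norm (u t - wp lam a t) \<le> \<rho>) \<and> u 0 = wp lam a 0 \<and>
      (\<exists>v. v 0 = wp lam a 0 \<and> (\<forall>t. (v has_vector_derivative U (- t) (- imul (mulop V (U t (v t))))) (at t)) \<and> u T = U T (v T))"
    if V: "V \<in> borel_measurable borel" "\<And>x. cmod (V x) \<le> \<omega> (norm x)" for V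
  proof -
    obtain v where v: "v 0 = wp lam a 0" "\<And>t. (v has_vector_derivative U (- t) (- imul (mulop V (U t (v t))))) (at t)"
      "\<And>t. 0 \<le> t \<Longrightarrow> t \<le> T \<Longrightarrow> norm (U t (v t) - wp lam a t) \<le> \<rho>"
      using solution_close[OF V lam] unfolding \<rho>_def by blast
    define u where "u t = U t (v t)" for t
    have vc: "continuous_on UNIV v"
      by (rule has_vector_derivative_imp_continuous_on[OF v(2)])
    have uc: "continuous_on UNIV u" unfolding u_def by (rule U_apply_continuous[OF vc])
    have d: "((\<lambda>t. inner (u t) (q t)) has_vector_derivative inner (- imul (mulop V (u t))) (q t)) (at t)" for t
      using perturbed_pairing[where P = "\<lambda>x. - imul (mulop V x)", OF v(2) qg qd, of t] by (simp add: u_def)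
    have "((\<lambda>t. inner (- imul (mulop V (u t))) (q t)) has_integral inner (u T) (q T) - inner (u 0) (q 0)) {0..T}"
      using T by (intro fundamental_theorem_of_calculus has_vector_derivative_at_within[OF d]) simp
    then show ?thesis using uc v by (intro exI[of _ u]) (auto simp: u_def)
  qed
  obtain u1 v1 where u1: "continuous_on UNIV u1"
      "((\<lambda>t. inner (- imul (mulop V1 (u1 t))) (q t)) has_integral inner (u1 T) (q T) - inner (u1 0) (q 0)) {0..T}"
      "\<And>t. t \<in> {0..T} \<Longrightarrow> norm (u1 t - wp lam a t) \<le> \<rho>" "u1 0 = wp lam a 0"
    and v1: "v1 0 = wp lam a 0" "\<And>t. (v1 has_vector_derivative U (- t) (- imul (mulop V1 (U t (v1 t))))) (at t)" "u1 T = U T (v1 T)"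
    using key[OF V1 V1B] by blast
  obtain u2 v2 where u2: "continuous_on UNIV u2"
      "((\<lambda>t. inner (- imul (mulop V2 (u2 t))) (q t)) has_integral inner (u2 T) (q T) - inner (u2 0) (q 0)) {0..T}"
      "\<And>t. t \<in> {0..T} \<Longrightarrow> norm (u2 t - wp lam a t) \<le> \<rho>" "u2 0 = wp lam a 0"
    and v2: "v2 0 = wp lam a 0" "\<And>t. (v2 has_vector_derivative U (- t) (- imul (mulop V2 (U t (v2 t))))) (at t)" "u2 T = U T (v2 T)"
    using key[OF V2 V2B] by blast
  \<comment> \<open>Initial and final states agree, so the boundary terms of the two integrated
    pairings cancel.\<close>
  have "u1 T = u2 T" unfolding v1(3) v2(3) by (rule same) (use v1 v2 in auto)
  with has_integral_diff[OF u1(2) u2(2)] u1(4) u2(4)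
  have zero: "((\<lambda>t. inner (- imul (mulop V1 (u1 t))) (q t) - inner (- imul (mulop V2 (u2 t))) (q t)) has_integral 0) {0..T}"
    by simp
  note ml1 = mulop_bounded_linear[OF V1 V_le(1)] and ml2 = mulop_bounded_linear[OF V2 V_le(2)]
  note cl = bounded_linear.continuous_on
  \<comment> \<open>The cost of replacing the perturbed solutions by the free packet. Each term
    contains a deviation of norm at most \<open>\<rho>\<close>, which carries one transit
    time.\<close>
  define E where "E t = inner (- imul (mulop V1 (u1 t - wp lam a t))) (q t) - inner (- imul (mulop V2 (u2 t - wp lam a t))) (q t)" for t
  have Ec: "continuous_on UNIV E"
    unfolding E_def
    by (intro continuous_intros cl[OF imul_bounded_linear] cl[OF ml1] cl[OF ml2] u1(1) u2(1) wp_continuous qc)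
  have D: "mulop (\<lambda>x. V1 x - V2 x) b = mulop V1 b - mulop V2 b" for b
  proof -
    have "mulop (\<lambda>x. V1 x - V2 x) b = l2_of (\<lambda>x. V1 x * rep_l2 b x - V2 x * rep_l2 b x)"
      by (simp add: mulop_def left_diff_distrib)
    then show ?thesis
      by (simp add: mulop_def l2_of_diff sqint_mulop[OF V1 V_le(1)] sqint_mulop[OF V2 V_le(2)])
  qed
  have split: "inner (imul (mulop (\<lambda>x. V1 x - V2 x) (wp lam a t))) (q t) =
      E t - (inner (- imul (mulop V1 (u1 t))) (q t) - inner (- imul (mulop V2 (u2 t))) (q t))" for t
    unfolding E_def D linear_diff[OF imul_linear] linear_diff[OF bounded_linear.linear[OF ml1]] linear_diff[OF bounded_linear.linear[OF ml2]]
    by (simp add: inner_diff_left)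
  have "(E has_integral integral {0..T} E) {0..T}"
    by (intro integrable_integral integrable_continuous_real continuous_on_subset[OF Ec]) simp
  from has_integral_diff[OF this zero]
  have eq: "integral {0..T} (\<lambda>t. inner (imul (mulop (\<lambda>x. V1 x - V2 x) (wp lam a t))) (q t)) = integral {0..T} E"
    unfolding split by (simp add: integral_unique)
  \<comment> \<open>Moving the potential to the other side of the inner product lets it act on the
    free packet in place of the deviation; integrated in time, it contributes the second transit
    time.\<close>
  define F where "F t = \<rho> * norm (mulop (\<lambda>x. cnj (V1 x)) (imul (q t))) + \<rho> * norm (mulop (\<lambda>x. cnj (V2 x)) (imul (q t)))" for t
  have cV: "(\<lambda>x. cnj (V1 x)) \<in> borel_measurable borel" "(\<lambda>x. cnj (V2 x)) \<in> borel_measurable borel"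
    "cmod (cnj (V1 x)) \<le> \<omega> (norm x)" "cmod (cnj (V2 x)) \<le> \<omega> (norm x)"
    "cmod (cnj (V1 x)) \<le> \<omega> 0" "cmod (cnj (V2 x)) \<le> \<omega> 0" for x
    using V1B V2B V_le by auto
  note cl1 = mulop_bounded_linear[OF cV(1) cV(5)] and cl2 = mulop_bounded_linear[OF cV(2) cV(6)]
  have iq: "continuous_on UNIV (\<lambda>t. imul (q t))" by (rule cl[OF imul_bounded_linear qc])
  have iqe: "imul (q t) = l2_of (\<lambda>x. (\<i> * \<kappa>) * Wp lam a t x)" for t
    unfolding q by (subst imul_l2_of) (auto simp: mult.assoc packet.sqint_W[OF packet])
  have N1c: "continuous_on UNIV (\<lambda>t. norm (mulop (\<lambda>x. cnj (V1 x)) (imul (q t))))"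
    and N2c: "continuous_on UNIV (\<lambda>t. norm (mulop (\<lambda>x. cnj (V2 x)) (imul (q t))))"
    by (intro continuous_intros cl[OF cl1] cl[OF cl2] iq)+
  have i1: "(\<lambda>t. norm (mulop (\<lambda>x. cnj (V1 x)) (imul (q t)))) integrable_on {0..T}"
    and i2: "(\<lambda>t. norm (mulop (\<lambda>x. cnj (V2 x)) (imul (q t)))) integrable_on {0..T}"
    by (rule integrable_continuous_real, rule continuous_on_subset[OF N1c], simp)
       (rule integrable_continuous_real, rule continuous_on_subset[OF N2c], simp)
  have Eb: "norm (E t) \<le> F t" if "t \<in> {0..T}" for t
  proof -
    have one: "\<bar>inner (- imul (mulop V b)) (q t)\<bar> \<le> \<rho> * norm (mulop (\<lambda>x. cnj (V x)) (imul (q t)))"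
      if "V \<in> borel_measurable borel" "\<And>x. cmod (V x) \<le> \<omega> 0" "norm b \<le> \<rho>" for V b
    proof -
      have "inner (- imul (mulop V b)) (q t) = inner b (mulop (\<lambda>x. cnj (V x)) (imul (q t)))"
        by (simp add: imul_skew mulop_adjoint[OF that(1,2)])
      also have "\<bar>\<dots>\<bar> \<le> norm b * norm (mulop (\<lambda>x. cnj (V x)) (imul (q t)))" by (rule Cauchy_Schwarz_ineq2)
      also have "\<dots> \<le> \<rho> * norm (mulop (\<lambda>x. cnj (V x)) (imul (q t)))" by (intro mult_right_mono that) simp
      finally show ?thesis .
    qed
    show ?thesis
      using one[OF V1 V_le(1) u1(3)[OF that]] one[OF V2 V_le(2) u2(3)[OF that]]
      unfolding E_def F_def real_norm_def by linarith
  qed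
  have "norm (integral {0..T} E) \<le> integral {0..T} F"
  proof (rule integral_norm_bound_integral[OF _ _ Eb])
    show "E integrable_on {0..T}" by (intro integrable_continuous_real continuous_on_subset[OF Ec]) simp
    show "F integrable_on {0..T}" unfolding F_def by (intro integrable_add integrable_on_mult_right i1 i2)
  qed
  also have "integral {0..T} F = \<rho> * integral {0..T} (\<lambda>t. norm (mulop (\<lambda>x. cnj (V1 x)) (imul (q t)))) +
      \<rho> * integral {0..T} (\<lambda>t. norm (mulop (\<lambda>x. cnj (V2 x)) (imul (q t))))"
    unfolding F_def by (subst integral_add) (auto intro: integrable_on_mult_right i1 i2)
  also have "\<dots> \<le> \<rho> * transit lam a + \<rho> * transit lam a"
  proof (intro add_mono mult_left_mono)
    show "integral {0..T} (\<lambda>t. norm (mulop (\<lambda>x. cnj (V1 x)) (imul (q t)))) \<le> transit lam a"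
      by (rule mulop_transit[OF cV(1,3) lam _ iq iqe]) (simp_all add: norm_mult \<kappa>)
    show "integral {0..T} (\<lambda>t. norm (mulop (\<lambda>x. cnj (V2 x)) (imul (q t)))) \<le> transit lam a"
      by (rule mulop_transit[OF cV(2,4) lam _ iq iqe]) (simp_all add: norm_mult \<kappa>)
  qed (auto simp: \<rho>_def transit_nonneg[OF lam])
  finally show ?thesis unfolding eq by (simp add: \<rho>_def power2_eq_square)
qed

section \<open>The rescaled Born term and its limit\<close>

definition Z :: "real \<Rightarrow> 'a \<Rightarrow> real \<Rightarrow> complex" where
  "Z lam a t = (\<integral>x. (V1 x - V2 x) * of_real ((cmod (Wp lam a t x))\<^sup>2) \<partial>lborel)"

text \<open>The limit profile: the Gaussian is the squared modulus of a packet at its initial width,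
  including the constant \<open>\<epsilon>\<close> to the power \<open>- DIM('a)\<close> written as
  an exponential.\<close>

definition \<zeta> :: "'a \<Rightarrow> complex" where
  "\<zeta> b = (\<integral>x. (V1 x - V2 x) * of_real (exp (- (real DIM('a) * ln \<epsilon>) - (norm (x - b))\<^sup>2 / \<epsilon>)) \<partial>lborel)"

lemma D_le: "cmod (V1 x - V2 x) \<le> 2 * \<omega> (norm x)" "cmod (V1 x - V2 x) \<le> 2 * \<omega> 0"
  using norm_triangle_ineq4[of "V1 x" "V2 x"] V1B[of x] V2B[of x] V_le[of x] by auto

text \<open>For \<open>\<kappa> = 1\<close> the right side is \<open>- Im (Z lam a t)\<close>, for
  \<open>\<kappa> = \<i>\<close> it is \<open>Re (Z lam a t)\<close>: two test packets recover the
  complex integral from a real inner product.\<close>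

lemma inner_Z:
  "inner (imul (mulop (\<lambda>x. V1 x - V2 x) (wp lam a t))) (l2_of (\<lambda>x. \<kappa> * Wp lam a t x)) = Re (\<i> * cnj \<kappa> * Z lam a t)"
proof -
  note sW = packet.sqint_W[OF packet, of lam a t]
  have sD: "sqint (\<lambda>x. (V1 x - V2 x) * Wp lam a t x)"
    by (rule sqint_mult[OF sW, where C = "2 * \<omega> 0"]) (auto simp: D_le)
  have "mulop (\<lambda>x. V1 x - V2 x) (wp lam a t) = l2_of (\<lambda>x. (V1 x - V2 x) * Wp lam a t x)"
    unfolding packet.w_def[OF packet] by (rule mulop_l2_of[OF _ D_le(2) sW]) measurable
  then have "inner (imul (mulop (\<lambda>x. V1 x - V2 x) (wp lam a t))) (l2_of (\<lambda>x. \<kappa> * Wp lam a t x))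
      = Re (\<integral>x. \<i> * ((V1 x - V2 x) * Wp lam a t x) * cnj (\<kappa> * Wp lam a t x) \<partial>lborel)"
    by (simp only: imul_l2_of[OF sD] inner_l2_of[OF sqint_cmult[OF sD] sqint_cmult[OF sW]])
  also have "(\<integral>x. \<i> * ((V1 x - V2 x) * Wp lam a t x) * cnj (\<kappa> * Wp lam a t x) \<partial>lborel)
      = (\<integral>x. (\<i> * cnj \<kappa>) * ((V1 x - V2 x) * of_real ((cmod (Wp lam a t x))\<^sup>2)) \<partial>lborel)"
    by (rule Bochner_Integration.integral_cong) (simp_all only: complex_norm_square complex_cnj_mult mult_ac)
  also have "\<dots> = \<i> * cnj \<kappa> * Z lam a t"
    unfolding Z_def by (rule integral_mult_right_zero)
  finally show ?thesis .
qed

lemma Wp_square_le: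
  assumes "0 \<le> t" "t \<le> T"
  shows "(cmod (Wp lam a t x))\<^sup>2 \<le> (amp a)\<^sup>2 * exp (- (2 * norm (x - (2 * lam * t) *\<^sub>R \<theta>)))"
proof -
  have "(cmod (Wp lam a t x))\<^sup>2 \<le> (amp a * exp (- norm (x - (2 * lam * t) *\<^sub>R \<theta>)))\<^sup>2"
    by (rule power_mono[OF Wp_le[OF assms]]) simp
  then show ?thesis by (simp add: power_mult_distrib exp_double[symmetric])
qed

lemma Wp_measurable [measurable]: "Wp lam a t \<in> borel_measurable borel"
  by (rule packet.borel_W[OF packet])

text \<open>The bound depends on \<open>t\<close> and \<open>lam\<close> only through
  \<open>2 * lam * t\<close>, so it is one dominating function for all momenta after
  rescaling.\<close>

lemma Z_le:
  assumes t: "0 \<le> t" "t \<le> T" and lam: "0 < lam"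
  shows "cmod (Z lam a t) \<le> 2 * (amp a)\<^sup>2 * expmass TYPE('a) * dominator (2 * lam * t)"
proof -
  define \<sigma> where "\<sigma> = 2 * lam * t"
  have \<sigma>: "0 \<le> \<sigma>" using t lam by (simp add: \<sigma>_def)
  define M where "M = 2 * (amp a)\<^sup>2 * (\<omega> (\<sigma> / 2) + \<omega> 0 * exp (- (\<sigma> / 2)))"
  have bd: "norm ((V1 x - V2 x) * of_real ((cmod (Wp lam a t x))\<^sup>2)) \<le> M * exp (- norm (x - \<sigma> *\<^sub>R \<theta>))" for x
  proof -
    have "norm ((V1 x - V2 x) * of_real ((cmod (Wp lam a t x))\<^sup>2)) = cmod (V1 x - V2 x) * (cmod (Wp lam a t x))\<^sup>2"
      by (simp add: norm_mult norm_power)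
    also have "\<dots> \<le> cmod (V1 x - V2 x) * ((amp a)\<^sup>2 * exp (- (2 * norm (x - \<sigma> *\<^sub>R \<theta>))))"
      using Wp_square_le[OF t, of lam a x] by (intro mult_left_mono) (auto simp: \<sigma>_def)
    also have "\<dots> = 2 * (amp a)\<^sup>2 * ((cmod (V1 x - V2 x) / 2) * exp (- (2 * norm (x - \<sigma> *\<^sub>R \<theta>))))" by simp
    also have "\<dots> \<le> 2 * (amp a)\<^sup>2 * ((\<omega> (\<sigma> / 2) + \<omega> 0 * exp (- (\<sigma> / 2))) * exp (- norm (x - \<sigma> *\<^sub>R \<theta>)))"
      using D_le(1)[of x] by (intro mult_left_mono envelope_exp_le(1)[OF \<theta> \<sigma>]) auto
    finally show ?thesis by (simp only: M_def mult.assoc)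
  qed
  have "cmod (Z lam a t) \<le> (\<integral>x. M * exp (- norm (x - \<sigma> *\<^sub>R \<theta>)) \<partial>lborel)"
    unfolding Z_def
  proof (rule Bochner_Integration.integral_norm_bound_integral)
    show "integrable lborel (\<lambda>x. M * exp (- norm (x - \<sigma> *\<^sub>R \<theta>)))" by (intro integrable_mult_right exp_norm_shift)
    then show "integrable lborel (\<lambda>x. (V1 x - V2 x) * of_real ((cmod (Wp lam a t x))\<^sup>2))"
    proof (rule Bochner_Integration.integrable_bound)
      show "AE x in lborel. norm ((V1 x - V2 x) * of_real ((cmod (Wp lam a t x))\<^sup>2)) \<le> norm (M * exp (- norm (x - \<sigma> *\<^sub>R \<theta>)))"
        by (rule AE_I2) (rule order_trans[OF bd], simp)
    qed measurable
  qed (rule bd)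
  also have "\<dots> = M * expmass TYPE('a)" by (simp add: exp_norm_shift)
  also have "M \<le> 2 * (amp a)\<^sup>2 * dominator \<sigma>"
    unfolding M_def dominator_def using \<sigma> \<omega>_nonneg by (intro mult_left_mono) (auto intro!: mult_left_mono)
  finally show ?thesis using expmass_nonneg[where 'a='a] by (simp add: mult_right_mono mult_ac \<sigma>_def)
qed

text \<open>At fixed \<open>\<sigma>\<close> the physical time tends to 0, hence \<open>c\<close>
  tends to \<open>\<epsilon>\<close> and the packet is seen without spreading, while its centre
  stays at \<open>a + \<sigma> *\<^sub>R \<theta>\<close>.\<close>

lemma Z_limit:
  assumes \<sigma>: "0 \<le> \<sigma>"
  shows "(\<lambda>m. Z (real (Suc m)) a (\<sigma> / (2 * real (Suc m)))) \<longlonglongrightarrow> \<zeta> (a + \<sigma> *\<^sub>R \<theta>)"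
proof -
  \<comment> \<open>From the index \<open>N\<close> on, the physical time lies in
    \<open>{0..T}\<close>, where the packet bounds hold.\<close>
  obtain N where N: "\<sigma> / (2 * T) \<le> real N" using real_arch_simple by blast
  have tm: "0 \<le> \<sigma> / (2 * real (Suc m))" "\<sigma> / (2 * real (Suc m)) \<le> T" if "m \<ge> N" for m
  proof -
    have "\<sigma> / (2 * T) \<le> real (Suc m)" using N that by simp
    then show "\<sigma> / (2 * real (Suc m)) \<le> T" using T by (simp add: field_simps)
  qed (use \<sigma> in simp)
  have "(\<lambda>m. Z (real (Suc (m + N))) a (\<sigma> / (2 * real (Suc (m + N))))) \<longlonglongrightarrow> \<zeta> (a + \<sigma> *\<^sub>R \<theta>)"
    unfolding Z_def \<zeta>_def
  proof (rule integral_dominated_convergence[where w = "\<lambda>x. (2 * \<omega> 0 * (amp a)\<^sup>2) * exp (- norm (x - \<sigma> *\<^sub>R \<theta>))"])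
    show "integrable lborel (\<lambda>x. (2 * \<omega> 0 * (amp a)\<^sup>2) * exp (- norm (x - \<sigma> *\<^sub>R \<theta>)))"
      by (intro integrable_mult_right exp_norm_shift)
    show "AE x in lborel. (\<lambda>m. (V1 x - V2 x) * of_real ((cmod (Wp (real (Suc (m + N))) a (\<sigma> / (2 * real (Suc (m + N)))) x))\<^sup>2))
      \<longlonglongrightarrow> (V1 x - V2 x) * of_real (exp (- (real DIM('a) * ln \<epsilon>) - (norm (x - (a + \<sigma> *\<^sub>R \<theta>)))\<^sup>2 / \<epsilon>))"
    proof (rule AE_I2)
      fix x
      define s where "s m = \<sigma> / (2 * real (Suc (m + N)))" for m
      have s0: "s \<longlonglongrightarrow> 0"
      proof -
        have "(\<lambda>m. (\<sigma> / 2) * (1 / real (Suc (m + N)))) \<longlonglongrightarrow> (\<sigma> / 2) * 0"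
          using LIMSEQ_ignore_initial_segment[OF LIMSEQ_Suc[OF lim_1_over_n[where 'a = real]], of N] by (intro tendsto_intros) simp
        then show ?thesis by (simp add: s_def[abs_def] field_simps)
      qed
      have y: "packet.y lam a \<theta> (\<sigma> / (2 * lam)) x = x - (a + \<sigma> *\<^sub>R \<theta>)" if "lam > 0" for lam
        using that by (simp add: packet.y_def[OF packet])
      have "(\<lambda>m. packet.c \<epsilon> (s m)) \<longlonglongrightarrow> packet.c \<epsilon> 0"
        unfolding packet.c_def[OF packet] by (intro tendsto_intros s0)
      moreover have c0: "packet.c \<epsilon> 0 = of_real \<epsilon>" by (simp add: packet.c_def[OF packet] complex_eq_iff)
      ultimately have c: "(\<lambda>m. cmod (packet.c \<epsilon> (s m))) \<longlonglongrightarrow> \<epsilon>" using tendsto_norm \<epsilon> by fastforce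
      have W: "(cmod (Wp (real (Suc (m + N))) a (s m) x))\<^sup>2 =
          exp (- (real DIM('a) * ln (cmod (packet.c \<epsilon> (s m)))) - \<epsilon> * (norm (x - (a + \<sigma> *\<^sub>R \<theta>)))\<^sup>2 / (cmod (packet.c \<epsilon> (s m)))\<^sup>2)" for m
        unfolding packet.cmod_W_square[OF packet] s_def by (subst y) auto
      have "(\<lambda>m. (cmod (Wp (real (Suc (m + N))) a (s m) x))\<^sup>2) \<longlonglongrightarrow>
          exp (- (real DIM('a) * ln \<epsilon>) - \<epsilon> * (norm (x - (a + \<sigma> *\<^sub>R \<theta>)))\<^sup>2 / \<epsilon>\<^sup>2)"
        unfolding W by (intro tendsto_intros c) (use \<epsilon> in auto)
      also have "\<epsilon> * (norm (x - (a + \<sigma> *\<^sub>R \<theta>)))\<^sup>2 / \<epsilon>\<^sup>2 = (norm (x - (a + \<sigma> *\<^sub>R \<theta>)))\<^sup>2 / \<epsilon>"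
        using \<epsilon> by (simp add: power2_eq_square)
      finally show "(\<lambda>m. (V1 x - V2 x) * of_real ((cmod (Wp (real (Suc (m + N))) a (\<sigma> / (2 * real (Suc (m + N)))) x))\<^sup>2))
        \<longlonglongrightarrow> (V1 x - V2 x) * of_real (exp (- (real DIM('a) * ln \<epsilon>) - (norm (x - (a + \<sigma> *\<^sub>R \<theta>)))\<^sup>2 / \<epsilon>))"
        unfolding s_def by (intro tendsto_intros)
    qed
    show "AE x in lborel. norm ((V1 x - V2 x) * of_real ((cmod (Wp (real (Suc (m + N))) a (\<sigma> / (2 * real (Suc (m + N)))) x))\<^sup>2))
        \<le> (2 * \<omega> 0 * (amp a)\<^sup>2) * exp (- norm (x - \<sigma> *\<^sub>R \<theta>))" for m
    proof (rule AE_I2)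
      fix x
      have "(cmod (Wp (real (Suc (m + N))) a (\<sigma> / (2 * real (Suc (m + N)))) x))\<^sup>2
          \<le> (amp a)\<^sup>2 * exp (- (2 * norm (x - (2 * real (Suc (m + N)) * (\<sigma> / (2 * real (Suc (m + N))))) *\<^sub>R \<theta>)))"
        by (rule Wp_square_le) (rule tm, simp)+
      also have "2 * real (Suc (m + N)) * (\<sigma> / (2 * real (Suc (m + N)))) = \<sigma>" by simp
      also have "(amp a)\<^sup>2 * exp (- (2 * norm (x - \<sigma> *\<^sub>R \<theta>))) \<le> (amp a)\<^sup>2 * exp (- norm (x - \<sigma> *\<^sub>R \<theta>))"
        by (intro mult_left_mono) auto
      finally have "cmod (V1 x - V2 x) * (cmod (Wp (real (Suc (m + N))) a (\<sigma> / (2 * real (Suc (m + N)))) x))\<^sup>2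
          \<le> (2 * \<omega> 0) * ((amp a)\<^sup>2 * exp (- norm (x - \<sigma> *\<^sub>R \<theta>)))"
        by (intro mult_mono D_le) (auto simp: \<omega>_nonneg)
      then show "norm ((V1 x - V2 x) * of_real ((cmod (Wp (real (Suc (m + N))) a (\<sigma> / (2 * real (Suc (m + N)))) x))\<^sup>2))
        \<le> (2 * \<omega> 0 * (amp a)\<^sup>2) * exp (- norm (x - \<sigma> *\<^sub>R \<theta>))"
        by (simp add: norm_mult norm_power mult.assoc)
    qed
  qed measurable
  then show ?thesis by (rule LIMSEQ_offset)
qed

text \<open>The integral of \<open>s m\<close> is \<open>2 * Suc m\<close> times a Born term of
  order \<open>1 / (Suc m)^2\<close>, so it tends to 0. The integrands converge by
  \<open>Z_limit\<close> and are dominated through \<open>Z_le\<close>, so it also tends to the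
  half-line integral.\<close>

lemma half_line_integral:
  assumes \<kappa>: "\<kappa> = 1 \<or> \<kappa> = \<i>"
  shows "integrable lborel (\<lambda>\<sigma>. indicat_real {0..} \<sigma> * Re (\<i> * cnj \<kappa> * \<zeta> (a + \<sigma> *\<^sub>R \<theta>)))"
    and "(\<integral>\<sigma>. indicat_real {0..} \<sigma> * Re (\<i> * cnj \<kappa> * \<zeta> (a + \<sigma> *\<^sub>R \<theta>)) \<partial>lborel) = 0"
proof -
  have \<kappa>1: "cmod \<kappa> = 1" using \<kappa> by auto
  have ReB: "\<bar>Re (\<i> * cnj \<kappa> * z)\<bar> \<le> cmod z" for z
    using abs_Re_le_cmod[of "\<i> * cnj \<kappa> * z"] \<kappa>1 by (simp add: norm_mult)
  define P where "P m t = Re (\<i> * cnj \<kappa> * Z (real (Suc m)) a t)" for m t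
  have born: "\<bar>integral {0..T} (P m)\<bar> \<le> 2 * exp (\<omega> 0 * T) * (transit (real (Suc m)) a)\<^sup>2"
    and Pc: "continuous_on UNIV (P m)" for m
  proof -
    let ?l = "real (Suc m)"
    note L = packet.w_lapgen[OF packet, of ?l a] packet.w_derivative[OF packet, of ?l a]
    have ex: "\<exists>q q'. (\<forall>t. q t = l2_of (\<lambda>x. \<kappa> * Wp ?l a t x)) \<and> (\<forall>t. generates (q t) (q' t)) \<and> (\<forall>t. (q has_vector_derivative q' t) (at t))"
      using \<kappa>
    proof
      assume "\<kappa> = 1"
      then show ?thesis
        using gen[OF L(1)] L(2) wp_eq[of ?l a] by (intro exI[of _ "wp ?l a"] exI) (intro conjI allI; simp)
    next
      assume k: "\<kappa> = \<i>"
      have "imul (wp ?l a t) = l2_of (\<lambda>x. \<kappa> * Wp ?l a t x)" for t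
        unfolding packet.w_def[OF packet] k by (rule imul_l2_of[OF packet.sqint_W[OF packet]])
      then show ?thesis
        using gen[OF lapgen_imul[OF L(1)]] bounded_linear.has_vector_derivative[OF imul_bounded_linear L(2)]
        by (intro exI[of _ "\<lambda>t. imul (wp ?l a t)"] exI) (intro conjI allI; simp)
    qed
    then obtain q q' where q: "\<And>t. q t = l2_of (\<lambda>x. \<kappa> * Wp ?l a t x)" "\<And>t. generates (q t) (q' t)"
      "\<And>t. (q has_vector_derivative q' t) (at t)" by blast
    have Pq: "P m = (\<lambda>t. inner (imul (mulop (\<lambda>x. V1 x - V2 x) (wp ?l a t))) (q t))"
      unfolding P_def[abs_def] q inner_Z ..
    show "\<bar>integral {0..T} (P m)\<bar> \<le> 2 * exp (\<omega> 0 * T) * (transit ?l a)\<^sup>2"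
      unfolding Pq by (rule born_estimate[OF _ \<kappa>1 q]) simp
    have "continuous_on UNIV q"
      by (rule has_vector_derivative_imp_continuous_on[OF q(3)])
    moreover have "bounded_linear (mulop (\<lambda>x. V1 x - V2 x))"
      by (rule mulop_bounded_linear[OF _ D_le(2)]) measurable
    ultimately show "continuous_on UNIV (P m)"
      unfolding Pq by (intro continuous_intros bounded_linear.continuous_on[OF imul_bounded_linear]
        bounded_linear.continuous_on[of "mulop (\<lambda>x. V1 x - V2 x)"] wp_continuous)
  qed
  have Pm [measurable]: "P m \<in> borel_measurable borel" for m by (rule borel_measurable_continuous_onI[OF Pc])
  \<comment> \<open>The Born integrand in the variable \<open>\<sigma>\<close>, extended by zero
    past the physical time \<open>T\<close>, so that all \<open>m\<close> share one domain of
    integration.\<close>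
  define s where "s m \<sigma> = indicat_real {0..T} (\<sigma> / (2 * real (Suc m))) * P m (\<sigma> / (2 * real (Suc m)))" for m \<sigma>
  have sm [measurable]: "s m \<in> borel_measurable borel" for m unfolding s_def by measurable
  have sint: "(\<integral>\<sigma>. s m \<sigma> \<partial>lborel) = 2 * real (Suc m) * integral {0..T} (P m)" for m
  proof -
    have si: "set_integrable lborel {0..T} (P m)"
      by (rule borel_integrable_atLeastAtMost'[OF continuous_on_subset[OF Pc]]) simp
    have "integral {0..T} (P m) = (\<integral>t. indicat_real {0..T} t * P m t \<partial>lborel)"
      using set_borel_integral_eq_integral(2)[OF si] by (simp add: set_lebesgue_integral_def)
    also have "\<dots> = \<bar>1 / (2 * real (Suc m))\<bar> *\<^sub>R (\<integral>\<sigma>. indicat_real {0..T} (0 + (1 / (2 * real (Suc m))) * \<sigma>) * P m (0 + (1 / (2 * real (Suc m))) * \<sigma>) \<partial>lborel)"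
      by (rule lborel_integral_real_affine) simp
    also have "\<dots> = (1 / (2 * real (Suc m))) * (\<integral>\<sigma>. s m \<sigma> \<partial>lborel)" by (simp add: s_def)
    finally show ?thesis by simp
  qed
  have lim0: "(\<lambda>m. \<integral>\<sigma>. s m \<sigma> \<partial>lborel) \<longlonglongrightarrow> 0"
  proof (rule Lim_null_comparison)
    \<comment> \<open>Since \<open>2 * r * (2 * E * (A / (2 * r))\<^sup>2)\<close> equals
      \<open>E * A\<^sup>2 / r\<close>, all factors free of \<open>r\<close> are collected
      here.\<close>
    define B where "B = exp (\<omega> 0 * T) * (amp a * sqrt (expmass TYPE('a)) * total)\<^sup>2"
    have "norm (\<integral>\<sigma>. s m \<sigma> \<partial>lborel) \<le> B * (1 / real (Suc m))" for m
    proof -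
      have "norm (\<integral>\<sigma>. s m \<sigma> \<partial>lborel) \<le> 2 * real (Suc m) * (2 * exp (\<omega> 0 * T) * (transit (real (Suc m)) a)\<^sup>2)"
        unfolding sint using born[of m] by (simp add: abs_mult mult_left_mono)
      also have "\<dots> = B * (1 / real (Suc m))"
      proof -
        have "2 * r * (2 * E * (A / (2 * r))\<^sup>2) = E * A\<^sup>2 * (1 / r)" if "0 < r" for r E A :: real
          using that by (simp add: power2_eq_square field_simps)
        from this[of "real (Suc m)"] show ?thesis unfolding B_def transit_def by (simp only: of_nat_0_less_iff zero_less_Suc)
      qed
      finally show ?thesis .
    qed
    then show "\<forall>\<^sub>F m in sequentially. norm (\<integral>\<sigma>. s m \<sigma> \<partial>lborel) \<le> B * (1 / real (Suc m))" by simp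
    show "(\<lambda>m. B * (1 / real (Suc m))) \<longlonglongrightarrow> 0"
      using tendsto_mult_right_zero[OF LIMSEQ_Suc[OF lim_1_over_n[where 'a = real]]] by simp
  qed
  have \<zeta>lim: "(\<lambda>m. s m \<sigma>) \<longlonglongrightarrow> indicat_real {0..} \<sigma> * Re (\<i> * cnj \<kappa> * \<zeta> (a + \<sigma> *\<^sub>R \<theta>))" for \<sigma> :: real
    proof (cases "0 \<le> \<sigma>")
      case True
      obtain N where N: "\<sigma> / (2 * T) \<le> real N" using real_arch_simple by blast
      have sP: "s m \<sigma> = P m (\<sigma> / (2 * real (Suc m)))" if "m \<ge> N" for m
      proof -
        have "\<sigma> / (2 * T) \<le> real (Suc m)" using N that by simp
        then have "\<sigma> / (2 * real (Suc m)) \<le> T" using T by (simp add: field_simps)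
        then show ?thesis using True by (simp add: s_def)
      qed
      have ev: "\<forall>\<^sub>F m in sequentially. P m (\<sigma> / (2 * real (Suc m))) = s m \<sigma>"
        unfolding eventually_sequentially by (intro exI[of _ N] allI impI sP[symmetric])
      have "(\<lambda>m. P m (\<sigma> / (2 * real (Suc m)))) \<longlonglongrightarrow> Re (\<i> * cnj \<kappa> * \<zeta> (a + \<sigma> *\<^sub>R \<theta>))"
        unfolding P_def by (intro tendsto_intros Z_limit True)
      then show ?thesis using Lim_transform_eventually[OF _ ev] True by simp
    next
      case False
      then have "s m \<sigma> = 0" for m by (simp add: s_def zero_le_divide_iff)
      then show ?thesis using False by simp
    qed
  have dom: "AE \<sigma> in lborel. norm (s m \<sigma>) \<le> 2 * (amp a)\<^sup>2 * expmass TYPE('a) * dominator \<sigma>" for m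
  proof (rule AE_I2)
    fix \<sigma> :: real
    show "norm (s m \<sigma>) \<le> 2 * (amp a)\<^sup>2 * expmass TYPE('a) * dominator \<sigma>"
    proof (cases "\<sigma> / (2 * real (Suc m)) \<in> {0..T}")
      case True
      then have "norm (s m \<sigma>) \<le> cmod (Z (real (Suc m)) a (\<sigma> / (2 * real (Suc m))))"
        using ReB by (simp add: s_def P_def)
      also have "\<dots> \<le> 2 * (amp a)\<^sup>2 * expmass TYPE('a) * dominator (2 * real (Suc m) * (\<sigma> / (2 * real (Suc m))))"
        by (rule Z_le) (use True in auto)
      finally show ?thesis by simp
    next
      case False
      then show ?thesis using expmass_nonneg[where 'a='a] dominator_nonneg by (simp add: s_def)
    qed
  qed
  have "(\<lambda>\<sigma>. indicat_real {0..} \<sigma> * Re (\<i> * cnj \<kappa> * \<zeta> (a + \<sigma> *\<^sub>R \<theta>))) \<in> borel_measurable lborel"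
    by (rule borel_measurable_LIMSEQ_real[where u = s, OF \<zeta>lim]) simp
  moreover have "integrable lborel (\<lambda>\<sigma>. 2 * (amp a)\<^sup>2 * expmass TYPE('a) * dominator \<sigma>)"
    by (intro integrable_mult_right dominator_integrable)
  moreover have "s m \<in> borel_measurable lborel" for m by simp
  ultimately have DC: "integrable lborel (\<lambda>\<sigma>. indicat_real {0..} \<sigma> * Re (\<i> * cnj \<kappa> * \<zeta> (a + \<sigma> *\<^sub>R \<theta>)))"
    "(\<lambda>m. \<integral>\<sigma>. s m \<sigma> \<partial>lborel) \<longlonglongrightarrow> (\<integral>\<sigma>. indicat_real {0..} \<sigma> * Re (\<i> * cnj \<kappa> * \<zeta> (a + \<sigma> *\<^sub>R \<theta>)) \<partial>lborel)"
    using integrable_dominated_convergence[of _ lborel s, OF _ _ _ AE_I2[OF \<zeta>lim] dom]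
      integral_dominated_convergence[of _ lborel s, OF _ _ _ AE_I2[OF \<zeta>lim] dom] by blast+
  show "integrable lborel (\<lambda>\<sigma>. indicat_real {0..} \<sigma> * Re (\<i> * cnj \<kappa> * \<zeta> (a + \<sigma> *\<^sub>R \<theta>)))" by (rule DC)
  show "(\<integral>\<sigma>. indicat_real {0..} \<sigma> * Re (\<i> * cnj \<kappa> * \<zeta> (a + \<sigma> *\<^sub>R \<theta>)) \<partial>lborel) = 0"
    by (rule LIMSEQ_unique[OF DC(2) lim0])
qed

text \<open>Subtracting the half-line integrals that start at \<open>a\<close> and at
  \<open>a + r *\<^sub>R \<theta>\<close> leaves a vanishing integral over the segment between them.
  A continuous function with vanishing integrals over all short segments from 0 is 0 there.\<close>

lemma \<zeta>_zero:
  assumes sD: "sqint (\<lambda>x. V1 x - V2 x)"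
  shows "\<zeta> a = 0"
proof -
  have vanish: "Re (\<i> * cnj \<kappa> * \<zeta> a) = 0" if \<kappa>: "\<kappa> = 1 \<or> \<kappa> = \<i>" for \<kappa>
  proof -
    define \<phi> where "\<phi> \<sigma> = Re (\<i> * cnj \<kappa> * \<zeta> (a + \<sigma> *\<^sub>R \<theta>))" for \<sigma>
    define g where "g x = complex_of_real (exp (- ((1 / \<epsilon>) * (norm x)\<^sup>2)))" for x :: 'a
    have sg: "sqint g"
    proof (rule sqint_bound)
      show "g \<in> borel_measurable borel" unfolding g_def by measurable
      show "integrable lborel (\<lambda>x::'a. exp (- ((1 / \<epsilon>) * (norm x)\<^sup>2)))"
        by (rule integrable_gaussian) (use \<epsilon> in simp)
      show "AE x in lborel. (cmod (g x))\<^sup>2 \<le> exp (- ((1 / \<epsilon>) * (norm x)\<^sup>2))"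
      proof (rule AE_I2)
        fix x :: 'a
        have "exp (- ((1 / \<epsilon>) * (norm x)\<^sup>2)) \<le> 1" using \<epsilon> by simp
        then have "exp (- ((1 / \<epsilon>) * (norm x)\<^sup>2)) * exp (- ((1 / \<epsilon>) * (norm x)\<^sup>2)) \<le> exp (- ((1 / \<epsilon>) * (norm x)\<^sup>2)) * 1"
          by (intro mult_left_mono) auto
        then show "(cmod (g x))\<^sup>2 \<le> exp (- ((1 / \<epsilon>) * (norm x)\<^sup>2))"
          unfolding g_def norm_of_real by (simp add: power2_eq_square)
      qed
    qed
    \<comment> \<open>As an inner product with a translated Gaussian, the value is continuous in
      \<open>b\<close> by the strong continuity of translations.\<close>
    have rep: "Re (\<i> * cnj \<kappa> * \<zeta> b) = exp (- (real DIM('a) * ln \<epsilon>)) *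
        inner (l2_of (\<lambda>x. (\<i> * cnj \<kappa>) * (V1 x - V2 x))) (translate (- b) (l2_of g))" for b
    proof -
      have "\<zeta> b = (\<integral>x. of_real (exp (- (real DIM('a) * ln \<epsilon>))) * ((V1 x - V2 x) * cnj (g (x + - b))) \<partial>lborel)"
        unfolding \<zeta>_def g_def
        by (rule Bochner_Integration.integral_cong) (auto simp: exp_diff exp_minus divide_inverse)
      also have "\<dots> = of_real (exp (- (real DIM('a) * ln \<epsilon>))) * (\<integral>x. (V1 x - V2 x) * cnj (g (x + - b)) \<partial>lborel)"
        by (rule integral_mult_right_zero)
      finally have 1: "\<i> * cnj \<kappa> * \<zeta> b = of_real (exp (- (real DIM('a) * ln \<epsilon>))) * ((\<i> * cnj \<kappa>) * (\<integral>x. (V1 x - V2 x) * cnj (g (x + - b)) \<partial>lborel))"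
        by simp
      have "(\<i> * cnj \<kappa>) * (\<integral>x. (V1 x - V2 x) * cnj (g (x + - b)) \<partial>lborel) = (\<integral>x. (\<i> * cnj \<kappa>) * ((V1 x - V2 x) * cnj (g (x + - b))) \<partial>lborel)"
        by (rule integral_mult_right_zero[symmetric])
      also have "\<dots> = (\<integral>x. ((\<i> * cnj \<kappa>) * (V1 x - V2 x)) * cnj (g (x + - b)) \<partial>lborel)"
        by (simp only: mult.assoc)
      finally have "Re ((\<i> * cnj \<kappa>) * (\<integral>x. (V1 x - V2 x) * cnj (g (x + - b)) \<partial>lborel))
          = inner (l2_of (\<lambda>x. (\<i> * cnj \<kappa>) * (V1 x - V2 x))) (translate (- b) (l2_of g))"
        by (simp only: translate_l2_of[OF sg] inner_l2_of[OF sqint_cmult[OF sD] sqint_shift[OF sg]])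
      moreover have "Re (of_real r * z) = r * Re z" for r z by simp
      ultimately show ?thesis unfolding 1 by (simp only:)
    qed
    have \<phi>c: "continuous_on UNIV \<phi>"
      unfolding \<phi>_def rep
      by (intro continuous_intros continuous_on_compose2[OF translate_continuous]) auto
    have [measurable]: "\<phi> \<in> borel_measurable borel" by (rule borel_measurable_continuous_onI[OF \<phi>c])
    have tail: "integrable lborel (\<lambda>\<sigma>. indicat_real {r..} \<sigma> * \<phi> \<sigma>)"
      "(\<integral>\<sigma>. indicat_real {r..} \<sigma> * \<phi> \<sigma> \<partial>lborel) = 0" for r
    proof -
      have e: "indicat_real {0..} \<sigma> * Re (\<i> * cnj \<kappa> * \<zeta> ((a + r *\<^sub>R \<theta>) + \<sigma> *\<^sub>R \<theta>)) = indicat_real {r..} (\<sigma> + r) * \<phi> (\<sigma> + r)" for \<sigma>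
        by (auto simp: \<phi>_def indicator_def scaleR_add_left add_ac)
      have i: "integrable lborel (\<lambda>\<sigma>. indicat_real {r..} (\<sigma> + r) * \<phi> (\<sigma> + r))"
        and z: "(\<integral>\<sigma>. indicat_real {r..} (\<sigma> + r) * \<phi> (\<sigma> + r) \<partial>lborel) = 0"
        using half_line_integral[OF \<kappa>, of "a + r *\<^sub>R \<theta>"] unfolding e by auto
      show "integrable lborel (\<lambda>\<sigma>. indicat_real {r..} \<sigma> * \<phi> \<sigma>)"
        using integrable_lborel_shift[OF i, of "- r"] by simp
      show "(\<integral>\<sigma>. indicat_real {r..} \<sigma> * \<phi> \<sigma> \<partial>lborel) = 0"
        using integral_lborel_shift[of "\<lambda>\<sigma>. indicat_real {r..} \<sigma> * \<phi> \<sigma>" r] z by simp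
    qed
    have int0: "integral {0..r} \<phi> = 0" if "r \<in> {0..1}" for r
    proof -
      have si: "set_integrable lborel {0..r} \<phi>"
        by (rule borel_integrable_atLeastAtMost'[OF continuous_on_subset[OF \<phi>c]]) simp
      have "integral {0..r} \<phi> = (\<integral>\<sigma>. indicat_real {0..r} \<sigma> * \<phi> \<sigma> \<partial>lborel)"
        using set_borel_integral_eq_integral(2)[OF si] by (simp add: set_lebesgue_integral_def)
      also have "\<dots> = (\<integral>\<sigma>. indicat_real {0..} \<sigma> * \<phi> \<sigma> - indicat_real {r..} \<sigma> * \<phi> \<sigma> \<partial>lborel)"
      proof (rule integral_cong_AE)
        have "AE \<sigma> in lborel. \<sigma> \<noteq> r" by (rule AE_lborel_singleton)
        then show "AE \<sigma> in lborel. indicat_real {0..r} \<sigma> * \<phi> \<sigma> = indicat_real {0..} \<sigma> * \<phi> \<sigma> - indicat_real {r..} \<sigma> * \<phi> \<sigma>"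
          by eventually_elim (use that in \<open>auto simp: indicator_def\<close>)
      qed measurable
      also have "\<dots> = 0" by (subst Bochner_Integration.integral_diff) (simp_all add: tail)
      finally show ?thesis .
    qed
    \<comment> \<open>The segments run forward from 0, so a one-sided derivative is
      compared.\<close>
    have "((\<lambda>r. integral {0..r} \<phi>) has_vector_derivative \<phi> 0) (at 0 within {0..1})"
      by (rule integral_has_vector_derivative) (auto intro: continuous_on_subset[OF \<phi>c])
    then have "((\<lambda>r. 0) has_vector_derivative \<phi> 0) (at (0::real) within {0..1})"
      by (rule has_vector_derivative_transform_within[where d = 1]) (auto simp: int0)
    then have "\<phi> 0 = 0"
      using vector_derivative_unique_within[of "0::real" "{0..1}" "\<lambda>r. 0" "\<phi> 0" 0] has_vector_derivative_const
      by (auto simp: trivial_limit_within islimpt_Icc)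
    then show ?thesis by (simp add: \<phi>_def)
  qed
  have "Im (\<zeta> a) = 0" "Re (\<zeta> a) = 0" using vanish[of 1] vanish[of \<i>] by auto
  then show ?thesis by (simp add: complex_eq_iff)
qed

lemma gaussian_average_zero:
  assumes "sqint (\<lambda>x. V1 x - V2 x)"
  shows "(\<integral>x. (V1 x - V2 x) * of_real (exp (- ((norm (x - a))\<^sup>2 / \<epsilon>))) \<partial>lborel) = 0"
proof -
  have "\<zeta> a = (\<integral>x. of_real (exp (- (real DIM('a) * ln \<epsilon>))) * ((V1 x - V2 x) * of_real (exp (- ((norm (x - a))\<^sup>2 / \<epsilon>)))) \<partial>lborel)"
    unfolding \<zeta>_def
    by (rule Bochner_Integration.integral_cong) (auto simp: exp_diff exp_minus divide_inverse)
  also have "\<dots> = of_real (exp (- (real DIM('a) * ln \<epsilon>))) * (\<integral>x. (V1 x - V2 x) * of_real (exp (- ((norm (x - a))\<^sup>2 / \<epsilon>))) \<partial>lborel)"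
    by (rule integral_mult_right_zero)
  finally show ?thesis using \<zeta>_zero[OF assms, of a] by simp
qed

end

section \<open>Uniqueness\<close>

text \<open>Setting a Borel version to 0 wherever it exceeds the envelope changes it on a null set
  only and makes the bound hold at every point, the form in which the multiplication operators take
  it.\<close>

lemma bounded_borel_version:
  fixes V :: "real^'n \<Rightarrow> complex"
  assumes V: "L1 V" and \<omega>: "envelope \<omega>" "AE x in lebesgue. cmod (V x) \<le> \<omega> (norm x)"
  obtains V' where "V' \<in> borel_measurable borel" "\<And>x. cmod (V' x) \<le> \<omega> (norm x)"
    "AE x in lebesgue. V x = V' x" "integrable lborel V'"
proof -
  have Vm: "V \<in> borel_measurable lebesgue" and Vi: "integrable lebesgue V" using V by (auto simp: L1_def)
  obtain V0 where [measurable]: "V0 \<in> borel_measurable borel" and V0: "AE x in lborel. V x = V0 x"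
    by (rule borel_version[OF Vm])
  have [measurable]: "\<omega> \<in> borel_measurable borel" and nn: "0 \<le> \<omega> r" for r using \<omega>(1) by (auto simp: envelope_def)
  define V' where "V' x = (if cmod (V0 x) \<le> \<omega> (norm x) then V0 x else 0)" for x
  have m: "V' \<in> borel_measurable borel" unfolding V'_def by measurable
  have ae: "AE x in lebesgue. V x = V' x"
    using AE_completion[OF V0] \<omega>(2) by eventually_elim (simp add: V'_def)
  have "V' \<in> borel_measurable lebesgue" using m by (intro measurable_completion) simp
  from integrable_cong_AE[OF Vm this ae, THEN iffD1, OF Vi]
  have "integrable lborel V'" using m by (subst (asm) integrable_completion) auto
  moreover have "cmod (V' x) \<le> \<omega> (norm x)" for x using nn by (simp add: V'_def)
  ultimately show ?thesis using that m ae by blast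
qed

theorem mainTheorem1:
  fixes V1 V2 :: "real^'n \<Rightarrow> complex" and T :: real
  assumes "CARD('n) \<ge> 2" and "T > 0"
    and "L1 V1" "Linf V1" "L1 V2" "Linf V2"
    and "summable (\<lambda>k. 2^k * Linf_norm_on V1 (annulus k))"
    and "summable (\<lambda>k. 2^k * Linf_norm_on V2 (annulus k))"
    and "same_final_map V1 V2 T"
  shows "AE x in lebesgue. V1 x = V2 x"
proof -
  obtain \<omega>1 where \<omega>1: "envelope \<omega>1" "AE x in lebesgue. cmod (V1 x) \<le> \<omega>1 (norm x)"
    by (rule envelope_exists[OF assms(4,7)])
  obtain \<omega>2 where \<omega>2: "envelope \<omega>2" "AE x in lebesgue. cmod (V2 x) \<le> \<omega>2 (norm x)"
    by (rule envelope_exists[OF assms(6,8)])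
  \<comment> \<open>A common envelope lets one dominating function serve both potentials.\<close>
  define \<omega> where "\<omega> r = \<omega>1 r + \<omega>2 r" for r
  have \<omega>: "envelope \<omega>" unfolding \<omega>_def[abs_def] by (rule envelope_add[OF \<omega>1(1) \<omega>2(1)])
  have nn: "0 \<le> \<omega>1 r" "0 \<le> \<omega>2 r" for r using \<omega>1(1) \<omega>2(1) by (auto simp: envelope_def)
  have "AE x in lebesgue. cmod (V1 x) \<le> \<omega> (norm x)"
    using \<omega>1(2) by eventually_elim (use nn in \<open>auto simp: \<omega>_def intro: add_increasing2\<close>)
  from bounded_borel_version[OF assms(3) \<omega> this] obtain W1 where W1: "W1 \<in> borel_measurable borel"
    "\<And>x. cmod (W1 x) \<le> \<omega> (norm x)" "AE x in lebesgue. V1 x = W1 x" "integrable lborel W1" by blast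
  have "AE x in lebesgue. cmod (V2 x) \<le> \<omega> (norm x)"
    using \<omega>2(2) by eventually_elim (use nn in \<open>auto simp: \<omega>_def intro: add_increasing\<close>)
  from bounded_borel_version[OF assms(5) \<omega> this] obtain W2 where W2: "W2 \<in> borel_measurable borel"
    "\<And>x. cmod (W2 x) \<le> \<omega> (norm x)" "AE x in lebesgue. V2 x = W2 x" "integrable lborel W2" by blast
  interpret radial_envelope \<omega> by (rule radial_envelope.intro[OF \<omega>])
  have C: "cmod (W1 x) \<le> \<omega> 0" "cmod (W2 x) \<le> \<omega> 0" for x
    using W1(2)[of x] W2(2)[of x] \<omega>_anti[of 0 "norm x"] by auto
  obtain U :: "real \<Rightarrow> (real^'n) l2 \<Rightarrow> (real^'n) l2" where U: "isometric_group U"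
    and gen: "\<And>a L. lapgen a L \<Longrightarrow> isometric_group.generates U a (imul L)"
    using schroedinger_group_exists by blast
  \<comment> \<open>Interaction picture solutions yield weak solutions with a common initial value,
    so the hypothesis on the final states applies to them; equality almost everywhere is then
    equality in \<open>l2\<close>.\<close>
  have same: "U T (v1 T) = U T (v2 T)"
    if "v1 0 = v2 0"
      and v1: "\<And>t. (v1 has_vector_derivative U (- t) (- imul (mulop W1 (U t (v1 t))))) (at t)"
      and v2: "\<And>t. (v2 has_vector_derivative U (- t) (- imul (mulop W2 (U t (v2 t))))) (at t)" for v1 v2
  proof -
    have m: "V1 \<in> borel_measurable lebesgue" "V2 \<in> borel_measurable lebesgue" using assms by (auto simp: L1_def)
    have "schrod_sol V1 T (rep_l2 (v1 0)) (\<lambda>t. rep_l2 (U t (v1 t)))"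
      by (rule schrod_sol_perturbed[OF m(1) U gen W1(1) C(1) W1(3) v1 assms(2)])
    moreover have "schrod_sol V2 T (rep_l2 (v1 0)) (\<lambda>t. rep_l2 (U t (v2 t)))"
      unfolding that(1) by (rule schrod_sol_perturbed[OF m(2) U gen W2(1) C(2) W2(3) v2 assms(2)])
    ultimately have "AE x in lebesgue. rep_l2 (U T (v1 T)) x = rep_l2 (U T (v2 T)) x"
      using assms(9) L2_rep unfolding same_final_map_def by blast
    then have "AE x in lborel. rep_l2 (U T (v1 T)) x = rep_l2 (U T (v2 T)) x" by (rule AE_completion_iff[THEN iffD1])
    then have "l2_of (rep_l2 (U T (v1 T))) = l2_of (rep_l2 (U T (v2 T)))" by (rule l2_of_cong)
    then show ?thesis by simp
  qed
  \<comment> \<open>One direction suffices, since the half lines may start at any point.\<close>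
  define \<theta> :: "real^'n" where "\<theta> = axis undefined 1"
  have \<theta>: "norm \<theta> = 1" by (simp add: \<theta>_def norm_eq_1 inner_axis_axis)
  have sc: "scattering \<omega> W1 W2 T \<epsilon> \<theta> U" if "\<epsilon> > 0" for \<epsilon>
    by (intro scattering.intro scattering_axioms.intro radial_envelope.intro packet.intro)
       (use \<omega> W1 W2 assms(2) that \<theta> U gen same in auto)
  have Dm: "(\<lambda>x. W1 x - W2 x) \<in> borel_measurable borel" using W1(1) W2(1) by measurable
  have DC: "cmod (W1 x - W2 x) \<le> 2 * \<omega> 0" for x
    using norm_triangle_ineq4[of "W1 x" "W2 x"] C[of x] by linarith
  have Di: "integrable lborel (\<lambda>x. W1 x - W2 x)" using W1(4) W2(4) by simp
  have sD: "sqint (\<lambda>x. W1 x - W2 x)"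
  proof (rule sqint_bound[OF Dm])
    show "integrable lborel (\<lambda>x. 2 * \<omega> 0 * norm (W1 x - W2 x))" using Di by simp
    show "AE x in lborel. (cmod (W1 x - W2 x))\<^sup>2 \<le> 2 * \<omega> 0 * norm (W1 x - W2 x)"
      unfolding power2_eq_square by (intro AE_I2 mult_right_mono DC) simp
  qed
  have "AE x in lborel. W1 x - W2 x = 0"
    by (rule gaussian_averages_determine[OF Dm DC Di scattering.gaussian_average_zero[OF sc sD]])
  then have "AE x in lebesgue. W1 x - W2 x = 0" by (rule AE_completion)
  with W1(3) W2(3) show ?thesis by eventually_elim simp
qed

end
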